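(* Let $0<\eta\le1/3$, $\dfrac{[\ln N]^4}{N^{1-2\eta}}\ll\nu_N\lesssim1$ and $g_N\ll\nu_N^2N^{-\eta}[\ln N]^{-2}$. For any $N\in\mathbb N$ let $\{N_j\}_{j\in\mathbb Z}$ be occupation numbers of the intervals with respect to the ground state, i.e. an admissible sequence of $N$ with $E_{\mathrm{LS}}^{\mathrm{QM}}(N,\Lambda_N,g_N)=\sum_{j\in\mathbb Z}E_0^{\mathrm{QM}}(N_j,\tilde l_j,g_N)$, and let $\mathcal N_N^{>}:=\max_{j\in\mathbb Z}N_j$. Put $K(\eta):=10\cdot5^2\cdot\pi^2\eta^{-2}+1$ and $c_1(\eta):=90\,E^{\mathrm{GP}}(1,1,K(\eta))\,\eta^{-2}$. Then almost surely, for all but finitely many $N\in\mathbb N$, $$\frac{\mathcal N_N^{>}}{\tilde\ell_N^{>}}\le\sqrt{8c_1(\eta)}\,\frac{\nu_N^{3/2}}{\ln N}\,\frac{1}{[\ln(\nu_NN)]^{1/2}}\left(\min\Big\{g_N,\frac{\nu_N}{N^{1/3}[\ln N]^2}\Big\}\right)^{-1/2}N^{1/2}$$ (the right-hand side being read as $+\infty$ if $g_N=0$). Furthermore, if $\eta<1/6$ and $g_N\gg\nu_NN^{-1/6}[\ln N]^{-2}$, then for any $\delta>0$, almost surely and for all but finitely many $N\in\mathbb N$, $$\frac{\mathcal N_N^{>}}{\tilde\ell_N^{>}}\le\sqrt{8c_1(\eta)}\,\frac{\nu_N}{[\ln(\nu_NN)]^{1/2}}\,N^{3/5+\delta}.$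$
   Context: **Random intervals.** Fix $\nu>0$ and $\rho>0$. Let $X(\omega)=\{x_j(\omega):j\in\mathbb Z\}$ be a Poisson point process on $\mathbb R$ with intensity $\nu$ on a probability space $(\Omega,\mathcal F,\mathbb P)$, with the points enumerated in strictly increasing order such that $0\in(x_0(\omega),x_1(\omega))$. Let $(s_N)_{N\in\mathbb N}$ be a real sequence with $0<s_N\le 1$ and put $\nu_N:=\nu s_N$. For $N\in\mathbb N$ let $L_N:=N/\rho$, $\Lambda_N:=(-L_N/2,L_N/2)$, $\widetilde W_j:=(s_N^{-1}x_j(\omega),s_N^{-1}x_{j+1}(\omega))\cap\Lambda_N$, $\tilde l_j:=|\widetilde W_j|$ (depending on $N,\omega$) and $\tilde\ell_N^{>}:=\max\{\tilde l_j:j\in\mathbb Z\}$. Let $(g_N)_{N\in\mathbb N}$ be a sequence with $g_N\ge0$. **Asymptotic notation.** $a_N\ll b_N$ (equivalently $b_N\gg a_N$) means $a_N/b_N\to0$; $a_N\sim b_N$ means $c\le a_N/b_N\le C$ for some constants $c,C>0$ and all but finitely many $N$; $a_N\lesssim b_N$ means $a_N\sim b_N$ or $a_N\ll b_N$. **Many-body energies.** For $n\in\mathbb N$, $g\ge0$ and an interval $W$ of length $l>0$, $H(n,l,g)=-\sum_{i=1}^n\partial_{z_i}^2+g\sum_{1\le i<k\le n}\delta(z_i-z_k)$ is the operator on the symmetric subspace of $L^2(W^n)$ associated with the quadratic form $\int_{W^n}|\nabla\psi|^2+g\sum_{i<k}\int_{\{z_i=z_k\}}|\psi|^2$ on symmetric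 $\psi\in H^1_0(W^n)$ (Dirichlet boundary conditions). $E_0^{\mathrm{QM}}(n,l,g)$ is its ground-state energy; $E_0^{\mathrm{QM}}(0,l,g)=0$. An admissible sequence of $N$ is $\{M_j\}_{j\in\mathbb Z}$ with $M_j\in\mathbb N_0$, $M_j=0$ whenever $\tilde l_j=0$, and $\sum_jM_j=N$. Set $$E_{\mathrm{LS}}^{\mathrm{QM}}(N,\Lambda_N,g_N):=\inf\Big\{\sum_{j}E_0^{\mathrm{QM}}(M_j,\tilde l_j,g_N):\{M_j\}\text{ admissible sequence of }N\Big\}.$$ **Gross--Pitaevskii energy.** For an interval $W$ of length $l>0$, $n>0$, $g\ge0$, $E^{\mathrm{GP}}(n,l,g):=\inf\{\int_W(|\phi'|^2+\frac g2|\phi|^4):\phi\in H^1_0(W),\ \|\phi\|_{L^2}^2=n\}$. *)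

theory Defs
  imports "HOL-Probability.Probability"
begin

section \<open>Asymptotic notation\<close>

text \<open>
  The denominator is required to be eventually nonzero, because division by zero is zero in HOL and
  a vanishing sequence would otherwise dominate every sequence.
\<close>

definition much_less :: "(nat \<Rightarrow> real) \<Rightarrow> (nat \<Rightarrow> real) \<Rightarrow> bool" (infix "\<lless>" 50) where
  "a \<lless> b \<longleftrightarrow> (\<forall>\<^sub>F N in sequentially. b N \<noteq> 0) \<and> (\<lambda>N. a N / b N) \<longlonglongrightarrow> 0"

definition same_order :: "(nat \<Rightarrow> real) \<Rightarrow> (nat \<Rightarrow> real) \<Rightarrow> bool" where
  "same_order a b \<longleftrightarrow> (\<exists>c>0. \<exists>C>0. \<forall>\<^sub>F N in sequentially.
     b N \<noteq> 0 \<and> c \<le> a N / b N \<and> a N / b N \<le> C)"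

definition less_sim :: "(nat \<Rightarrow> real) \<Rightarrow> (nat \<Rightarrow> real) \<Rightarrow> bool" (infix "\<lesssim>" 50) where
  "a \<lesssim> b \<longleftrightarrow> same_order a b \<or> a \<lless> b"


section \<open>Poisson point processes on the line\<close>

definition poisson_process :: "'w measure \<Rightarrow> real \<Rightarrow> ('w \<Rightarrow> real set) \<Rightarrow> bool" where
  "poisson_process P \<nu> X \<longleftrightarrow>
     (AE \<omega> in P. \<forall>B. bounded B \<longrightarrow> finite (X \<omega> \<inter> B)) \<and>
     (\<forall>B \<in> sets borel. bounded B \<longrightarrow>
        (\<lambda>\<omega>. card (X \<omega> \<inter> B)) \<in> measurable P (count_space UNIV) \<and>
        (\<forall>k. measure P {\<omega> \<in> space P. card (X \<omega> \<inter> B) = k} =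
           exp (- (\<nu> * measure lborel B)) * (\<nu> * measure lborel B) ^ k / fact k)) \<and>
     (\<forall>(m::nat) A. (\<forall>i<m. A i \<in> sets borel \<and> bounded (A i)) \<longrightarrow> disjoint_family_on A {..<m} \<longrightarrow>
        prob_space.indep_vars P (\<lambda>_. count_space UNIV) (\<lambda>i \<omega>. card (X \<omega> \<inter> A i)) {..<m})"


section \<open>Sobolev spaces on cubes\<close>

text \<open>
  A point of \<open>\<real>\<^sup>n\<close> is an extensional function on \<open>{..<n}\<close>; the measure
  \<open>cube_measure {..<n} l\<close> is Lebesgue measure on the cube \<open>W\<^sup>n\<close> for \<open>W = (0, l)\<close>. By translation
  invariance this choice of the interval of length \<open>l\<close> is immaterial.
\<close>

definition cube_measure :: "nat set \<Rightarrow> real \<Rightarrow> (nat \<Rightarrow> real) measure" where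
  "cube_measure I l = Pi\<^sub>M I (\<lambda>_. restrict_space lborel {0<..<l})"

definition L2 :: "(nat \<Rightarrow> real) measure \<Rightarrow> ((nat \<Rightarrow> real) \<Rightarrow> complex) set" where
  "L2 M = {f \<in> borel_measurable M. integrable M (\<lambda>z. (cmod (f z))\<^sup>2)}"

definition L2_inner :: "(nat \<Rightarrow> real) measure \<Rightarrow> ((nat \<Rightarrow> real) \<Rightarrow> complex) \<Rightarrow>
    ((nat \<Rightarrow> real) \<Rightarrow> complex) \<Rightarrow> complex" where
  "L2_inner M f h = (LINT z|M. cnj (f z) * h z)"

definition L2_norm :: "(nat \<Rightarrow> real) measure \<Rightarrow> ((nat \<Rightarrow> real) \<Rightarrow> complex) \<Rightarrow> real" where
  "L2_norm M f = sqrt (LINT z|M. (cmod (f z))\<^sup>2)"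

definition L2_lim :: "(nat \<Rightarrow> real) measure \<Rightarrow> (nat \<Rightarrow> (nat \<Rightarrow> real) \<Rightarrow> complex) \<Rightarrow>
    ((nat \<Rightarrow> real) \<Rightarrow> complex) \<Rightarrow> bool" where
  "L2_lim M F f \<longleftrightarrow> (\<forall>m. F m \<in> L2 M) \<and> f \<in> L2 M \<and>
     (\<lambda>m. L2_norm M (\<lambda>z. F m z - f z)) \<longlonglongrightarrow> 0"

definition partial_deriv :: "nat \<Rightarrow> ((nat \<Rightarrow> real) \<Rightarrow> complex) \<Rightarrow> (nat \<Rightarrow> real) \<Rightarrow> complex" where
  "partial_deriv i \<phi> z = vector_derivative (\<lambda>t. \<phi> (z(i := t))) (at (z i))"

text \<open>\<open>D [i\<^sub>1, \<dots>, i\<^sub>k]\<close> is the iterated partial derivative of \<open>\<phi>\<close> in the directions \<open>i\<^sub>k, \<dots>, i\<^sub>1\<close>.\<close>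

definition smooth :: "nat \<Rightarrow> ((nat \<Rightarrow> real) \<Rightarrow> complex) \<Rightarrow> bool" where
  "smooth n \<phi> \<longleftrightarrow> (\<exists>D. D [] = \<phi> \<and>
     (\<forall>is \<in> lists {..<n}. continuous_on (extensional {..<n}) (D is) \<and>
        (\<forall>i<n. \<forall>z \<in> extensional {..<n}.
           ((\<lambda>t. D is (z(i := t))) has_vector_derivative D (i # is) z) (at (z i)))))"

definition test_function :: "nat \<Rightarrow> real \<Rightarrow> ((nat \<Rightarrow> real) \<Rightarrow> complex) \<Rightarrow> bool" where
  "test_function n l \<phi> \<longleftrightarrow> smooth n \<phi> \<and>
     (\<exists>K. compact K \<and> K \<subseteq> {..<n} \<rightarrow>\<^sub>E {0<..<l} \<and> (\<forall>z \<in> extensional {..<n} - K. \<phi> z = 0))"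

definition is_weak_deriv :: "nat \<Rightarrow> real \<Rightarrow> nat \<Rightarrow> ((nat \<Rightarrow> real) \<Rightarrow> complex) \<Rightarrow>
    ((nat \<Rightarrow> real) \<Rightarrow> complex) \<Rightarrow> bool" where
  "is_weak_deriv n l i \<psi> v \<longleftrightarrow> v \<in> L2 (cube_measure {..<n} l) \<and>
     (\<forall>\<phi>. test_function n l \<phi> \<longrightarrow>
        (LINT z|cube_measure {..<n} l. \<psi> z * partial_deriv i \<phi> z) =
        - (LINT z|cube_measure {..<n} l. v z * \<phi> z))"

definition weak_deriv :: "nat \<Rightarrow> real \<Rightarrow> nat \<Rightarrow> ((nat \<Rightarrow> real) \<Rightarrow> complex) \<Rightarrow>
    (nat \<Rightarrow> real) \<Rightarrow> complex" where
  "weak_deriv n l i \<psi> = (SOME v. is_weak_deriv n l i \<psi> v)"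

definition H1 :: "nat \<Rightarrow> real \<Rightarrow> ((nat \<Rightarrow> real) \<Rightarrow> complex) set" where
  "H1 n l = {\<psi> \<in> L2 (cube_measure {..<n} l). \<forall>i<n. \<exists>v. is_weak_deriv n l i \<psi> v}"

definition test_approx :: "nat \<Rightarrow> real \<Rightarrow> (nat \<Rightarrow> (nat \<Rightarrow> real) \<Rightarrow> complex) \<Rightarrow>
    ((nat \<Rightarrow> real) \<Rightarrow> complex) \<Rightarrow> bool" where
  "test_approx n l \<Phi> \<psi> \<longleftrightarrow> (\<forall>m. test_function n l (\<Phi> m)) \<and>
     L2_lim (cube_measure {..<n} l) \<Phi> \<psi> \<and>
     (\<forall>i<n. L2_lim (cube_measure {..<n} l) (\<lambda>m. partial_deriv i (\<Phi> m)) (weak_deriv n l i \<psi>))"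

definition H10 :: "nat \<Rightarrow> real \<Rightarrow> ((nat \<Rightarrow> real) \<Rightarrow> complex) set" where
  "H10 n l = {\<psi> \<in> H1 n l. \<exists>\<Phi>. test_approx n l \<Phi> \<psi>}"


section \<open>Bosons with repulsive contact interaction\<close>

text \<open>
  The restriction of \<open>\<psi> \<in> H\<^sup>1\<^sub>0\<close> to the hyperplane \<open>z\<^sub>i = z\<^sub>k\<close> is its trace, that is, the limit in
  \<open>L\<^sup>2\<close> of the restrictions of approximating test functions. As \<open>\<delta>(z\<^sub>i - z\<^sub>k)\<close> demands, the hyperplane
  is parametrised by the coordinates other than \<open>z\<^sub>k\<close> and carries Lebesgue measure in these
  coordinates (the surface measure would be larger by the factor \<open>sqrt 2\<close>).
\<close>

definition diag_trace :: "nat \<Rightarrow> real \<Rightarrow> nat \<Rightarrow> nat \<Rightarrow> ((nat \<Rightarrow> real) \<Rightarrow> complex) \<Rightarrow>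
    (nat \<Rightarrow> real) \<Rightarrow> complex" where
  "diag_trace n l i k \<psi> = (SOME \<tau>. \<exists>\<Phi>. test_approx n l \<Phi> \<psi> \<and>
     L2_lim (cube_measure ({..<n} - {k}) l) (\<lambda>m z. \<Phi> m (z(k := z i))) \<tau>)"

definition symmetric_on_cube :: "nat \<Rightarrow> real \<Rightarrow> ((nat \<Rightarrow> real) \<Rightarrow> complex) \<Rightarrow> bool" where
  "symmetric_on_cube n l \<psi> \<longleftrightarrow>
     (\<forall>\<pi>. \<pi> permutes {..<n} \<longrightarrow> (AE z in cube_measure {..<n} l. \<psi> (z \<circ> \<pi>) = \<psi> z))"

definition L2_sym :: "nat \<Rightarrow> real \<Rightarrow> ((nat \<Rightarrow> real) \<Rightarrow> complex) set" where
  "L2_sym n l = {\<psi> \<in> L2 (cube_measure {..<n} l). symmetric_on_cube n l \<psi>}"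

definition form_domain :: "nat \<Rightarrow> real \<Rightarrow> ((nat \<Rightarrow> real) \<Rightarrow> complex) set" where
  "form_domain n l = {\<psi> \<in> H10 n l. symmetric_on_cube n l \<psi>}"

definition energy_form :: "nat \<Rightarrow> real \<Rightarrow> real \<Rightarrow> ((nat \<Rightarrow> real) \<Rightarrow> complex) \<Rightarrow>
    ((nat \<Rightarrow> real) \<Rightarrow> complex) \<Rightarrow> complex" where
  "energy_form n l g \<phi> \<psi> =
     (\<Sum>i<n. L2_inner (cube_measure {..<n} l) (weak_deriv n l i \<phi>) (weak_deriv n l i \<psi>)) +
     of_real g * (\<Sum>k<n. \<Sum>i<k. L2_inner (cube_measure ({..<n} - {k}) l)
        (diag_trace n l i k \<phi>) (diag_trace n l i k \<psi>))"

text \<open>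
  \<open>hamiltonian n l g \<psi> f\<close> says that \<open>\<psi>\<close> lies in the domain of the operator \<open>H(n, l, g)\<close> associated
  with the form and that \<open>f\<close> represents \<open>H(n, l, g) \<psi>\<close>.
\<close>

definition hamiltonian :: "nat \<Rightarrow> real \<Rightarrow> real \<Rightarrow> ((nat \<Rightarrow> real) \<Rightarrow> complex) \<Rightarrow>
    ((nat \<Rightarrow> real) \<Rightarrow> complex) \<Rightarrow> bool" where
  "hamiltonian n l g \<psi> f \<longleftrightarrow> \<psi> \<in> form_domain n l \<and> f \<in> L2_sym n l \<and>
     (\<forall>\<phi> \<in> form_domain n l. energy_form n l g \<phi> \<psi> = L2_inner (cube_measure {..<n} l) \<phi> f)"

text \<open>
  A number \<open>w\<close> is in the resolvent set if \<open>H - w\<close> is injective on its domain and maps it onto the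
  symmetric subspace, with bounded inverse.
\<close>

definition resolvent_set :: "nat \<Rightarrow> real \<Rightarrow> real \<Rightarrow> complex set" where
  "resolvent_set n l g = {w.
     (\<forall>\<psi>. hamiltonian n l g \<psi> (\<lambda>z. w * \<psi> z) \<longrightarrow> (AE z in cube_measure {..<n} l. \<psi> z = 0)) \<and>
     (\<exists>C. \<forall>f \<in> L2_sym n l. \<exists>\<psi>. hamiltonian n l g \<psi> (\<lambda>z. w * \<psi> z + f z) \<and>
        L2_norm (cube_measure {..<n} l) \<psi> \<le> C * L2_norm (cube_measure {..<n} l) f)}"

definition spectrum :: "nat \<Rightarrow> real \<Rightarrow> real \<Rightarrow> complex set" where
  "spectrum n l g = - resolvent_set n l g"

text \<open>The ground-state energy is the bottom of the (real) spectrum.\<close>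

definition E0_QM :: "nat \<Rightarrow> real \<Rightarrow> real \<Rightarrow> real" where
  "E0_QM n l g = (if n = 0 then 0 else Inf {e. complex_of_real e \<in> spectrum n l g})"


section \<open>The Gross--Pitaevskii energy\<close>

text \<open>The interval \<open>W = (0, l)\<close> is identified with the cube \<open>W\<^sup>1\<close>.\<close>

definition E_GP :: "real \<Rightarrow> real \<Rightarrow> real \<Rightarrow> real" where
  "E_GP n l g = Inf {(LINT z|cube_measure {..<1} l.
       (cmod (weak_deriv 1 l 0 \<phi> z))\<^sup>2 + g / 2 * (cmod (\<phi> z)) ^ 4) |\<phi>.
     \<phi> \<in> H10 1 l \<and> (L2_norm (cube_measure {..<1} l) \<phi>)\<^sup>2 = n}"

definition K_const :: "real \<Rightarrow> real" where
  "K_const \<eta> = 10 * 5\<^sup>2 * pi\<^sup>2 / \<eta>\<^sup>2 + 1"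

definition c1_const :: "real \<Rightarrow> real" where
  "c1_const \<eta> = 90 * E_GP 1 1 (K_const \<eta>) / \<eta>\<^sup>2"


section \<open>Random intervals and occupation numbers\<close>

definition window :: "real \<Rightarrow> nat \<Rightarrow> real set" where
  "window \<rho> N = {- (real N / \<rho>) / 2 <..< (real N / \<rho>) / 2}"

definition cell :: "real \<Rightarrow> real \<Rightarrow> (int \<Rightarrow> real) \<Rightarrow> nat \<Rightarrow> int \<Rightarrow> real set" where
  "cell \<rho> s x N j = {inverse s * x j <..< inverse s * x (j + 1)} \<inter> window \<rho> N"

definition cell_length :: "real \<Rightarrow> real \<Rightarrow> (int \<Rightarrow> real) \<Rightarrow> nat \<Rightarrow> int \<Rightarrow> real" where
  "cell_length \<rho> s x N j = measure lborel (cell \<rho> s x N j)"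

text \<open>
  In the following, \<open>len j\<close> is the length of the \<open>j\<close>-th interval. A family of naturals with a finite
  sum has finite support, so that sums over all intervals reduce to sums over \<open>{j. M j \<noteq> 0}\<close>.
\<close>

definition admissible :: "(int \<Rightarrow> real) \<Rightarrow> nat \<Rightarrow> (int \<Rightarrow> nat) \<Rightarrow> bool" where
  "admissible len N M \<longleftrightarrow> (\<forall>j. len j = 0 \<longrightarrow> M j = 0) \<and>
     finite {j. M j \<noteq> 0} \<and> (\<Sum>j | M j \<noteq> 0. M j) = N"

definition total_energy :: "(int \<Rightarrow> real) \<Rightarrow> real \<Rightarrow> (int \<Rightarrow> nat) \<Rightarrow> real" where
  "total_energy len g M = (\<Sum>j | M j \<noteq> 0. E0_QM (M j) (len j) g)"

definition E_LS_QM :: "(int \<Rightarrow> real) \<Rightarrow> nat \<Rightarrow> real \<Rightarrow> real" where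
  "E_LS_QM len N g = Inf {total_energy len g M |M. admissible len N M}"

definition ground_state_occupation :: "(int \<Rightarrow> real) \<Rightarrow> nat \<Rightarrow> real \<Rightarrow> (int \<Rightarrow> nat) \<Rightarrow> bool" where
  "ground_state_occupation len N g M \<longleftrightarrow> admissible len N M \<and> E_LS_QM len N g = total_energy len g M"

end

theory Submission
  imports Defs "HOL-Real_Asymp.Real_Asymp"
begin

text \<open>
  Compare an upper bound on the total energy with a lower bound on the energy of the most
  occupied cell. By the representation theorem for closed forms, the ground-state energy is the
  infimum of the Rayleigh quotient.

  For the upper bound, almost surely, for all large \<open>N\<close>, of order \<open>\<nu>\<^sub>N N\<^bsup>1 - \<eta>/2\<^esup> / (ln N)\<^sup>2\<close> cells have length at least
  \<open>\<eta> ln N / (2 \<nu>\<^sub>N)\<close>; spreading the particles evenly over them in product states makes the interaction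
  negligible and yields a total energy of order \<open>N \<nu>\<^sub>N\<^sup>2 / (\<eta> ln N)\<^sup>2\<close>.

  For the lower bound, a fraction \<open>1 / n\<close> of the kinetic energy of a particle turns each contact
  interaction into an interaction of range \<open>R \<le> 1 / (g n)\<close> that counts pairs in the same box of side \<open>R\<close>.
  Among \<open>n\<close> particles in \<open>l / R\<close> boxes there are at least about \<open>n\<^sup>2 R / (2 l)\<close> such pairs, so the energy is at
  least a constant times \<open>g n\<^sup>2 / l\<close> as long as \<open>g l\<close> is small. The constant \<open>c\<^sub>1(\<eta>)\<close>, which is at least of order \<open>\<eta>\<^sup>-\<^sup>4\<close>
  because \<open>E_GP 1 1 K \<ge> K / 2\<close>, absorbs all numerical constants.
\<close>

text \<open>Energies are defined through the spectrum of an operator, and weak derivatives and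
  traces are representatives picked by \<open>SOME\<close>. This shapes the analytic half:
  closedness of the form and independence of the traces from the approximating sequence reduce every
  energy estimate to smooth compactly supported functions. The exponent \<eta>/2 is a compromise. A
  gap of the required length has probability \<open>N powr (- \<eta> / 2)\<close>, which puts, up to
  logarithms and powers of \<nu>N, \<open>N powr (\<eta> / 2)\<close> particles into each long cell;
  as \<open>g\<close> brings in \<open>N powr (- \<eta>)\<close>, interaction over kinetic energy is
  of order \<open>N powr (- \<eta> / 2) * ln N\<close> and vanishes. No upper bound on the length d
  of the most occupied cell is used. The occupation n is divided by the longest length, which is at
  least d and at least the length l of the long cells. In n^2 / (d l) the factor d cancels against
  that of the energy g n^2 / d, and only the lower bound l remains. Where g d is not small, the
  coupling is lowered to order 1 / d, and n^2 / d^2 is bounded by the energy directly.\<close>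

section \<open>Hermitian forms on spaces of functions\<close>

text \<open>Only semidefiniteness is required: the elements of \<open>V\<close> are functions, not
  classes modulo null sets, so limits are unique only up to \<open>nrm\<close> 0. The locale is used
  twice, for \<open>L2_inner\<close> on square-integrable functions and for the energy form shifted
  by one of its lower bounds.\<close>

locale hermitian_form =
  fixes V :: "('b \<Rightarrow> complex) set" and B :: "('b \<Rightarrow> complex) \<Rightarrow> ('b \<Rightarrow> complex) \<Rightarrow> complex"
  assumes zero: "(\<lambda>_. 0) \<in> V"
    and add: "f \<in> V \<Longrightarrow> h \<in> V \<Longrightarrow> (\<lambda>z. f z + h z) \<in> V"
    and scale: "f \<in> V \<Longrightarrow> (\<lambda>z. c * f z) \<in> V"
    and B_add_right: "f \<in> V \<Longrightarrow> h \<in> V \<Longrightarrow> k \<in> V \<Longrightarrow> B f (\<lambda>z. h z + k z) = B f h + B f k"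
    and B_scale_right: "f \<in> V \<Longrightarrow> h \<in> V \<Longrightarrow> B f (\<lambda>z. c * h z) = c * B f h"
    and B_herm: "f \<in> V \<Longrightarrow> h \<in> V \<Longrightarrow> B h f = cnj (B f h)"
    and B_nonneg: "f \<in> V \<Longrightarrow> 0 \<le> Re (B f f)"
begin

lemma B_add_left: "f \<in> V \<Longrightarrow> h \<in> V \<Longrightarrow> k \<in> V \<Longrightarrow> B (\<lambda>z. f z + h z) k = B f k + B h k"
  using B_herm[of k "\<lambda>z. f z + h z"] B_herm[of k f] B_herm[of k h] B_add_right[of k f h] add[of f h] by simp

lemma B_scale_left: "f \<in> V \<Longrightarrow> h \<in> V \<Longrightarrow> B (\<lambda>z. c * f z) h = cnj c * B f h"
  using B_herm[of h "\<lambda>z. c * f z"] B_herm[of h f] B_scale_right[of h f c] scale[of f c] by simp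

lemma diff: "f \<in> V \<Longrightarrow> h \<in> V \<Longrightarrow> (\<lambda>z. f z - h z) \<in> V"
  using add[OF _ scale[of h "-1"], of f] by simp

lemma B_diff_right: "f \<in> V \<Longrightarrow> h \<in> V \<Longrightarrow> k \<in> V \<Longrightarrow> B f (\<lambda>z. h z - k z) = B f h - B f k"
  using B_add_right[of f h "\<lambda>z. -1 * k z"] scale[of k "-1"] B_scale_right[of f k "-1"] by simp

definition nrm :: "('b \<Rightarrow> complex) \<Rightarrow> real" where "nrm f = sqrt (Re (B f f))"

lemma nrm_ge0: "f \<in> V \<Longrightarrow> 0 \<le> nrm f" and nrm_sq: "f \<in> V \<Longrightarrow> (nrm f)\<^sup>2 = Re (B f f)"
  using B_nonneg by (auto simp: nrm_def)

lemma Re_B_add: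
  assumes "f \<in> V" "h \<in> V"
  shows "Re (B (\<lambda>z. f z + c * h z) (\<lambda>z. f z + c * h z)) =
    Re (B f f) + 2 * Re (c * B f h) + (cmod c)\<^sup>2 * Re (B h h)"
proof -
  have "B (\<lambda>z. f z + c * h z) (\<lambda>z. f z + c * h z)
      = B f f + c * B f h + (cnj c * B h f + cnj c * (c * B h h))"
    using assms scale[of h c]
    by (simp add: B_add_right B_add_left B_scale_right B_scale_left add algebra_simps)
  also have "B h f = cnj (B f h)" by (rule B_herm) fact+
  also have "cnj c * (c * B h h) = of_real ((cmod c)\<^sup>2) * B h h"
    using complex_norm_square[of c] by (simp add: mult.commute mult.left_commute)
  finally show ?thesis
    by (simp add: algebra_simps) 
qed

text \<open>A quadratic that is nonnegative in every complex direction has nonpositive discriminant;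
  \<open>c = - cnj b / q\<close> is its minimiser. This gives Cauchy-Schwarz and, with an error
  \<open>E = 1 / Suc m\<close>, the approximate Euler equation of the minimising sequence in
  \<open>riesz\<close>.\<close>

lemma quadratic_bound:
  assumes nonneg: "\<And>c::complex. 0 \<le> E + 2 * Re (c * b) + (cmod c)\<^sup>2 * q" and "0 \<le> q" "0 \<le> (E::real)"
  shows "(cmod b)\<^sup>2 \<le> E * q"
proof (cases "q = 0")
  case True
  have "b = 0"
  proof (rule ccontr)
    assume b: "b \<noteq> 0"
    \<comment> \<open>With \<open>q = 0\<close> the expression is affine in \<open>c\<close>; this
      size of \<open>c\<close> brings it down to \<open>E - 2 * (E + 1) < 0\<close>.\<close>
    define t where "t = (E + 1) / (cmod b)\<^sup>2"
    have "0 \<le> E + 2 * Re (- of_real t * cnj b * b)" using nonneg[of "- of_real t * cnj b"] True by simp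
    also have "- of_real t * cnj b * b = - of_real (t * (cmod b)\<^sup>2)"
      using complex_norm_square[of b] by (simp add: mult.commute mult.left_commute)
    also have "t * (cmod b)\<^sup>2 = E + 1" using b by (simp add: t_def)
    finally show False using assms by simp
  qed
  then show ?thesis using True by simp
next
  case False
  then have q: "q > 0" using assms by simp
  define t where "t = 1 / q"
  have e1: "- of_real t * cnj b * b = - of_real (t * (cmod b)\<^sup>2)"
    using complex_norm_square[of b] by (simp add: mult.commute mult.left_commute)
  have e2: "(cmod (- of_real t * cnj b))\<^sup>2 = t\<^sup>2 * (cmod b)\<^sup>2"
    by (simp add: norm_mult power_mult_distrib)
  have "0 \<le> E + 2 * Re (- of_real (t * (cmod b)\<^sup>2)) + t\<^sup>2 * (cmod b)\<^sup>2 * q"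
    using nonneg[of "- of_real t * cnj b"] unfolding e1 e2 .
  also have "\<dots> = E - (cmod b)\<^sup>2 / q" using q by (simp add: t_def field_simps power2_eq_square)
  finally show ?thesis using q by (simp add: field_simps)
qed

lemma Cauchy_Schwarz_sq:
  assumes "f \<in> V" "h \<in> V"
  shows "(cmod (B f h))\<^sup>2 \<le> Re (B f f) * Re (B h h)"
proof (rule quadratic_bound)
  fix c show "0 \<le> Re (B f f) + 2 * Re (c * B f h) + (cmod c)\<^sup>2 * Re (B h h)"
    using Re_B_add[OF assms, of c] B_nonneg[OF add[OF assms(1) scale[OF assms(2)], of c]] by simp
qed (use assms B_nonneg in auto)

lemma Cauchy_Schwarz: "f \<in> V \<Longrightarrow> h \<in> V \<Longrightarrow> cmod (B f h) \<le> nrm f * nrm h"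
  using Cauchy_Schwarz_sq[of f h] B_nonneg
  by (simp add: nrm_def real_le_rsqrt flip: real_sqrt_mult)

lemma nrm_triangle:
  assumes "f \<in> V" "h \<in> V" shows "nrm (\<lambda>z. f z + h z) \<le> nrm f + nrm h"
proof (rule power2_le_imp_le)
  have "(nrm (\<lambda>z. f z + h z))\<^sup>2 = (nrm f)\<^sup>2 + 2 * Re (B f h) + (nrm h)\<^sup>2"
    using Re_B_add[OF assms, of 1] assms by (simp add: nrm_sq add)
  also have "Re (B f h) \<le> nrm f * nrm h"
    using Cauchy_Schwarz[OF assms] complex_Re_le_cmod[of "B f h"] by linarith
  finally show "(nrm (\<lambda>z. f z + h z))\<^sup>2 \<le> (nrm f + nrm h)\<^sup>2" by (simp add: power2_sum)
qed (use assms nrm_ge0 in auto)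

lemma nrm_scale: "f \<in> V \<Longrightarrow> nrm (\<lambda>z. c * f z) = cmod c * nrm f"
proof -
  assume f: "f \<in> V"
  have "B (\<lambda>z. c * f z) (\<lambda>z. c * f z) = cnj c * c * B f f"
    using f scale by (simp add: B_scale_left B_scale_right)
  also have "cnj c * c = of_real ((cmod c)\<^sup>2)" using complex_norm_square[of c] by (simp add: mult.commute)
  finally show ?thesis by (simp add: nrm_def real_sqrt_mult)
qed

lemma nrm_diff_commute: "f \<in> V \<Longrightarrow> h \<in> V \<Longrightarrow> nrm (\<lambda>z. f z - h z) = nrm (\<lambda>z. h z - f z)"
  using nrm_scale[OF diff, of f h "-1"] by (simp add: algebra_simps)

lemma nrm_diff_triangle:
  assumes "f \<in> V" "h \<in> V" "k \<in> V"
  shows "nrm (\<lambda>z. f z - k z) \<le> nrm (\<lambda>z. f z - h z) + nrm (\<lambda>z. h z - k z)"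
  using nrm_triangle[OF diff[OF assms(1,2)] diff[OF assms(2,3)]] by simp

lemma nrm_reverse_triangle:
  assumes "f \<in> V" "h \<in> V"
  shows "\<bar>nrm f - nrm h\<bar> \<le> nrm (\<lambda>z. f z - h z)"
  using nrm_triangle[OF diff[OF assms] assms(2)] nrm_triangle[OF diff[OF assms(2,1)] assms(1)]
    nrm_diff_commute[OF assms] by simp

definition conv :: "(nat \<Rightarrow> 'b \<Rightarrow> complex) \<Rightarrow> ('b \<Rightarrow> complex) \<Rightarrow> bool" where
  "conv F f \<longleftrightarrow> (\<forall>m. F m \<in> V) \<and> f \<in> V \<and> (\<lambda>m. nrm (\<lambda>z. F m z - f z)) \<longlonglongrightarrow> 0"

lemma conv_B_right:
  assumes "conv F f" "h \<in> V" shows "(\<lambda>m. B h (F m)) \<longlonglongrightarrow> B h f"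
proof -
  have "(\<lambda>m. B h (F m) - B h f) \<longlonglongrightarrow> 0"
  proof (rule Lim_null_comparison)
    show "\<forall>\<^sub>F m in sequentially. norm (B h (F m) - B h f) \<le> nrm h * nrm (\<lambda>z. F m z - f z)"
      using assms Cauchy_Schwarz[OF assms(2) diff] by (auto simp: conv_def B_diff_right[symmetric])
    show "(\<lambda>m. nrm h * nrm (\<lambda>z. F m z - f z)) \<longlonglongrightarrow> 0"
      using assms by (auto simp: conv_def intro: tendsto_mult_right_zero)
  qed
  then show ?thesis by (simp add: LIM_zero_iff)
qed

lemma conv_nrm:
  assumes "conv F f" shows "(\<lambda>m. nrm (F m)) \<longlonglongrightarrow> nrm f"
proof -
  have "(\<lambda>m. nrm (F m) - nrm f) \<longlonglongrightarrow> 0"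
  proof (rule Lim_null_comparison)
    show "\<forall>\<^sub>F m in sequentially. norm (nrm (F m) - nrm f) \<le> nrm (\<lambda>z. F m z - f z)"
      using assms nrm_reverse_triangle by (auto simp: conv_def)
  qed (use assms in \<open>auto simp: conv_def\<close>)
  then show ?thesis by (simp add: LIM_zero_iff)
qed

lemma conv_add:
  assumes "conv F f" "conv H h" shows "conv (\<lambda>m z. F m z + c * H m z) (\<lambda>z. f z + c * h z)"
proof -
  have V: "F m \<in> V" "f \<in> V" "H m \<in> V" "h \<in> V" for m using assms by (auto simp: conv_def)
  have bound: "nrm (\<lambda>z. F m z + c * H m z - (f z + c * h z)) \<le>
      nrm (\<lambda>z. F m z - f z) + cmod c * nrm (\<lambda>z. H m z - h z)" for m
  proof -
    have "(\<lambda>z. F m z + c * H m z - (f z + c * h z)) = (\<lambda>z. (F m z - f z) + c * (H m z - h z))"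
      by (auto simp: algebra_simps)
    then show ?thesis
      using nrm_triangle[OF diff[OF V(1) V(2)] scale[OF diff[OF V(3) V(4)]], of m c m]
        nrm_scale[OF diff[OF V(3) V(4)], of c m] by simp
  qed
  have lim: "(\<lambda>m. nrm (\<lambda>z. F m z - f z) + cmod c * nrm (\<lambda>z. H m z - h z)) \<longlonglongrightarrow> 0"
    using tendsto_add[OF _ tendsto_mult_right_zero, of "\<lambda>m. nrm (\<lambda>z. F m z - f z)" 0 sequentially
        "\<lambda>m. nrm (\<lambda>z. H m z - h z)" "cmod c"] assms by (simp add: conv_def)
  have in_V: "(\<lambda>z. F m z + c * H m z) \<in> V" for m
    by (rule add[OF V(1) scale[OF V(3)]])
  have in_V': "(\<lambda>z. f z + c * h z) \<in> V"
    by (rule add[OF V(2) scale[OF V(4)]])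
  have ge0: "0 \<le> nrm (\<lambda>z. F m z + c * H m z - (f z + c * h z))" for m
    by (rule nrm_ge0[OF diff[OF in_V in_V']])
  have "(\<lambda>m. nrm (\<lambda>z. F m z + c * H m z - (f z + c * h z))) \<longlonglongrightarrow> 0"
    by (rule tendsto_sandwich[OF always_eventually always_eventually tendsto_const lim])
      (auto simp only: ge0 bound)
  then show ?thesis unfolding conv_def by (simp only: in_V in_V' simp_thms)
qed

lemma conv_unique:
  assumes "conv F f" "conv F h" shows "nrm (\<lambda>z. f z - h z) = 0"
proof -
  have "conv (\<lambda>m z. F m z + (-1) * F m z) (\<lambda>z. f z + (-1) * h z)" by (rule conv_add) fact+
  from conv_nrm[OF this] have "(\<lambda>m. nrm (\<lambda>z. 0)) \<longlonglongrightarrow> nrm (\<lambda>z. f z - h z)" by simp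
  moreover have "nrm (\<lambda>z. 0) = 0" using nrm_scale[OF zero, of 0] by simp
  ultimately show ?thesis by (simp add: LIMSEQ_const_iff)
qed

definition cauchy :: "(nat \<Rightarrow> 'b \<Rightarrow> complex) \<Rightarrow> bool" where
  "cauchy F \<longleftrightarrow> (\<forall>m. F m \<in> V) \<and> (\<forall>e>0. \<exists>N. \<forall>m\<ge>N. \<forall>n\<ge>N. nrm (\<lambda>z. F m z - F n z) < e)"

lemma conv_imp_cauchy:
  assumes "conv F f" shows "cauchy F"
  unfolding cauchy_def
proof (intro conjI allI impI)
  have V: "F m \<in> V" "f \<in> V" for m using assms by (auto simp: conv_def)
  show "F m \<in> V" for m using V by auto
  fix e :: real assume "e > 0"
  then obtain N where N: "\<And>m. m \<ge> N \<Longrightarrow> norm (nrm (\<lambda>z. F m z - f z)) < e / 2"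
    using assms unfolding conv_def LIMSEQ_iff by (metis diff_zero half_gt_zero_iff)
  show "\<exists>N. \<forall>m\<ge>N. \<forall>n\<ge>N. nrm (\<lambda>z. F m z - F n z) < e"
  proof (intro exI[of _ N] allI impI)
    fix m n assume "m \<ge> N" "n \<ge> N"
    then show "nrm (\<lambda>z. F m z - F n z) < e"
      using N[of m] N[of n] nrm_diff_triangle[OF V V(1), of m n] nrm_diff_commute[OF V, of n] by auto
  qed
qed

text \<open>The minimising sequence of \<open>\<parallel>f\<parallel>\<^sup>2 - 2 Re (L f)\<close> is Cauchy by the parallelogram law.\<close>
lemma riesz:
  assumes complete: "\<And>F. cauchy F \<Longrightarrow> \<exists>f. conv F f"
    and L_add: "\<And>f h. f \<in> V \<Longrightarrow> h \<in> V \<Longrightarrow> L (\<lambda>z. f z + h z) = L f + L h"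
    and L_scale: "\<And>c f. f \<in> V \<Longrightarrow> L (\<lambda>z. c * f z) = cnj c * L f"
    and L_bound: "\<And>f. f \<in> V \<Longrightarrow> cmod (L f) \<le> C * nrm f"
  shows "\<exists>u\<in>V. \<forall>f\<in>V. B f u = L f"
proof -
  define J where "J f = Re (B f f) - 2 * Re (L f)" for f
  have J_lower: "- C\<^sup>2 \<le> J f" if "f \<in> V" for f
  proof -
    have "Re (L f) \<le> C * nrm f" using L_bound[OF that] complex_Re_le_cmod[of "L f"] by linarith
    moreover have "0 \<le> (nrm f - C)\<^sup>2" by simp
    ultimately show ?thesis using nrm_sq[OF that] by (simp add: J_def power2_diff algebra_simps)
  qed
  define d where "d = Inf (J ` V)"
  have bdd: "bdd_below (J ` V)" using J_lower by (auto intro!: bdd_belowI)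
  have d_le: "d \<le> J f" if "f \<in> V" for f unfolding d_def using that bdd by (auto intro: cInf_lower)
  have "\<exists>f\<in>V. J f < d + 1 / Suc m" for m
  proof (rule ccontr)
    assume "\<not> ?thesis"
    then have "d + 1 / Suc m \<le> d" unfolding d_def using zero by (intro cInf_greatest) (auto simp: not_less)
    then show False by simp
  qed
  then obtain F where F: "\<And>m. F m \<in> V" "\<And>m. J (F m) < d + 1 / Suc m" by metis
  have L_diff: "L (\<lambda>z. f z - h z) = L f - L h" if "f \<in> V" "h \<in> V" for f h
    using L_add[OF that(1) scale[OF that(2)], of "-1"] L_scale[OF that(2), of "-1"] by simp
  have "cauchy F" unfolding cauchy_def
  proof (intro conjI allI impI)
    fix e :: real assume e: "e > 0"
    obtain N :: nat where N: "4 / e\<^sup>2 < N" using reals_Archimedean2 by blast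
    show "\<exists>N. \<forall>m\<ge>N. \<forall>n\<ge>N. nrm (\<lambda>z. F m z - F n z) < e"
    proof (intro exI[of _ N] allI impI)
      fix m n assume mn: "m \<ge> N" "n \<ge> N"
      let ?s = "\<lambda>z. (1/2) * (F m z + 1 * F n z)"
      have s: "(\<lambda>z. F m z + 1 * F n z) \<in> V" using add[OF F(1) F(1), of m n] by simp
      have "J ?s = Re (B (\<lambda>z. F m z + 1 * F n z) (\<lambda>z. F m z + 1 * F n z)) / 4 - (Re (L (F m)) + Re (L (F n)))"
        using s F scale[OF s, of "1/2"] unfolding J_def 
        by (simp only: B_scale_left B_scale_right L_scale) (simp add: L_add add_divide_distrib)
      moreover have "Re (B (\<lambda>z. F m z + (-1) * F n z) (\<lambda>z. F m z + (-1) * F n z))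
          = 2 * Re (B (F m) (F m)) + 2 * Re (B (F n) (F n))
            - Re (B (\<lambda>z. F m z + 1 * F n z) (\<lambda>z. F m z + 1 * F n z))"
        unfolding Re_B_add[OF F(1) F(1)] by simp
      moreover have "d \<le> J ?s" using d_le[OF scale[OF s, of "1/2"]] .
      ultimately have "Re (B (\<lambda>z. F m z - F n z) (\<lambda>z. F m z - F n z)) < 2 / Suc m + 2 / Suc n"
        using F(2)[of m] F(2)[of n] unfolding J_def by simp
      also have "\<dots> \<le> 2 / Suc N + 2 / Suc N" using mn by (intro add_mono divide_left_mono) auto
      also have "\<dots> < e\<^sup>2"
      proof -
        have "4 / e\<^sup>2 < Suc N" using N by simp
        then have "4 / real (Suc N) < e\<^sup>2" using e
          by (metis divide_less_eq mult.commute of_nat_0_less_iff zero_less_Suc zero_less_power)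
        then show ?thesis by (simp add: add_divide_distrib[symmetric])
      qed
      finally show "nrm (\<lambda>z. F m z - F n z) < e"
        unfolding nrm_def using e by (metis real_sqrt_less_iff real_sqrt_abs abs_of_pos)
    qed
  qed (rule F)
  then obtain u where u: "conv F u" using complete by blast
  then have uV: "u \<in> V" by (simp add: conv_def)
  have "B f u = L f" if f: "f \<in> V" for f
  proof -
    \<comment> \<open>\<open>F m\<close> minimises \<open>J\<close> up to \<open>1 / Suc m\<close>,
      so a variation in the direction \<open>f\<close> is a quadratic in \<open>c\<close> that is
      nonnegative up to this error, and its linear coefficient must be small.\<close>
    have bnd: "(cmod (B (F m) f - cnj (L f)))\<^sup>2 \<le> 1 / Suc m * Re (B f f)" for m
    proof (rule quadratic_bound)
      fix c :: complex
      have "d \<le> J (\<lambda>z. F m z + c * f z)" by (rule d_le[OF add[OF F(1) scale[OF f]]])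
      also have "\<dots> = J (F m) + 2 * Re (c * B (F m) f) + (cmod c)\<^sup>2 * Re (B f f) - 2 * Re (cnj c * L f)"
        unfolding J_def Re_B_add[OF F(1) f] using L_add[OF F(1) scale[OF f], of m c] L_scale[OF f, of c] by simp
      also have "Re (cnj c * L f) = Re (c * cnj (L f))" by simp
      finally show "0 \<le> 1 / Suc m + 2 * Re (c * (B (F m) f - cnj (L f))) + (cmod c)\<^sup>2 * Re (B f f)"
        using F(2)[of m] by (simp add: algebra_simps)
    qed (use B_nonneg[OF f] in auto)
    have "(\<lambda>m. (cmod (B (F m) f - cnj (L f)))\<^sup>2) \<longlonglongrightarrow> 0"
    proof (rule Lim_null_comparison)
      show "\<forall>\<^sub>F m in sequentially. norm ((cmod (B (F m) f - cnj (L f)))\<^sup>2) \<le> 1 / Suc m * Re (B f f)"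
        using bnd by simp
      show "(\<lambda>m. 1 / Suc m * Re (B f f)) \<longlonglongrightarrow> 0"
        using tendsto_mult_left_zero[OF LIMSEQ_inverse_real_of_nat] by (simp add: inverse_eq_divide)
    qed
    moreover have "(\<lambda>m. (cmod (B (F m) f - cnj (L f)))\<^sup>2) \<longlonglongrightarrow> (cmod (B u f - cnj (L f)))\<^sup>2"
    proof -
      have "(\<lambda>m. cnj (B f (F m))) \<longlonglongrightarrow> cnj (B f u)" using conv_B_right[OF u f] by (intro tendsto_intros)
      then have "(\<lambda>m. B (F m) f) \<longlonglongrightarrow> B u f" using B_herm[OF f F(1)] B_herm[OF f uV] by simp
      then show ?thesis by (intro tendsto_intros)
    qed
    ultimately have "B u f = cnj (L f)" using LIMSEQ_unique by fastforce
    then show ?thesis using B_herm[OF uV f] by simp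
  qed
  then show ?thesis using uV by blast
qed

end


section \<open>Square-integrable functions\<close>

lemma borel_measurable_cnj [measurable]:
  "f \<in> borel_measurable M \<Longrightarrow> (\<lambda>z. cnj (f z)) \<in> borel_measurable M"
  by (rule borel_measurable_continuous_on[of cnj]) (intro continuous_intros)

lemma L2_borel: "f \<in> L2 M \<Longrightarrow> f \<in> borel_measurable M"
  and L2_integrable: "f \<in> L2 M \<Longrightarrow> integrable M (\<lambda>z. (cmod (f z))\<^sup>2)"
  by (auto simp: L2_def)

lemma L2I: "f \<in> borel_measurable M \<Longrightarrow> integrable M (\<lambda>z. (cmod (f z))\<^sup>2) \<Longrightarrow> f \<in> L2 M"
  by (auto simp: L2_def)

lemma L2_dominated:
  assumes "f \<in> borel_measurable M" "integrable M w" "AE z in M. (cmod (f z))\<^sup>2 \<le> w z"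
  shows "f \<in> L2 M"
  using assms by (intro L2I Bochner_Integration.integrable_bound[OF assms(2)]) (auto elim: eventually_mono)

lemma L2_mult_integrable:
  assumes "f \<in> L2 M" "h \<in> L2 M" shows "integrable M (\<lambda>z. f z * h z)"
proof (rule Bochner_Integration.integrable_bound)
  note [measurable] = L2_borel[OF assms(1)] L2_borel[OF assms(2)]
  show "integrable M (\<lambda>z. (cmod (f z))\<^sup>2 + (cmod (h z))\<^sup>2)"
    using L2_integrable[OF assms(1)] L2_integrable[OF assms(2)] by simp
  have "cmod (f z * h z) \<le> (cmod (f z))\<^sup>2 + (cmod (h z))\<^sup>2" for z
    using sum_squares_bound[of "cmod (f z)" "cmod (h z)"] mult_nonneg_nonneg[OF norm_ge_zero norm_ge_zero, of "f z" "h z"]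
    unfolding norm_mult by linarith
  then show "AE z in M. norm (f z * h z) \<le> norm ((cmod (f z))\<^sup>2 + (cmod (h z))\<^sup>2)"
    by (simp add: order_trans[OF _ abs_ge_self])
  show "(\<lambda>z. f z * h z) \<in> borel_measurable M" by measurable
qed

lemma L2_cnj: "f \<in> L2 M \<Longrightarrow> (\<lambda>z. cnj (f z)) \<in> L2 M"
  by (auto simp: L2_def)

lemma L2_zero: "(\<lambda>_. 0) \<in> L2 M" by (auto simp: L2_def)

lemma L2_add: assumes "f \<in> L2 M" "h \<in> L2 M" shows "(\<lambda>z. f z + h z) \<in> L2 M"
proof (rule L2_dominated)
  note [measurable] = L2_borel[OF assms(1)] L2_borel[OF assms(2)]
  show "integrable M (\<lambda>z. 2 * (cmod (f z))\<^sup>2 + 2 * (cmod (h z))\<^sup>2)"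
    using L2_integrable[OF assms(1)] L2_integrable[OF assms(2)] by simp
  have "(cmod (f z + h z))\<^sup>2 \<le> 2 * (cmod (f z))\<^sup>2 + 2 * (cmod (h z))\<^sup>2" for z
    using power_mono[OF norm_triangle_ineq[of "f z" "h z"], of 2] sum_squares_bound[of "cmod (f z)" "cmod (h z)"]
    by (simp add: power2_sum)
  then show "AE z in M. (cmod (f z + h z))\<^sup>2 \<le> 2 * (cmod (f z))\<^sup>2 + 2 * (cmod (h z))\<^sup>2" by simp
  show "(\<lambda>z. f z + h z) \<in> borel_measurable M" by measurable
qed

lemma L2_scale: "f \<in> L2 M \<Longrightarrow> (\<lambda>z. c * f z) \<in> L2 M"
  by (auto simp: L2_def norm_mult power_mult_distrib)

lemma L2_inner_self: "L2_inner M f f = complex_of_real (LINT z|M. (cmod (f z))\<^sup>2)"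
  unfolding L2_inner_def integral_complex_of_real[symmetric]
  by (intro Bochner_Integration.integral_cong refl) (metis complex_norm_square mult.commute)

lemma L2_norm_sq: "(L2_norm M f)\<^sup>2 = (LINT z|M. (cmod (f z))\<^sup>2)"
  by (simp add: L2_norm_def)

lemma L2_norm_nonneg: "0 \<le> L2_norm M f"
  by (simp add: L2_norm_def)

text \<open>The rewrites identify the abstract norm and convergence with \<open>L2_norm\<close> and
  \<open>L2_lim\<close>, so that the facts of the locale speak about the given definitions directly;
  \<open>cauchy\<close> keeps its abstract form.\<close>

interpretation L2: hermitian_form "L2 M" "L2_inner M"
  rewrites "hermitian_form.nrm (L2_inner M) = L2_norm M"
    and "hermitian_form.conv (L2 M) (L2_inner M) = L2_lim M"
  for M
proof -
  show H: "hermitian_form (L2 M) (L2_inner M)"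
  proof
    fix f h k :: "(nat \<Rightarrow> real) \<Rightarrow> complex" and c
    assume f: "f \<in> L2 M" and h: "h \<in> L2 M"
    show "L2_inner M h f = cnj (L2_inner M f h)"
      using Bochner_Integration.integral_cnj[of M "\<lambda>z. cnj (f z) * h z"]
      by (simp add: L2_inner_def mult.commute)
    show "L2_inner M f (\<lambda>z. c * h z) = c * L2_inner M f h"
      unfolding L2_inner_def by (simp add: mult.left_commute)
    assume "k \<in> L2 M"
    then show "L2_inner M f (\<lambda>z. h z + k z) = L2_inner M f h + L2_inner M f k"
      unfolding L2_inner_def distrib_left using f h
      by (intro Bochner_Integration.integral_add L2_mult_integrable L2_cnj)
  qed (auto intro: L2_zero L2_add L2_scale simp: L2_inner_self)
  show nrm: "hermitian_form.nrm (L2_inner M) = L2_norm M"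
    by (rule ext) (simp add: hermitian_form.nrm_def[OF H] L2_inner_self L2_norm_def)
  show "hermitian_form.conv (L2 M) (L2_inner M) = L2_lim M"
    by (intro ext) (simp add: hermitian_form.conv_def[OF H] nrm L2_lim_def)
qed

lemma L2_norm_eq_0_iff:
  assumes "f \<in> L2 M" shows "L2_norm M f = 0 \<longleftrightarrow> (AE z in M. f z = 0)"
  using assms integral_nonneg_eq_0_iff_AE[OF L2_integrable[OF assms]] by (simp add: L2_norm_def)

lemma L2_norm_cong_AE:
  assumes "f \<in> borel_measurable M" "h \<in> borel_measurable M" "AE z in M. f z = h z"
  shows "L2_norm M f = L2_norm M h"
  unfolding L2_norm_def using assms by (intro arg_cong[of _ _ sqrt] integral_cong_AE) (auto elim: eventually_mono)

lemma L2_inner_cong_AE: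
  assumes "f \<in> L2 M" "f' \<in> L2 M" "h \<in> L2 M" "h' \<in> L2 M" "AE z in M. f z = f' z" "AE z in M. h z = h' z"
  shows "L2_inner M f h = L2_inner M f' h'"
  unfolding L2_inner_def
proof (rule integral_cong_AE)
  note [measurable] = assms(1-4)[THEN L2_borel]
  show "AE z in M. cnj (f z) * h z = cnj (f' z) * h' z" using assms(5,6) by eventually_elim simp
  show "(\<lambda>z. cnj (f z) * h z) \<in> borel_measurable M" by measurable
  show "(\<lambda>z. cnj (f' z) * h' z) \<in> borel_measurable M" by measurable
qed

lemma L2_cong_AE:
  assumes "f \<in> L2 M" "h \<in> borel_measurable M" "AE z in M. f z = h z" shows "h \<in> L2 M"
  using assms(2) L2_integrable[OF assms(1)]
  by (rule L2_dominated) (use assms(3) in \<open>auto elim: eventually_mono\<close>)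

text \<open>Limits have to be compared with representatives chosen by \<open>SOME\<close>, which are
  determined only up to null sets.\<close>

lemma L2_lim_cong_AE:
  assumes "L2_lim M F f" "h \<in> borel_measurable M" "AE z in M. f z = h z" shows "L2_lim M F h"
proof -
  have h: "h \<in> L2 M" using L2_cong_AE assms by (auto simp: L2_lim_def)
  have "L2_norm M (\<lambda>z. F m z - h z) = L2_norm M (\<lambda>z. F m z - f z)" for m
    using assms h L2.diff[THEN L2_borel] by (intro L2_norm_cong_AE) (auto simp: L2_lim_def elim: eventually_mono)
  then show ?thesis using assms(1) h by (simp add: L2_lim_def)
qed

lemma L2_lim_unique:
  assumes "L2_lim M F f" "L2_lim M F h" shows "AE z in M. f z = h z"
proof -
  have "L2_norm M (\<lambda>z. f z - h z) = 0" using assms by (rule L2.conv_unique)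
  then show ?thesis using L2_norm_eq_0_iff[OF L2.diff, of f M h] assms by (simp add: L2_lim_def)
qed

lemma ennreal_term_le_suminf: "f k \<le> (\<Sum>k. f k :: ennreal)"
  using sum_le_suminf[OF summableI, of "{k}" f] by simp

text \<open>A subsequence whose increments are at most \<open>4\<^sup>-\<^sup>k\<close> in norm converges almost everywhere.\<close>
lemma L2_complete:
  assumes "hermitian_form.cauchy (L2 M) (L2_inner M) F"
  shows "\<exists>f. L2_lim M F f"
proof -
  have F: "F m \<in> L2 M" for m using assms by (auto simp: L2.cauchy_def)
  note [measurable] = L2_borel[OF F]
  have C: "\<exists>N. \<forall>m\<ge>N. \<forall>n\<ge>N. L2_norm M (\<lambda>z. F m z - F n z) < e" if "e > 0" for e
    using assms that by (auto simp: L2.cauchy_def)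
  obtain c where c: "\<And>k m n. m \<ge> c k \<Longrightarrow> n \<ge> c k \<Longrightarrow> L2_norm M (\<lambda>z. F m z - F n z) < (1/4)^k"
    using C[of "(1/4)^k" for k] by (metis zero_less_power zero_less_divide_1_iff zero_less_numeral)
  \<comment> \<open>The sum dominates \<open>c k\<close> and makes \<open>r\<close> monotone; adding
    \<open>k\<close> gives \<open>k \<le> r k\<close>, so the indices are unbounded.\<close>
  define r where "r k = (\<Sum>j\<le>k. c j) + k" for k
  have r_c: "c k \<le> r k" for k unfolding r_def by (simp add: trans_le_add1 member_le_sum)
  have r_mono: "r k \<le> r (Suc k)" for k unfolding r_def by simp
  have r_ge: "k \<le> r k" for k unfolding r_def by simp
  define \<Delta> where "\<Delta> k z = F (r (Suc k)) z - F (r k) z" for k z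
  have [measurable]: "\<Delta> k \<in> borel_measurable M" for k unfolding \<Delta>_def by measurable
  have \<Delta>L2: "\<Delta> k \<in> L2 M" for k unfolding \<Delta>_def by (intro L2.diff F)
  have \<Delta>n: "(LINT z|M. (cmod (\<Delta> k z))\<^sup>2) \<le> (1/16)^k" for k
  proof -
    have "L2_norm M (\<Delta> k) \<le> (1/4)^k"
      using c[of k "r (Suc k)" "r k"] r_c[of k] r_mono[of k] by (simp add: \<Delta>_def[abs_def] less_imp_le)
    then have "(L2_norm M (\<Delta> k))\<^sup>2 \<le> ((1/4)^k)\<^sup>2" using L2_norm_nonneg by (intro power_mono)
    also have "((1/4)^k)\<^sup>2 = (1/16::real)^k" by (simp add: power2_eq_square power_mult_distrib[symmetric])
    finally show ?thesis by (simp add: L2_norm_sq)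
  qed
  \<comment> \<open>The weight \<open>4 ^ k\<close> lies between two rates: against integrals of
    size \<open>(1/16) ^ k\<close> it leaves a convergent series, while finiteness of
    \<open>S z\<close> still forces the increments below a multiple of \<open>(1/2) ^ k\<close>,
    which is summable.\<close>
  define S where "S z = (\<Sum>k. ennreal (4^k * (cmod (\<Delta> k z))\<^sup>2))" for z
  have "(\<integral>\<^sup>+z. S z \<partial>M) = (\<Sum>k. \<integral>\<^sup>+z. ennreal (4^k * (cmod (\<Delta> k z))\<^sup>2) \<partial>M)"
    unfolding S_def by (rule nn_integral_suminf) simp
  also have "\<dots> \<le> (\<Sum>k. ennreal ((1/4)^k))"
  proof (rule suminf_le)
    fix k
    have "(\<integral>\<^sup>+z. ennreal (4^k * (cmod (\<Delta> k z))\<^sup>2) \<partial>M) = ennreal (LINT z|M. 4^k * (cmod (\<Delta> k z))\<^sup>2)"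
      using L2_integrable[OF \<Delta>L2] by (intro nn_integral_eq_integral) auto
    also have "(LINT z|M. 4^k * (cmod (\<Delta> k z))\<^sup>2) \<le> 4^k * (1/16)^k"
      using \<Delta>n[of k] by simp
    also have "4^k * (1/16)^k = (1/4::real)^k" by (simp add: power_mult_distrib[symmetric])
    finally show "(\<integral>\<^sup>+z. ennreal (4^k * (cmod (\<Delta> k z))\<^sup>2) \<partial>M) \<le> ennreal ((1/4)^k)" by (simp add: ennreal_leI)
  qed auto
  also have "\<dots> < \<infinity>"
    using summable_geometric[of "1/4::real"] by (subst suminf_ennreal2) (auto simp: )
  finally have "(\<integral>\<^sup>+z. S z \<partial>M) \<noteq> \<infinity>" by simp
  moreover have "S \<in> borel_measurable M" unfolding S_def by measurable
  ultimately have "AE z in M. S z \<noteq> \<infinity>" by (intro nn_integral_PInf_AE)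
  then have conv: "AE z in M. convergent (\<lambda>k. F (r k) z)"
  proof eventually_elim
    case (elim z)
    define C where "C = enn2real (S z)"
    have C: "S z = ennreal C" "C \<ge> 0" using elim by (simp_all add: C_def ennreal_enn2real_if)
    have bd: "norm (\<Delta> k z) \<le> sqrt C * (1/2)^k" for k
    proof -
      have "ennreal (4^k * (cmod (\<Delta> k z))\<^sup>2) \<le> S z" unfolding S_def
        by (rule ennreal_term_le_suminf)
      then have "4^k * (cmod (\<Delta> k z))\<^sup>2 \<le> C" using C by (simp only: ennreal_le_iff)
      then have "(2^k * cmod (\<Delta> k z))\<^sup>2 \<le> C" 
      proof -
        have "(2^k)\<^sup>2 = (4::real)^k" by (simp add: power2_eq_square flip: power_mult_distrib)
        then show ?thesis using \<open>4^k * (cmod (\<Delta> k z))\<^sup>2 \<le> C\<close> by (simp only: power_mult_distrib)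
      qed
      then have "2^k * cmod (\<Delta> k z) \<le> sqrt C" by (rule real_le_rsqrt)
      then show ?thesis by (simp add: power_divide pos_le_divide_eq mult.commute)
    qed
    have "summable (\<lambda>k. sqrt C * (1/2)^k)" by (intro summable_mult summable_geometric) simp
    then have "summable (\<lambda>k. \<Delta> k z)" by (rule summable_comparison_test'[where N = 0]) (rule bd)
    then have "(\<lambda>n. \<Sum>k<n. \<Delta> k z) \<longlonglongrightarrow> (\<Sum>k. \<Delta> k z)" by (rule summable_LIMSEQ)
    moreover have "(\<Sum>k<n. \<Delta> k z) = F (r n) z - F (r 0) z" for n unfolding \<Delta>_def by (rule sum_lessThan_telescope)
    ultimately have "(\<lambda>n. F (r n) z - F (r 0) z + F (r 0) z) \<longlonglongrightarrow> (\<Sum>k. \<Delta> k z) + F (r 0) z" by (simp only: tendsto_add tendsto_const)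
    then show ?case by (auto simp: convergent_def)
  qed
  define f where "f z = lim (\<lambda>k. F (r k) z)" for z
  have [measurable]: "f \<in> borel_measurable M" unfolding f_def by measurable
  \<comment> \<open>Fatou's lemma along the subsequence estimates the distance of every late
    \<open>F m\<close> from \<open>f\<close>, so the whole sequence converges and not just the
    subsequence.\<close>
  have fatou: "(\<integral>\<^sup>+z. ennreal ((cmod (F m z - f z))\<^sup>2) \<partial>M) \<le> ennreal (e\<^sup>2)"
    if e: "e > 0" and N: "\<And>m n. m \<ge> N \<Longrightarrow> n \<ge> N \<Longrightarrow> L2_norm M (\<lambda>z. F m z - F n z) < e" and m: "m \<ge> N" for e m N
  proof -
    have "(\<integral>\<^sup>+z. ennreal ((cmod (F m z - f z))\<^sup>2) \<partial>M)
        = (\<integral>\<^sup>+z. liminf (\<lambda>k. ennreal ((cmod (F m z - F (r k) z))\<^sup>2)) \<partial>M)"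
      using conv
    proof (intro nn_integral_cong_AE, eventually_elim)
      case (elim z)
      then have "(\<lambda>k. F (r k) z) \<longlonglongrightarrow> f z" unfolding f_def by (simp add: convergent_LIMSEQ_iff)
      then have "(\<lambda>k. ennreal ((cmod (F m z - F (r k) z))\<^sup>2)) \<longlonglongrightarrow> ennreal ((cmod (F m z - f z))\<^sup>2)"
        by (intro tendsto_ennrealI tendsto_intros)
      then show ?case by (rule lim_imp_Liminf[OF sequentially_bot, symmetric])
    qed
    also have "\<dots> \<le> liminf (\<lambda>k. \<integral>\<^sup>+z. ennreal ((cmod (F m z - F (r k) z))\<^sup>2) \<partial>M)"
      by (rule nn_integral_liminf) measurable
    also have "\<dots> \<le> liminf (\<lambda>k::nat. ennreal (e\<^sup>2))"
    proof (rule Liminf_mono)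
      show "\<forall>\<^sub>F k in sequentially. (\<integral>\<^sup>+z. ennreal ((cmod (F m z - F (r k) z))\<^sup>2) \<partial>M) \<le> ennreal (e\<^sup>2)"
        using eventually_ge_at_top[of N]
      proof eventually_elim
        case (elim k)
        then have "L2_norm M (\<lambda>z. F m z - F (r k) z) < e" using N[OF m] r_ge[of k] by auto
        then have "(L2_norm M (\<lambda>z. F m z - F (r k) z))\<^sup>2 \<le> e\<^sup>2" using L2_norm_nonneg by (intro power_mono) auto
        then show ?case
          using L2_integrable[OF L2.diff[OF F F]] unfolding L2_norm_sq
          by (subst nn_integral_eq_integral) (auto intro: ennreal_leI)
      qed
    qed
    also have "\<dots> = ennreal (e\<^sup>2)" by (simp add: Liminf_const)
    finally show ?thesis .
  qed
  have diffL2: "(\<lambda>z. F m z - f z) \<in> L2 M" and diffn: "L2_norm M (\<lambda>z. F m z - f z) \<le> e"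
    if e: "e > 0" and N: "\<And>m n. m \<ge> N \<Longrightarrow> n \<ge> N \<Longrightarrow> L2_norm M (\<lambda>z. F m z - F n z) < e" and m: "m \<ge> N" for e m N
  proof -
    have bd: "(\<integral>\<^sup>+z. ennreal ((cmod (F m z - f z))\<^sup>2) \<partial>M) \<le> ennreal (e\<^sup>2)" by (rule fatou) fact+
    then have "(\<integral>\<^sup>+z. ennreal ((cmod (F m z - f z))\<^sup>2) \<partial>M) < \<infinity>" by (rule order.strict_trans1) simp
    then show L: "(\<lambda>z. F m z - f z) \<in> L2 M" by (intro L2I integrableI_nonneg) auto
    then have "ennreal (LINT z|M. (cmod (F m z - f z))\<^sup>2) \<le> ennreal (e\<^sup>2)"
      using bd by (subst nn_integral_eq_integral[symmetric]) (auto dest: L2_integrable)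
    then have "(L2_norm M (\<lambda>z. F m z - f z))\<^sup>2 \<le> e\<^sup>2" by (simp add: L2_norm_sq)
    then show "L2_norm M (\<lambda>z. F m z - f z) \<le> e" by (rule power2_le_imp_le) (use e in simp)
  qed
  obtain N1 where "\<And>m n. m \<ge> N1 \<Longrightarrow> n \<ge> N1 \<Longrightarrow> L2_norm M (\<lambda>z. F m z - F n z) < 1" using C[of 1] by auto
  from diffL2[OF _ this, of N1] have "(\<lambda>z. F N1 z - f z) \<in> L2 M" by simp
  from L2.diff[OF F this, of N1] have f: "f \<in> L2 M" by simp
  have "(\<lambda>m. L2_norm M (\<lambda>z. F m z - f z)) \<longlonglongrightarrow> 0"
  proof (rule LIMSEQ_I)
    fix e :: real assume "0 < e"
    then obtain N where "\<And>m n. m \<ge> N \<Longrightarrow> n \<ge> N \<Longrightarrow> L2_norm M (\<lambda>z. F m z - F n z) < e / 2" using C[of "e/2"] by auto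
    from diffn[OF _ this] \<open>0 < e\<close> show "\<exists>no. \<forall>n\<ge>no. norm (L2_norm M (\<lambda>z. F n z - f z) - 0) < e"
      using L2_norm_nonneg by (intro exI[of _ N]) force
  qed
  then show ?thesis using F f by (auto simp: L2_lim_def)
qed


section \<open>Calculus on the cube\<close>

abbreviation segment_measure :: "real \<Rightarrow> real measure" where
  "segment_measure l \<equiv> restrict_space lborel {0<..<l}"

lemma space_segment_measure [simp]: "space (segment_measure l) = {0<..<l}"
  by (simp add: space_restrict_space)

lemma finite_measure_segment_measure: "finite_measure (segment_measure l)"
  by (rule finite_measureI, cases "0 \<le> l") (simp_all add: emeasure_restrict_space)

interpretation line: finite_measure "segment_measure l" for l by (rule finite_measure_segment_measure)

interpretation cube: product_sigma_finite "\<lambda>_::nat. segment_measure l" for l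
  by unfold_locales

lemma space_cube: "space (cube_measure I l) = I \<rightarrow>\<^sub>E {0<..<l}"
  by (simp add: cube_measure_def space_PiM)

lemma emeasure_cube: "finite I \<Longrightarrow> emeasure (cube_measure I l) (space (cube_measure I l)) = ennreal (max 0 l ^ card I)"
  unfolding cube_measure_def space_PiM
  by (subst cube.emeasure_PiM) (auto simp: emeasure_restrict_space max_def sets_restrict_space ennreal_power power_0_left)

lemma finite_measure_cube: "finite I \<Longrightarrow> finite_measure (cube_measure I l)"
  by (rule finite_measureI) (simp add: emeasure_cube ennreal_power)

lemma measurable_cube_component:
  assumes "i \<in> I" shows "(\<lambda>z. z i) \<in> borel_measurable (cube_measure I l)"
proof -
  have "(\<lambda>z. z i) \<in> measurable (cube_measure I l) (segment_measure l)"
    unfolding cube_measure_def using assms by (rule measurable_component_singleton)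
  moreover have "(\<lambda>x. x) \<in> measurable (segment_measure l) borel"
    by (rule measurable_restrict_space1) simp
  ultimately show ?thesis by (rule measurable_compose)
qed

text \<open>Test functions are continuous on \<open>extensional I\<close> as a subspace of
  \<open>nat \<Rightarrow> real\<close>, whereas the cube carries a product over \<open>I\<close>
  only. The two structures fit because the coordinates outside \<open>I\<close> are constantly
  \<open>undefined\<close> and the Borel sets of the full product are generated by the
  coordinates.\<close>

lemma measurable_cube_borel: "(\<lambda>z. z) \<in> borel_measurable (cube_measure I l)"
proof -
  have "(\<lambda>z. z) \<in> measurable (cube_measure I l) (Pi\<^sub>M UNIV (\<lambda>_. borel))"
  proof (rule measurable_PiM_single')
    fix i
    show "(\<lambda>z. z i) \<in> borel_measurable (cube_measure I l)"
    proof (cases "i \<in> I")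
      case False
      then have "z i = undefined" if "z \<in> space (cube_measure I l)" for z
        using that by (auto simp: space_cube PiE_def extensional_def)
      then show ?thesis by (subst measurable_cong[where g = "\<lambda>_. undefined"]) auto
    qed (rule measurable_cube_component)
  qed auto
  then show ?thesis using measurable_cong_sets[OF refl sets_PiM_equal_borel] by blast
qed

lemma borel_measurable_cube_continuous:
  fixes \<phi> :: "(nat \<Rightarrow> real) \<Rightarrow> complex"
  assumes "continuous_on (extensional I) \<phi>" shows "\<phi> \<in> borel_measurable (cube_measure I l)"
proof (rule measurable_compose[where f = "\<lambda>z. z"])
  show "(\<lambda>z. z) \<in> measurable (cube_measure I l) (restrict_space borel (extensional I))"
    using measurable_cube_borel by (rule measurable_restrict_space2[rotated]) (auto simp: space_cube PiE_def)
qed (rule borel_measurable_continuous_on_restrict[OF assms])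

lemma measurable_cube_upd:
  assumes "k \<in> I"
  shows "(\<lambda>(z, t). z(k := t)) \<in> measurable (cube_measure (I - {k}) l \<Otimes>\<^sub>M segment_measure l) (cube_measure I l)"
proof -
  have I: "insert k (I - {k}) = I" using assms by auto
  show ?thesis using measurable_add_dim[of k "I - {k}" "\<lambda>_. segment_measure l"] unfolding cube_measure_def I .
qed

lemma measurable_cube_diag:
  assumes "k \<in> I" "i \<in> I - {k}"
  shows "(\<lambda>z. z(k := z i)) \<in> measurable (cube_measure (I - {k}) l) (cube_measure I l)"
proof -
  have "(\<lambda>z. (z, z i)) \<in> measurable (cube_measure (I - {k}) l) (cube_measure (I - {k}) l \<Otimes>\<^sub>M segment_measure l)"
    using assms(2) unfolding cube_measure_def
    by (intro measurable_Pair measurable_ident_sets[OF refl] measurable_component_singleton)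
  from measurable_compose[OF this measurable_cube_upd[OF assms(1)]] show ?thesis by simp
qed

lemma cube_upd_space: "z \<in> I - {k} \<rightarrow>\<^sub>E A \<Longrightarrow> t \<in> A \<Longrightarrow> k \<in> I \<Longrightarrow> z(k := t) \<in> I \<rightarrow>\<^sub>E A"
  by (auto simp: PiE_def extensional_def)

lemma integrable_bounded:
  fixes F :: "_ \<Rightarrow> 'b::{banach, second_countable_topology}"
  assumes "finite_measure M" "F \<in> borel_measurable M" "\<And>z. z \<in> space M \<Longrightarrow> norm (F z) \<le> C"
  shows "integrable M F"
  by (rule finite_measure.integrable_const_bound[OF assms(1) AE_I2[OF assms(3)] assms(2)])

text \<open>Fubini in the single direction \<open>k\<close>, for bounded integrands, for which
  integrability on a finite measure is automatic. One-dimensional estimates are applied to the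
  slices \<open>F (z(k := t))\<close> and then integrated over the opposite face.\<close>

context
  fixes F :: "(nat \<Rightarrow> real) \<Rightarrow> 'b::{banach, second_countable_topology}" and n k :: nat and l C :: real
  assumes F: "F \<in> borel_measurable (cube_measure {..<n} l)"
    and C: "\<And>z. z \<in> space (cube_measure {..<n} l) \<Longrightarrow> norm (F z) \<le> C"
    and k: "k < n"
begin

lemma fubini_slice:
  assumes "z \<in> space (cube_measure ({..<n} - {k}) l)"
  shows "integrable (segment_measure l) (\<lambda>t. F (z(k := t)))"
proof (rule integrable_bounded[OF finite_measure_segment_measure])
  have "(\<lambda>p. F ((\<lambda>(z, t). z(k := t)) p)) \<in> borel_measurable (cube_measure ({..<n} - {k}) l \<Otimes>\<^sub>M segment_measure l)"
    using measurable_compose[OF measurable_cube_upd F] k by simp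
  from measurable_compose_Pair1[OF assms this] show "(\<lambda>t. F (z(k := t))) \<in> borel_measurable (segment_measure l)" by simp
  show "norm (F (z(k := t))) \<le> C" if "t \<in> space (segment_measure l)" for t
    using cube_upd_space[of z "{..<n}" k "{0<..<l}" t] assms that k by (intro C) (auto simp: space_cube)
qed

lemma fubini_integrable_inner:
  "integrable (cube_measure ({..<n} - {k}) l) (\<lambda>z. LINT t|segment_measure l. F (z(k := t)))"
proof (rule integrable_bounded[OF finite_measure_cube])
  have "(\<lambda>p. F ((\<lambda>(z, t). z(k := t)) p)) \<in> borel_measurable (cube_measure ({..<n} - {k}) l \<Otimes>\<^sub>M segment_measure l)"
    using measurable_compose[OF measurable_cube_upd F] k by simp
  then have "(\<lambda>(z, t). F (z(k := t))) \<in> borel_measurable (cube_measure ({..<n} - {k}) l \<Otimes>\<^sub>M segment_measure l)"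
    by (simp add: case_prod_beta')
  then show "(\<lambda>z. LINT t|segment_measure l. F (z(k := t))) \<in> borel_measurable (cube_measure ({..<n} - {k}) l)"
    by (rule line.borel_measurable_lebesgue_integral)
  show "norm (LINT t|segment_measure l. F (z(k := t))) \<le> C * measure (segment_measure l) (space (segment_measure l))"
    if z: "z \<in> space (cube_measure ({..<n} - {k}) l)" for z
  proof -
    have "norm (LINT t|segment_measure l. F (z(k := t))) \<le> (LINT t|segment_measure l. norm (F (z(k := t))))"
      by (rule integral_norm_bound)
    also have "\<dots> \<le> (LINT t|segment_measure l. C)"
      using fubini_slice[OF z] cube_upd_space[of z "{..<n}" k "{0<..<l}"] z k
      by (intro integral_mono) (auto simp: space_cube intro!: C)
    finally show ?thesis by (simp add: mult.commute)
  qed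
qed simp

lemma fubini_integrable: "integrable (cube_measure {..<n} l) F"
  using F C by (intro integrable_bounded[OF finite_measure_cube]) auto

lemma fubini:
  "(LINT z|cube_measure {..<n} l. F z) =
   (LINT z|cube_measure ({..<n} - {k}) l. LINT t|segment_measure l. F (z(k := t)))"
proof -
  have I: "insert k ({..<n} - {k}) = {..<n}" using k by auto
  show ?thesis
    using cube.product_integral_insert[of "{..<n} - {k}" k l F] fubini_integrable
    unfolding cube_measure_def I by simp
qed

end

text \<open>The fundamental theorem of calculus and Cauchy-Schwarz on \<open>[a, b]\<close>. This
  one-dimensional Hoelder bound is the source of the trace inequality, of the smearing of the
  contact interaction and of the sup bound for one particle.\<close>

lemma C1_diff_sq_le:
  fixes f f' :: "real \<Rightarrow> complex"
  assumes f: "\<And>t. (f has_vector_derivative f' t) (at t)" and cont: "continuous_on UNIV f'"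
    and ab: "a \<in> {0..l}" "b \<in> {0..l}" 
  shows "(cmod (f b - f a))\<^sup>2 \<le> \<bar>b - a\<bar> * (LINT t|segment_measure l. (cmod (f' t))\<^sup>2)"
  using ab
proof (induction a b rule: linorder_wlog)
  case (sym a b)
  then show ?case by (simp add: norm_minus_commute abs_minus_commute)
next
  case (le a b)
  have integ: "integrable lborel (\<lambda>t. indicator {c..d} t *\<^sub>R h t)" if "continuous_on UNIV h"
    for h :: "real \<Rightarrow> 'c::euclidean_space" and c d
    by (rule borel_integrable_compact[OF compact_Icc continuous_on_subset[OF that subset_UNIV]])
  have "has_bochner_integral lborel (\<lambda>t. indicator {a..b} t *\<^sub>R f' t) (f b - f a)"
    by (rule has_bochner_integral_FTC_Icc[OF le(1) has_vector_derivative_at_within[OF f]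
          continuous_on_subset[OF cont subset_UNIV]])
  then have "f b - f a = (LINT t|lborel. indicator {a..b} t *\<^sub>R f' t)" by (simp add: has_bochner_integral_iff)
  then have 1: "cmod (f b - f a) \<le> (LINT t|lborel. indicator {a..b} t *\<^sub>R cmod (f' t))"
    using integral_norm_bound[of lborel "\<lambda>t. indicator {a..b} t *\<^sub>R f' t"] by (simp add: norm_mult)
  define A where "A = (LINT t|lborel. indicator {a..b} t *\<^sub>R cmod (f' t))"
  define Q where "Q = (LINT t|lborel. indicator {a..b} t *\<^sub>R (cmod (f' t))\<^sup>2)"
  have i1: "integrable lborel (\<lambda>t. indicator {a..b} t *\<^sub>R cmod (f' t))"
    and i2: "integrable lborel (\<lambda>t. indicator {a..b} t *\<^sub>R (cmod (f' t))\<^sup>2)"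
    and i3: "integrable lborel (\<lambda>t. indicator {a..b} t *\<^sub>R (\<mu>::real))" for \<mu>
    by (rule integ, intro continuous_intros cont)+
  \<comment> \<open>Expands the integral of \<open>(cmod (f' t) - \<mu>)\<^sup>2\<close>; taking for
    \<mu> the mean \<open>A / d\<close> of \<open>cmod (f' t)\<close> turns it into
    Cauchy-Schwarz.\<close>
  have quad: "0 \<le> Q - 2 * \<mu> * A + \<mu>\<^sup>2 * (b - a)" for \<mu> :: real
  proof -
    have "0 \<le> (LINT t|lborel. indicator {a..b} t *\<^sub>R (cmod (f' t) - \<mu>)\<^sup>2)" by (intro integral_nonneg_AE) auto
    also have "\<dots> = (LINT t|lborel. indicator {a..b} t *\<^sub>R (cmod (f' t))\<^sup>2 - 2 * \<mu> * (indicator {a..b} t *\<^sub>R cmod (f' t)) + indicator {a..b} t *\<^sub>R \<mu>\<^sup>2)"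
      by (intro Bochner_Integration.integral_cong refl) (simp add: power2_diff algebra_simps)
    also have "\<dots> = Q - 2 * \<mu> * A + (LINT t|lborel. indicator {a..b} t *\<^sub>R \<mu>\<^sup>2)"
      unfolding Q_def A_def using i1 i2 i3[of "\<mu>\<^sup>2"]
      by (simp only: Bochner_Integration.integral_add Bochner_Integration.integral_diff integral_mult_right_zero
          Bochner_Integration.integrable_diff integrable_mult_right)
    also have "(LINT t|lborel. indicator {a..b} t *\<^sub>R \<mu>\<^sup>2) = \<mu>\<^sup>2 * (b - a)" using le by simp
    finally show ?thesis .
  qed
  have "A\<^sup>2 \<le> (b - a) * Q"
  proof (cases "a = b")
    case True
    have "AE t in lborel. indicator {a..b} t *\<^sub>R cmod (f' t) = 0"
      using AE_lborel_singleton[of b] by eventually_elim (simp add: True)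
    then have "A = 0" unfolding A_def by (intro integral_eq_zero_AE)
    then show ?thesis using True by simp
  next
    case False
    define d where "d = b - a"
    have d: "d > 0" using le False by (simp add: d_def)
    have "0 \<le> Q - 2 * (A / d) * A + (A / d)\<^sup>2 * d" using quad[of "A / d"] by (simp add: d_def)
    also have "\<dots> = Q - A\<^sup>2 / d" using d by (simp add: field_simps power2_eq_square)
    finally show ?thesis using d by (simp add: field_simps flip: d_def)
  qed
  moreover have "Q \<le> (LINT t|segment_measure l. (cmod (f' t))\<^sup>2)"
  proof -
    have "(LINT t|segment_measure l. (cmod (f' t))\<^sup>2) = (LINT t|lborel. indicator {0<..<l} t *\<^sub>R (cmod (f' t))\<^sup>2)"
      by (subst integral_restrict_space) auto
    also have "\<dots> = (LINT t|lborel. indicator {0..l} t *\<^sub>R (cmod (f' t))\<^sup>2)"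
    proof (rule integral_cong_AE)
      note [measurable] = borel_measurable_continuous_onI[OF cont]
      show "(\<lambda>t. indicator {0<..<l} t *\<^sub>R (cmod (f' t))\<^sup>2) \<in> borel_measurable lborel"
        "(\<lambda>t. indicator {0..l} t *\<^sub>R (cmod (f' t))\<^sup>2) \<in> borel_measurable lborel" by measurable
      show "AE t in lborel. indicator {0<..<l} t *\<^sub>R (cmod (f' t))\<^sup>2 = indicator {0..l} t *\<^sub>R (cmod (f' t))\<^sup>2"
        using AE_lborel_singleton[of 0] AE_lborel_singleton[of l] by eventually_elim (auto simp: indicator_def)
    qed
    also have "Q \<le> \<dots>" unfolding Q_def
    proof (rule integral_mono[OF i2 integ])
      show "continuous_on UNIV (\<lambda>t. (cmod (f' t))\<^sup>2)" using cont by (intro continuous_intros)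
    qed (use le in \<open>auto simp: indicator_def\<close>)
    finally show ?thesis .
  qed
  moreover have "0 \<le> A" unfolding A_def by (intro integral_nonneg_AE) auto
  ultimately have "A\<^sup>2 \<le> (b - a) * (LINT t|segment_measure l. (cmod (f' t))\<^sup>2)"
    using le by (meson diff_ge_0_iff_ge mult_left_mono order_trans)
  moreover have "(cmod (f b - f a))\<^sup>2 \<le> A\<^sup>2" using 1 unfolding A_def by (intro power_mono) auto
  ultimately show ?case using le by simp
qed

lemma continuous_on_fun_upd: "continuous_on UNIV (\<lambda>t. (z::nat \<Rightarrow> real)(i := t))"
proof (rule continuous_on_coordinatewise_then_product)
  fix j show "continuous_on UNIV (\<lambda>t. (z(i := t)) j)" by (cases "j = i") (auto intro: continuous_intros)
qed

lemma fun_upd_extensional: "z \<in> extensional I \<Longrightarrow> i \<in> I \<Longrightarrow> z(i := t) \<in> extensional I"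
  by (auto simp: extensional_def)

lemma smooth_continuous: "smooth n \<phi> \<Longrightarrow> continuous_on (extensional {..<n}) \<phi>"
  unfolding smooth_def by (metis lists.Nil)

text \<open>\<open>smooth\<close> only asserts that some family \<open>D\<close> of derivatives
  exists. Uniqueness of vector derivatives identifies \<open>D [i]\<close> with
  \<open>partial_deriv i \<phi>\<close> on extensional points, and replacing \<open>z\<close> by
  \<open>z(i := t)\<close> moves the base point along the line.\<close>

lemma smooth_partial:
  assumes "smooth n \<phi>" "i < n"
  shows "continuous_on (extensional {..<n}) (partial_deriv i \<phi>)"
    and "z \<in> extensional {..<n} \<Longrightarrow>
      ((\<lambda>t. \<phi> (z(i := t))) has_vector_derivative partial_deriv i \<phi> (z(i := t))) (at t)"
proof -
  obtain D where D: "D [] = \<phi>"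
    "\<And>is. is \<in> lists {..<n} \<Longrightarrow> continuous_on (extensional {..<n}) (D is)"
    "\<And>is j z. is \<in> lists {..<n} \<Longrightarrow> j < n \<Longrightarrow> z \<in> extensional {..<n} \<Longrightarrow>
       ((\<lambda>t. D is (z(j := t))) has_vector_derivative D (j # is) z) (at (z j))"
    using assms(1) unfolding smooth_def by blast
  have d: "((\<lambda>t. \<phi> (z(i := t))) has_vector_derivative D [i] z) (at (z i))" if "z \<in> extensional {..<n}" for z
    using D(3)[of "[]" i z] that assms(2) D(1) by simp
  have eq: "partial_deriv i \<phi> z = D [i] z" if "z \<in> extensional {..<n}" for z
    unfolding partial_deriv_def by (rule vector_derivative_at[OF d[OF that]])
  show "continuous_on (extensional {..<n}) (partial_deriv i \<phi>)"
    using D(2)[of "[i]"] assms(2) by (simp add: eq cong: continuous_on_cong)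
  assume z: "z \<in> extensional {..<n}"
  then have z': "z(i := t) \<in> extensional {..<n}" using assms(2) by (simp add: fun_upd_extensional)
  show "((\<lambda>t. \<phi> (z(i := t))) has_vector_derivative partial_deriv i \<phi> (z(i := t))) (at t)"
    using d[OF z'] unfolding eq[OF z'] fun_upd_upd fun_upd_same .
qed

lemma slice_continuous:
  fixes z :: "nat \<Rightarrow> real"
  assumes "continuous_on (extensional {..<n}) f" "i < n" "z \<in> extensional {..<n}"
  shows "continuous_on UNIV (\<lambda>t. f (z(i := t)))"
proof (rule continuous_on_compose2[OF assms(1), where f = "\<lambda>t. z(i := t)"])
  show "continuous_on UNIV (fun_upd z i)" by (rule continuous_on_fun_upd)
  show "range (fun_upd z i) \<subseteq> extensional {..<n}" 
    using fun_upd_extensional[OF assms(3)] assms(2) by (intro image_subsetI) simp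
qed

text \<open>The complement of a compact set is open, so \<phi> vanishes on a whole neighbourhood of
  \<open>z i\<close> along the coordinate line.\<close>

lemma partial_deriv_zero_outside_support:
  fixes z :: "nat \<Rightarrow> real"
  assumes "compact K" "\<And>z. z \<in> extensional {..<n} - K \<Longrightarrow> \<phi> z = 0" "z \<in> extensional {..<n} - K" "i < n"
  shows "partial_deriv i \<phi> z = 0"
proof -
  let ?S = "(\<lambda>s. z(i := s)) -` (- K)"
  have op: "open ?S"
    by (rule open_vimage[OF open_Compl[OF compact_imp_closed[OF assms(1)]] continuous_on_fun_upd])
  have mem: "z i \<in> ?S" using assms(3) by simp
  have zero: "0 = \<phi> (z(i := s))" if "s \<in> ?S" for s
  proof (rule assms(2)[symmetric], rule DiffI)
    show "z(i := s) \<in> extensional {..<n}" using assms(3,4) by (intro fun_upd_extensional) auto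
    show "z(i := s) \<notin> K" using that by simp
  qed
  have "((\<lambda>s. \<phi> (z(i := s))) has_vector_derivative 0) (at (z i))"
    by (rule has_vector_derivative_transform_within_open[OF has_vector_derivative_const op mem zero])
  then show ?thesis unfolding partial_deriv_def by (rule vector_derivative_at)
qed

lemma test_function_zero_outside:
  assumes "test_function n l \<phi>" "i < n" "z \<in> extensional {..<n}" "t \<notin> {0<..<l}"
  shows "\<phi> (z(i := t)) = 0"
proof -
  obtain K where K: "compact K" "K \<subseteq> {..<n} \<rightarrow>\<^sub>E {0<..<l}" "\<forall>z\<in>extensional {..<n} - K. \<phi> z = 0"
    using assms(1) unfolding test_function_def by metis
  have "z(i := t) \<notin> K"
  proof
    assume "z(i := t) \<in> K"
    then have "z(i := t) \<in> {..<n} \<rightarrow>\<^sub>E {0<..<l}" using K(2) by (rule rev_subsetD)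
    then have "(z(i := t)) i \<in> {0<..<l}" by (rule PiE_mem) (use assms(2) in simp)
    then show False using assms(4) by simp
  qed
  moreover have "z(i := t) \<in> extensional {..<n}" using assms(2,3) by (intro fun_upd_extensional) auto
  ultimately show ?thesis using K(3) by simp
qed

text \<open>Continuity on the compact support and vanishing outside. One constant serves \<phi> and
  all its first derivatives, which settles every integrability question on the cube.\<close>

lemma test_function_bounded:
  assumes "test_function n l \<phi>"
  obtains C where "C \<ge> 0" "\<And>z::nat \<Rightarrow> real. z \<in> extensional {..<n} \<Longrightarrow> cmod (\<phi> z) \<le> C"
    "\<And>(i::nat) (z::nat \<Rightarrow> real). i < n \<Longrightarrow> z \<in> extensional {..<n} \<Longrightarrow> cmod (partial_deriv i \<phi> z) \<le> C"
proof -
  obtain K where K: "compact K" "K \<subseteq> {..<n} \<rightarrow>\<^sub>E {0<..<l}" "\<forall>z\<in>extensional {..<n} - K. \<phi> z = 0"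
    using assms(1) unfolding test_function_def by metis
  have sm: "smooth n \<phi>" using assms(1) unfolding test_function_def by metis
  have Kext: "K \<subseteq> extensional {..<n}" using K(2) by (auto simp: PiE_def)
  have bdd: "\<exists>C. \<forall>z\<in>K. cmod (h z) \<le> C" if "continuous_on (extensional {..<n}) h" for h :: "_ \<Rightarrow> complex"
    using compact_imp_bounded[OF compact_continuous_image[OF continuous_on_subset[OF that Kext] K(1)]]
    unfolding bounded_iff by simp
  obtain C where C: "\<forall>z\<in>K. cmod (\<phi> z) \<le> C" using bdd[OF smooth_continuous[OF sm]] ..
  have "\<exists>C. \<forall>z\<in>K. cmod (partial_deriv i \<phi> z) \<le> C" if "i < n" for i
    by (rule bdd[OF smooth_partial(1)[OF sm that]])
  then obtain c where c: "\<And>i. i < n \<Longrightarrow> \<forall>z\<in>K. cmod (partial_deriv i \<phi> z) \<le> c i" by metis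
  define B where "B = \<bar>C\<bar> + (\<Sum>i<n. \<bar>c i\<bar>)"
  have B: "c i \<le> B" if "i < n" for i
  proof -
    have "\<bar>c i\<bar> \<le> (\<Sum>i<n. \<bar>c i\<bar>)" using that by (intro member_le_sum) auto
    then show ?thesis unfolding B_def by linarith
  qed
  have "0 \<le> (\<Sum>i<n. \<bar>c i\<bar>)" by (rule sum_nonneg) simp
  then have B0: "B \<ge> 0" "C \<le> B" unfolding B_def by linarith+
  show thesis
  proof (rule that[of B])
    fix z :: "nat \<Rightarrow> real" assume z: "z \<in> extensional {..<n}"
    show "cmod (\<phi> z) \<le> B"
    proof (cases "z \<in> K")
      case True then show ?thesis using C B0 by force
    next
      case False then show ?thesis using K(3) z B0 by simp
    qed
    fix i assume i: "i < n"
    show "cmod (partial_deriv i \<phi> z) \<le> B"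
    proof (cases "z \<in> K")
      case True then show ?thesis using c[OF i] B[OF i] by force
    next
      case False
      then have "partial_deriv i \<phi> z = 0"
        using partial_deriv_zero_outside_support[OF K(1), of n \<phi> z i] K(3) z i by simp
      then show ?thesis using B0 by simp
    qed
  qed fact
qed

lemma cube_extensional: "z \<in> space (cube_measure I l) \<Longrightarrow> z \<in> extensional I"
  by (simp add: space_cube PiE_def)

lemma test_function_measurable:
  assumes "test_function n l \<phi>"
  shows "\<phi> \<in> borel_measurable (cube_measure {..<n} l)"
    and "i < n \<Longrightarrow> partial_deriv i \<phi> \<in> borel_measurable (cube_measure {..<n} l)"
proof -
  have sm: "smooth n \<phi>" using assms unfolding test_function_def by metis
  show "\<phi> \<in> borel_measurable (cube_measure {..<n} l)"
    by (rule borel_measurable_cube_continuous[OF smooth_continuous[OF sm]])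
  assume "i < n"
  then show "partial_deriv i \<phi> \<in> borel_measurable (cube_measure {..<n} l)"
    by (rule borel_measurable_cube_continuous[OF smooth_partial(1)[OF sm]])
qed

lemma L2_bounded:
  assumes "finite_measure M" "f \<in> borel_measurable M" "\<And>z. z \<in> space M \<Longrightarrow> cmod (f z) \<le> C"
  shows "f \<in> L2 M"
proof (rule L2I[OF assms(2)])
  note [measurable] = assms(2)
  show "integrable M (\<lambda>z. (cmod (f z))\<^sup>2)"
    using assms(3) by (intro integrable_bounded[OF assms(1), where C = "C\<^sup>2"]) (auto intro: power_mono)
qed

lemma test_function_L2:
  assumes "test_function n l \<phi>"
  shows "\<phi> \<in> L2 (cube_measure {..<n} l)"
    and "i < n \<Longrightarrow> partial_deriv i \<phi> \<in> L2 (cube_measure {..<n} l)"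
proof -
  obtain C where C: "C \<ge> 0" "\<And>z. z \<in> extensional {..<n} \<Longrightarrow> cmod (\<phi> z) \<le> C"
    "\<And>i z. i < n \<Longrightarrow> z \<in> extensional {..<n} \<Longrightarrow> cmod (partial_deriv i \<phi> z) \<le> C"
    using test_function_bounded[OF assms] by metis
  show "\<phi> \<in> L2 (cube_measure {..<n} l)"
    by (rule L2_bounded[OF finite_measure_cube test_function_measurable(1)[OF assms] C(2)])
      (simp, rule cube_extensional)
  assume i: "i < n"
  show "partial_deriv i \<phi> \<in> L2 (cube_measure {..<n} l)"
    by (rule L2_bounded[OF finite_measure_cube test_function_measurable(2)[OF assms i] C(3)[OF i]])
      (simp, rule cube_extensional)
qed

lemma diagonal_restriction_L2:
  assumes "test_function n l \<phi>" "k < n" "i < n" "i \<noteq> k"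
  shows "(\<lambda>z. \<phi> (z(k := z i))) \<in> L2 (cube_measure ({..<n} - {k}) l)"
proof -
  obtain C where C: "C \<ge> 0" "\<And>z. z \<in> extensional {..<n} \<Longrightarrow> cmod (\<phi> z) \<le> C"
    using test_function_bounded[OF assms(1)] by metis
  have ext: "z(k := z i) \<in> extensional {..<n}" if "z \<in> space (cube_measure ({..<n} - {k}) l)" for z
    using cube_extensional[OF that] assms(2) by (simp add: extensional_def)
  have meas: "(\<lambda>z. \<phi> (z(k := z i))) \<in> borel_measurable (cube_measure ({..<n} - {k}) l)"
    using assms(2-4) by (intro measurable_compose[OF measurable_cube_diag test_function_measurable(1)[OF assms(1)]]) auto
  show ?thesis
    by (rule L2_bounded[OF finite_measure_cube meas C(2)[OF ext]]) simp
qed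

lemma restricted_extensional:
  assumes "z \<in> space (cube_measure ({..<n} - {k}) l)" "k < n" shows "z(k := t) \<in> extensional {..<n}"
  using cube_extensional[OF assms(1)] assms(2) by (simp add: extensional_def)

lemma slice_derivative:
  assumes "test_function n l \<phi>" "k < n" "z \<in> space (cube_measure ({..<n} - {k}) l)"
  shows "((\<lambda>t. \<phi> (z(k := t))) has_vector_derivative partial_deriv k \<phi> (z(k := t))) (at t)"
    and "continuous_on UNIV (\<lambda>t. partial_deriv k \<phi> (z(k := t)))"
    and "t \<notin> {0<..<l} \<Longrightarrow> \<phi> (z(k := t)) = 0"
proof -
  have sm: "smooth n \<phi>" using assms(1) unfolding test_function_def by metis
  have z: "z(k := 0) \<in> extensional {..<n}" by (rule restricted_extensional[OF assms(3,2)])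
  show "((\<lambda>t. \<phi> (z(k := t))) has_vector_derivative partial_deriv k \<phi> (z(k := t))) (at t)"
    using smooth_partial(2)[OF sm assms(2) z] by (simp only: fun_upd_upd)
  show "continuous_on UNIV (\<lambda>t. partial_deriv k \<phi> (z(k := t)))"
    using slice_continuous[OF smooth_partial(1)[OF sm assms(2)] assms(2) z] by (simp only: fun_upd_upd)
  show "\<phi> (z(k := t)) = 0" if "t \<notin> {0<..<l}"
    using test_function_zero_outside[OF assms(1,2) z that] by (simp only: fun_upd_upd)
qed

lemma slice_diff_sq_le:
  assumes "test_function n l \<phi>" "k < n" "z \<in> space (cube_measure ({..<n} - {k}) l)"
    "a \<in> {0..l}" "b \<in> {0..l}"
  shows "(cmod (\<phi> (z(k := b)) - \<phi> (z(k := a))))\<^sup>2 \<le>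
    \<bar>b - a\<bar> * (LINT t|segment_measure l. (cmod (partial_deriv k \<phi> (z(k := t))))\<^sup>2)"
  by (rule C1_diff_sq_le[OF slice_derivative(1,2)[OF assms(1-3)] assms(4,5)])


section \<open>Smooth bumps and the fundamental lemma of the calculus of variations\<close>

text \<open>Polynomials in \<open>1 / t\<close> are carried along because the resulting family is
  closed under differentiation; smoothness of \<open>exp (- c / t)\<close>, extended by 0, then
  follows from a single first-order computation.\<close>

definition poly_exp :: "real \<Rightarrow> real poly \<Rightarrow> real \<Rightarrow> real" where
  "poly_exp c p t = (if t > 0 then poly p (1 / t) * exp (- c / t) else 0)"

text \<open>The power \<open>x ^ k\<close> is generalised for the induction over coefficients:
  \<open>pCons a p\<close> splits into a monomial and \<open>x ^ Suc k * poly p x\<close>.\<close>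

lemma poly_times_exp_tendsto_0:
  assumes "c > 0" shows "((\<lambda>x. x ^ k * poly p x * exp (- c * x)) \<longlongrightarrow> (0::real)) at_top"
proof (induction p arbitrary: k)
  case 0 show ?case by simp
next
  case (pCons a p)
  have "((\<lambda>x. (c * x) ^ k / exp (c * x)) \<longlongrightarrow> 0) at_top"
    by (rule filterlim_compose[OF tendsto_power_div_exp_0])
      (rule filterlim_tendsto_pos_mult_at_top[OF tendsto_const assms filterlim_ident])
  from tendsto_mult_right_zero[OF this, of "a / c ^ k"]
  have "((\<lambda>x. a / c ^ k * ((c * x) ^ k / exp (c * x))) \<longlongrightarrow> 0) at_top" .
  moreover have "(\<lambda>x. a / c ^ k * ((c * x) ^ k / exp (c * x))) = (\<lambda>x. a * x ^ k * exp (- c * x))"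
    using assms by (auto simp: power_mult_distrib exp_minus field_simps)
  ultimately have "((\<lambda>x. a * x ^ k * exp (- c * x)) \<longlongrightarrow> 0) at_top" by simp
  from tendsto_add[OF this pCons.IH[of "Suc k"]] show ?case by (simp add: algebra_simps)
qed

text \<open>In terms of \<open>x = 1 / t\<close> differentiation sends the polynomial
  \<open>p\<close> to \<open>x\<^sup>2 * (c * p - p')\<close>, hence the \<open>monom 1 2\<close>.
  At 0 the right difference quotient is \<open>x * poly p x * exp (- c * x)\<close> with
  \<open>x\<close> tending to infinity.\<close>

lemma poly_exp_deriv:
  assumes "c > 0"
  shows "(poly_exp c p has_real_derivative poly_exp c (monom 1 2 * (smult c p - pderiv p)) t) (at t)"
proof -
  consider "t > 0" | "t < 0" | "t = 0" by linarith
  then show ?thesis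
  proof cases
    case 1
    have "((\<lambda>t. poly p (1 / t) * exp (- c / t)) has_real_derivative
        poly_exp c (monom 1 2 * (smult c p - pderiv p)) t) (at t)"
      using 1 by (auto intro!: derivative_eq_intros DERIV_chain'[of _ _ _ _ "poly p", OF _ poly_DERIV]
          simp: poly_exp_def poly_monom power2_eq_square field_simps)
    moreover have "\<forall>\<^sub>F t in nhds t. poly_exp c p t = poly p (1 / t) * exp (- c / t)"
      using eventually_nhds_in_open[of "{0<..}" t] 1 by (auto elim!: eventually_mono simp: poly_exp_def)
    ultimately show ?thesis by (subst DERIV_cong_ev[OF refl _ refl]) auto
  next
    case 2
    have "((\<lambda>t. 0) has_real_derivative 0) (at t)" by simp
    moreover have "\<forall>\<^sub>F t in nhds t. poly_exp c p t = 0"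
      using eventually_nhds_in_open[of "{..<0}" t] 2 by (auto elim!: eventually_mono simp: poly_exp_def)
    ultimately show ?thesis using 2 by (subst DERIV_cong_ev[OF refl _ refl]) (auto simp: poly_exp_def)
  next
    case 3
    have r: "((\<lambda>h. poly_exp c p h / h) \<longlongrightarrow> 0) (at_right 0)"
    proof -
      have "((\<lambda>h. inverse h ^ 1 * poly p (inverse h) * exp (- c * inverse h)) \<longlongrightarrow> 0) (at_right 0)"
        by (rule filterlim_compose[OF poly_times_exp_tendsto_0[OF assms] filterlim_inverse_at_top_right])
      moreover have "\<forall>\<^sub>F h in at_right 0. poly_exp c p h / h = inverse h ^ 1 * poly p (inverse h) * exp (- c * inverse h)"
        using eventually_at_right_less[of 0] by eventually_elim (simp add: poly_exp_def divide_simps)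
      ultimately show ?thesis by (simp add: tendsto_cong)
    qed
    have l: "((\<lambda>h. poly_exp c p h / h) \<longlongrightarrow> 0) (at_left 0)"
      by (rule tendsto_eventually) (auto simp: poly_exp_def eventually_at_left_field intro!: exI[of _ "-1"])
    have "((\<lambda>h. (poly_exp c p (0 + h) - poly_exp c p 0) / h) \<longlongrightarrow> 0) (at 0)"
      using r l by (subst filterlim_split_at_real) (auto simp: poly_exp_def)
    then show ?thesis using 3 by (simp add: DERIV_def poly_exp_def)
  qed
qed

definition smooth1 :: "(real \<Rightarrow> real) \<Rightarrow> bool" where
  "smooth1 f \<longleftrightarrow> (\<exists>D. D 0 = f \<and> (\<forall>k t. (D k has_real_derivative D (Suc k) t) (at t)))"

text \<open>Iterating a chosen derivative map inside \<open>S\<close> produces the sequence that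
  \<open>smooth1\<close> demands; no formula for higher derivatives has to be written down.\<close>

lemma smooth1_closed_family:
  assumes "f \<in> S" and "\<And>h. h \<in> S \<Longrightarrow> \<exists>h'\<in>S. \<forall>t. (h has_real_derivative h' t) (at t)"
  shows "smooth1 f"
proof -
  obtain d where d: "\<And>h. h \<in> S \<Longrightarrow> d h \<in> S" "\<And>h t. h \<in> S \<Longrightarrow> (h has_real_derivative d h t) (at t)"
    using assms(2) by metis
  define D where "D k = (d ^^ k) f" for k
  have "D k \<in> S" for k by (induction k) (use assms(1) d(1) in \<open>auto simp: D_def\<close>)
  then show ?thesis unfolding smooth1_def using d(2) by (intro exI[of _ D]) (auto simp: D_def)
qed

lemma smooth1_poly_exp:
  assumes "c > 0" shows "smooth1 (poly_exp c p)"
  by (rule smooth1_closed_family[of _ "range (poly_exp c)"]) (use poly_exp_deriv[OF assms] in auto)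

lemma smooth1_affine:
  assumes "smooth1 f" shows "smooth1 (\<lambda>t. f (a * t + b))"
proof -
  obtain D where D: "D 0 = f" "\<And>k t. (D k has_real_derivative D (Suc k) t) (at t)"
    using assms unfolding smooth1_def by metis
  have "((\<lambda>t. a ^ k * D k (a * t + b)) has_real_derivative a ^ Suc k * D (Suc k) (a * t + b)) (at t)" for k t
    by (rule derivative_eq_intros DERIV_chain'[OF _ D(2)] refl | simp)+
  then show ?thesis unfolding smooth1_def using D(1) by (intro exI[of _ "\<lambda>k t. a ^ k * D k (a * t + b)"]) auto
qed

text \<open>Sums of products of derivatives of the two factors. The product rule maps this set into
  itself, which replaces an explicit Leibniz formula.\<close>

inductive_set product_span :: "(nat \<Rightarrow> real \<Rightarrow> real) \<Rightarrow> (nat \<Rightarrow> real \<Rightarrow> real) \<Rightarrow> (real \<Rightarrow> real) set"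
  for D E :: "nat \<Rightarrow> real \<Rightarrow> real" where
    base: "(\<lambda>t. D i t * E j t) \<in> product_span D E"
  | sum: "f \<in> product_span D E \<Longrightarrow> h \<in> product_span D E \<Longrightarrow> (\<lambda>t. f t + h t) \<in> product_span D E"

lemma smooth1_mult:
  assumes "smooth1 f" "smooth1 h" shows "smooth1 (\<lambda>t. f t * h t)"
proof -
  obtain D where D: "D 0 = f" "\<And>k t. (D k has_real_derivative D (Suc k) t) (at t)"
    using assms(1) unfolding smooth1_def by metis
  obtain E where E: "E 0 = h" "\<And>k t. (E k has_real_derivative E (Suc k) t) (at t)"
    using assms(2) unfolding smooth1_def by metis
  show ?thesis
  proof (rule smooth1_closed_family[of _ "product_span D E"])
    show "(\<lambda>t. f t * h t) \<in> product_span D E" using product_span.base[of D 0 E 0] D(1) E(1) by simp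
    fix q assume "q \<in> product_span D E"
    then show "\<exists>q'\<in>product_span D E. \<forall>t. (q has_real_derivative q' t) (at t)"
    proof induction
      case (base i j)
      have "(\<lambda>t. D (Suc i) t * E j t + D i t * E (Suc j) t) \<in> product_span D E"
        by (rule product_span.sum[OF product_span.base product_span.base])
      moreover have "((\<lambda>t. D i t * E j t) has_real_derivative D (Suc i) t * E j t + D i t * E (Suc j) t) (at t)" for t
        by (rule derivative_eq_intros D(2) E(2))+ simp
      ultimately show ?case by (intro bexI) auto
    next
      case (sum p q)
      then obtain p' q' where p: "p' \<in> product_span D E" "\<forall>t. (p has_real_derivative p' t) (at t)"
        and q: "q' \<in> product_span D E" "\<forall>t. (q has_real_derivative q' t) (at t)" by metis
      have "\<forall>t. ((\<lambda>t. p t + q t) has_real_derivative p' t + q' t) (at t)" using p(2) q(2) by (auto intro: DERIV_add)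
      then show ?case using product_span.sum[OF p(1) q(1)] by (rule bexI)
    qed
  qed
qed

text \<open>The parameter \<open>c\<close> is kept free because the function has two uses:
  \<open>c\<close> tending to 0 recovers the indicator of the interval, and \<open>c\<close>
  proportional to the length of the interval gives a trial state with controlled derivative.\<close>

definition bump :: "real \<Rightarrow> real \<Rightarrow> real \<Rightarrow> real \<Rightarrow> real" where
  "bump c a b t = poly_exp c 1 (t - a) * poly_exp c 1 (b - t)"

lemma smooth1_bump: "c > 0 \<Longrightarrow> smooth1 (bump c a b)"
  using smooth1_mult[OF smooth1_affine[OF smooth1_poly_exp, of c 1 1 "-a"] smooth1_affine[OF smooth1_poly_exp, of c 1 "-1" b]]
  by (simp add: bump_def[abs_def])

lemma bump_zero: "t \<notin> {a<..<b} \<Longrightarrow> bump c a b t = 0"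
  by (auto simp: bump_def poly_exp_def)

lemma bump_range: "c > 0 \<Longrightarrow> 0 \<le> bump c a b t \<and> bump c a b t \<le> 1"
  by (auto simp: bump_def poly_exp_def intro!: mult_le_one)

text \<open>Shrinking the interval by \<open>\<delta> k\<close> keeps the supports away from the
  ends of the segment even when \<open>a\<close> or \<open>b\<close> is one of them, so that
  products of these bumps are test functions.\<close>

lemma bump_tendsto_indicator:
  assumes c: "c \<longlonglongrightarrow> 0" "\<And>k. c k > 0" and \<delta>: "\<delta> \<longlonglongrightarrow> 0" "\<And>k. \<delta> k > 0"
  shows "(\<lambda>k. bump (c k) (a + \<delta> k) (b - \<delta> k) t) \<longlonglongrightarrow> indicator {a<..<b} t"
proof (cases "t \<in> {a<..<b}")
  case False
  then have "bump (c k) (a + \<delta> k) (b - \<delta> k) t = 0" for k using \<delta>(2)[of k] by (intro bump_zero) auto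
  then show ?thesis using False by simp
next
  case True
  have "(\<lambda>k. exp (- c k / (t - (a + \<delta> k))) * exp (- c k / (b - \<delta> k - t))) \<longlonglongrightarrow>
      exp (- 0 / (t - (a + 0))) * exp (- 0 / (b - 0 - t))"
    using True by (intro tendsto_intros c \<delta>) auto
  moreover have "\<forall>\<^sub>F k in sequentially. bump (c k) (a + \<delta> k) (b - \<delta> k) t =
      exp (- c k / (t - (a + \<delta> k))) * exp (- c k / (b - \<delta> k - t))"
  proof -
    have "min (t - a) (b - t) > 0" using True by auto
    then have "\<forall>\<^sub>F k in sequentially. \<delta> k < min (t - a) (b - t)" using \<delta>(1) by (rule order_tendstoD(2)[rotated])
    then show ?thesis by eventually_elim (auto simp: bump_def poly_exp_def)
  qed
  ultimately show ?thesis using True by (simp add: tendsto_cong)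
qed

lemma smooth_product:
  assumes "\<And>i. i < n \<Longrightarrow> smooth1 (\<beta> i)"
  shows "smooth n (\<lambda>z. complex_of_real (\<Prod>i<n. \<beta> i (z i)))"
proof -
  obtain E where E: "\<And>i. i < n \<Longrightarrow> E i 0 = \<beta> i"
    "\<And>i k t. i < n \<Longrightarrow> (E i k has_real_derivative E i (Suc k) t) (at t)"
    using assms unfolding smooth1_def by metis
  \<comment> \<open>A mixed partial derivative of a product depends only on how often each direction
    occurs in the list, hence \<open>count_list\<close>.\<close>
  define D where "D is z = complex_of_real (\<Prod>i<n. E i (count_list is i) (z i))" for "is" and z :: "nat \<Rightarrow> real"
  have cont: "continuous_on UNIV (E i k)" if "i < n" for i k
    using DERIV_continuous[OF E(2)[OF that]] by (auto simp: continuous_at_imp_continuous_on)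
  have "continuous_on (extensional {..<n}) (D is)" for "is"
    unfolding D_def
    by (intro continuous_on_of_real continuous_on_prod
        continuous_on_compose2[OF cont continuous_on_subset[OF continuous_on_product_coordinates subset_UNIV]]) auto
  moreover have "((\<lambda>t. D is (z(i := t))) has_vector_derivative D (i # is) z) (at (z i))" if i: "i < n" for "is" i z
  proof -
    have split: "(\<Prod>j<n. f j) = f i * (\<Prod>j\<in>{..<n} - {i}. f j)" for f :: "nat \<Rightarrow> real"
      using i by (intro prod.remove) auto
    let ?r = "\<Prod>j\<in>{..<n} - {i}. E j (count_list is j) (z j)"
    have "(\<Prod>j\<in>{..<n} - {i}. E j (count_list is j) ((z(i := t)) j)) = ?r" for t by (rule prod.cong) auto
    then have 1: "D is (z(i := t)) = of_real (E i (count_list is i) t * ?r)" for t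
      unfolding D_def split by simp
    have "(\<Prod>j\<in>{..<n} - {i}. E j (count_list (i # is) j) (z j)) = ?r" by (rule prod.cong) auto
    then have 2: "D (i # is) z = of_real (E i (Suc (count_list is i)) (z i) * ?r)"
      unfolding D_def split by simp
    show ?thesis unfolding 1 2
      by (intro has_vector_derivative_of_real has_real_derivative_iff_has_vector_derivative[THEN iffD1]
          DERIV_cmult_right E(2) i)
  qed
  ultimately show ?thesis unfolding smooth_def using E(1)
    by (intro exI[of _ D]) (auto simp: D_def fun_eq_iff intro!: prod.cong)
qed

text \<open>Compactness refers to the topology of \<open>nat \<Rightarrow> real\<close>. There the
  extensional cube is a product over all natural numbers with factor \<open>{undefined}\<close> from
  \<open>n\<close> on, and Tychonoff's theorem applies.\<close>

lemma compact_PiE_interval: "compact ({..<n::nat} \<rightarrow>\<^sub>E {a..b::real})"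
proof -
  have "({..<n} \<rightarrow>\<^sub>E {a..b}) = PiE UNIV (\<lambda>i. if i < n then {a..b} else {undefined})"
    by (auto simp: PiE_def Pi_def extensional_def split: if_splits)
  moreover have "compactin (product_topology (\<lambda>i. euclidean) UNIV) (PiE UNIV (\<lambda>i. if i < n then {a..b::real} else {undefined}))"
    unfolding compactin_PiE by auto
  ultimately show ?thesis by (simp add: euclidean_product_topology)
qed

lemma test_function_product:
  assumes "\<And>i. i < n \<Longrightarrow> smooth1 (\<beta> i)" and ab: "0 < a" "b < l"
    and zero: "\<And>i t. i < n \<Longrightarrow> t \<notin> {a..b} \<Longrightarrow> \<beta> i t = 0"
  shows "test_function n l (\<lambda>z. complex_of_real (\<Prod>i<n. \<beta> i (z i)))"
  unfolding test_function_def
proof (intro conjI smooth_product assms(1) exI[of _ "{..<n} \<rightarrow>\<^sub>E {a..b}"] compact_PiE_interval ballI)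
  show "({..<n} \<rightarrow>\<^sub>E {a..b}) \<subseteq> ({..<n} \<rightarrow>\<^sub>E {0<..<l})" using ab by (intro PiE_mono) auto
  fix z assume "z \<in> extensional {..<n} - ({..<n} \<rightarrow>\<^sub>E {a..b})"
  then obtain i where "i < n" "z i \<notin> {a..b}" by (auto simp: PiE_def Pi_def)
  then have "(\<Prod>i<n. \<beta> i (z i)) = 0" using zero by (intro prod_zero) auto
  then show "complex_of_real (\<Prod>i<n. \<beta> i (z i)) = 0" by simp
qed

lemma partial_deriv_product:
  assumes "i < n" "(\<beta> i has_real_derivative \<beta>') (at (z i))"
  shows "partial_deriv i (\<lambda>z. complex_of_real (\<Prod>i<n. \<beta> i (z i))) z =
    complex_of_real (\<beta>' * (\<Prod>j\<in>{..<n} - {i}. \<beta> j (z j)))"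
  unfolding partial_deriv_def
proof (rule vector_derivative_at)
  have "(\<Prod>j<n. \<beta> j ((z(i := t)) j)) = \<beta> i t * (\<Prod>j\<in>{..<n} - {i}. \<beta> j (z j))" for t
  proof -
    have "(\<Prod>j\<in>{..<n} - {i}. \<beta> j ((z(i := t)) j)) = (\<Prod>j\<in>{..<n} - {i}. \<beta> j (z j))" by (rule prod.cong) auto
    then show ?thesis using assms(1) by (subst prod.remove[of _ i]) auto
  qed
  then show "((\<lambda>t. complex_of_real (\<Prod>j<n. \<beta> j ((z(i := t)) j))) has_vector_derivative
      complex_of_real (\<beta>' * (\<Prod>j\<in>{..<n} - {i}. \<beta> j (z j)))) (at (z i))"
    by (simp only:) (intro has_vector_derivative_of_real has_real_derivative_iff_has_vector_derivative[THEN iffD1]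
          DERIV_cmult_right assms(2))
qed

section \<open>Boxes as a generating system of the measurable sets of the cube\<close>

definition intervals :: "real \<Rightarrow> real set set" where
  "intervals l = {{a<..<b} |a b. 0 \<le> a \<and> b \<le> l}"

lemma sets_segment_measure_intervals:
  assumes "l > 0" shows "sets (segment_measure l) = sigma_sets {0<..<l} (intervals l)"
proof -
  have "sets (segment_measure l) = (\<inter>) {0<..<l} ` sets borel" by (simp add: sets_restrict_space)
  also have "sets borel = sigma_sets UNIV (range (\<lambda>(a, b). {a<..<b::real}))"
    by (subst borel_eq_box) (simp add: case_prod_beta' box_real)
  also have "(\<inter>) {0<..<l} ` sigma_sets UNIV (range (\<lambda>(a, b). {a<..<b::real}))
      = sigma_sets {0<..<l} ((\<inter>) {0<..<l} ` range (\<lambda>(a, b). {a<..<b::real}))"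
    by (rule sigma_sets_Int) (auto intro: sigma_sets.Basic)
  also have "(\<inter>) {0<..<l} ` range (\<lambda>(a, b). {a<..<b::real}) = intervals l"
  proof (intro equalityI subsetI)
    fix A assume "A \<in> (\<inter>) {0<..<l} ` range (\<lambda>(a, b). {a<..<b::real})"
    then obtain a b where "A = {0<..<l} \<inter> {a<..<b}" by auto
    then have "A = {max 0 a<..<min l b}" by auto
    then show "A \<in> intervals l" unfolding intervals_def by (intro CollectI exI[of _ "max 0 a"] exI[of _ "min l b"]) auto
  next
    fix A assume "A \<in> intervals l"
    then obtain a b where ab: "A = {a<..<b}" "0 \<le> a" "b \<le> l" by (auto simp: intervals_def)
    then have "A = {0<..<l} \<inter> (\<lambda>(a, b). {a<..<b}) (a, b)" by auto
    then show "A \<in> (\<inter>) {0<..<l} ` range (\<lambda>(a, b). {a<..<b::real})" by blast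
  qed
  finally show ?thesis .
qed

definition boxes :: "nat set \<Rightarrow> real \<Rightarrow> (nat \<Rightarrow> real) set set" where
  "boxes I l = {PiE I F |F. \<forall>i\<in>I. F i \<in> intervals l}"

lemma intervals_subset: "A \<in> intervals l \<Longrightarrow> A \<subseteq> {0<..<l}"
  by (auto simp: intervals_def)

lemma whole_in_intervals: "{0<..<l} \<in> intervals l"
  unfolding intervals_def by (intro CollectI exI[of _ 0] exI[of _ l]) simp

lemma sets_cube_boxes:
  assumes "l > 0"
  shows "finite I \<Longrightarrow> sets (cube_measure I l) = sigma_sets (space (cube_measure I l)) (boxes I l)"
proof -
  assume fin: "finite I"
  let ?\<Omega> = "\<lambda>_::nat. {0<..<l}" and ?E = "\<lambda>_::nat. intervals l"
  have E_Pow: "intervals l \<subseteq> Pow {0<..<l}" using intervals_subset by auto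
  have "sets (cube_measure I l) = sets (Pi\<^sub>M I (\<lambda>i. sigma (?\<Omega> i) (?E i)))"
    unfolding cube_measure_def
    by (intro sets_PiM_cong refl) (simp add: sets_segment_measure_intervals[OF assms] sets_measure_of[OF E_Pow])
  also have "\<dots> = sets (sigma (\<Pi>\<^sub>E i\<in>I. ?\<Omega> i) {{f\<in>(\<Pi>\<^sub>E i\<in>I. ?\<Omega> i). \<forall>i\<in>j. f i \<in> A i} | A j. j \<in> {I} \<and> A \<in> Pi j ?E})"
  proof (rule sets_PiM_sigma)
    show "\<exists>S\<subseteq>intervals l. countable S \<and> {0<..<l} = \<Union>S" if "i \<in> I" for i
      using whole_in_intervals by (intro exI[of _ "{{0<..<l}}"]) auto
  qed (use E_Pow fin in auto)
  also have "{{f\<in>(\<Pi>\<^sub>E i\<in>I. ?\<Omega> i). \<forall>i\<in>j. f i \<in> A i} | A j. j \<in> {I} \<and> A \<in> Pi j ?E} = boxes I l"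
  proof -
    have "{f\<in>(\<Pi>\<^sub>E i\<in>I. ?\<Omega> i). \<forall>i\<in>I. f i \<in> A i} = PiE I A" if "A \<in> Pi I ?E" for A
    proof -
      have "A i \<subseteq> {0<..<l}" if "i \<in> I" for i using \<open>A \<in> Pi I ?E\<close> that by (intro intervals_subset) auto
      then have "PiE I A \<subseteq> PiE I ?\<Omega>" by (rule PiE_mono)
      then have "f \<in> (\<Pi>\<^sub>E i\<in>I. ?\<Omega> i)" if "f \<in> PiE I A" for f using that by (rule subsetD)
      then show ?thesis by (intro equalityI subsetI) (simp_all add: PiE_iff)
    qed
    note eq = this
    show ?thesis
    proof (intro equalityI subsetI)
      fix B assume "B \<in> {{f\<in>(\<Pi>\<^sub>E i\<in>I. ?\<Omega> i). \<forall>i\<in>j. f i \<in> A i} | A j. j \<in> {I} \<and> A \<in> Pi j ?E}"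
      then obtain A where A: "A \<in> Pi I ?E" "B = {f\<in>(\<Pi>\<^sub>E i\<in>I. ?\<Omega> i). \<forall>i\<in>I. f i \<in> A i}" by auto
      have "B = PiE I A" unfolding A(2) by (rule eq[OF A(1)])
      then show "B \<in> boxes I l" unfolding boxes_def using A(1) by (intro CollectI exI[of _ A] conjI ballI) auto
    next
      fix B assume "B \<in> boxes I l"
      then obtain A where A: "B = PiE I A" "\<forall>i\<in>I. A i \<in> intervals l" unfolding boxes_def by auto
      then have A': "A \<in> Pi I ?E" by auto
      have "B = {f\<in>(\<Pi>\<^sub>E i\<in>I. ?\<Omega> i). \<forall>i\<in>I. f i \<in> A i}" unfolding A(1) by (rule eq[OF A', symmetric])
      then show "B \<in> {{f\<in>(\<Pi>\<^sub>E i\<in>I. ?\<Omega> i). \<forall>i\<in>j. f i \<in> A i} | A j. j \<in> {I} \<and> A \<in> Pi j ?E}"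
        using A' by (intro CollectI exI[of _ A] exI[of _ I] conjI) auto
    qed
  qed
  also have "sets (sigma (\<Pi>\<^sub>E i\<in>I. ?\<Omega> i) (boxes I l)) = sigma_sets (space (cube_measure I l)) (boxes I l)"
    unfolding space_cube
  proof (rule sets_measure_of, intro subsetI PowI)
    fix B z assume "B \<in> boxes I l" "z \<in> B"
    then obtain F where F: "z \<in> PiE I F" "\<forall>i\<in>I. F i \<in> intervals l" by (auto simp: boxes_def)
    have "PiE I F \<subseteq> I \<rightarrow>\<^sub>E {0<..<l}" by (rule PiE_mono) (use F(2) intervals_subset in blast)
    then show "z \<in> I \<rightarrow>\<^sub>E {0<..<l}" using F(1) by blast
  qed
  finally show ?thesis .
qed

lemma intervals_Int:
  assumes "A \<in> intervals l" "B \<in> intervals l" shows "A \<inter> B \<in> intervals l"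
proof -
  obtain a b where A: "A = {a<..<b}" "0 \<le> a" "b \<le> l" using assms(1) by (auto simp: intervals_def)
  obtain c d where B: "B = {c<..<d}" "0 \<le> c" "d \<le> l" using assms(2) by (auto simp: intervals_def)
  have "A \<inter> B = {max a c<..<min b d}" unfolding A B by auto
  moreover have "0 \<le> max a c" "min b d \<le> l" using A(2,3) by (auto simp: le_max_iff_disj min_le_iff_disj)
  ultimately show ?thesis unfolding intervals_def by (intro CollectI exI[of _ "max a c"] exI[of _ "min b d"] conjI)
qed

lemma Int_stable_boxes: "Int_stable (boxes I l)"
proof (rule Int_stableI)
  fix A B assume AB: "A \<in> boxes I l" "B \<in> boxes I l"
  obtain F where F: "A = PiE I F" "\<forall>i\<in>I. F i \<in> intervals l" using AB(1) by (auto simp: boxes_def)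
  obtain G where G: "B = PiE I G" "\<forall>i\<in>I. G i \<in> intervals l" using AB(2) by (auto simp: boxes_def)
  show "A \<inter> B \<in> boxes I l" unfolding boxes_def F G PiE_Int
    using F(2) G(2) by (intro CollectI exI[of _ "\<lambda>i. F i \<inter> G i"] conjI refl ballI intervals_Int) auto
qed

text \<open>The measurable sets over which \<open>u\<close> integrates to 0 form a Dynkin system
  containing a generating family stable under intersection. All measurable sets belong to it, so
  \<open>u\<close> has the same integrals as the density 0.\<close>

lemma AE_zero_if_box_integrals_zero:
  fixes u :: "(nat \<Rightarrow> real) \<Rightarrow> real"
  assumes I: "finite I" "l > 0" and u: "integrable (cube_measure I l) u"
    and zero: "\<And>B. B \<in> boxes I l \<Longrightarrow> (LINT z:B|cube_measure I l. u z) = 0"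
  shows "AE z in cube_measure I l. u z = 0"
proof -
  let ?M = "cube_measure I l"
  have sub: "boxes I l \<subseteq> Pow (space ?M)"
    using sets.sets_into_space[of _ ?M] sets_cube_boxes[OF I(2,1)] by (blast intro: sigma_sets.Basic)
  have sp: "space ?M \<in> boxes I l"
    unfolding boxes_def space_cube using whole_in_intervals by (intro CollectI exI[of _ "\<lambda>_. {0<..<l}"]) auto
  have si: "set_integrable ?M A u" if "A \<in> sets ?M" for A
    unfolding set_integrable_def by (rule integrable_mult_indicator[OF that u])
  have "(LINT z:A|?M. u z) = 0" if "A \<in> sigma_sets (space ?M) (boxes I l)" for A
    using Int_stable_boxes sub that
  proof (induction rule: sigma_sets_induct_disjoint)
    case (basic A) then show ?case by (rule zero)
  next
    case empty show ?case by (simp add: set_lebesgue_integral_def)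
  next
    case (compl A)
    have A: "A \<in> sets ?M" using compl(1) sets_cube_boxes[OF I(2,1)] by simp
    have "(LINT z:A \<union> (space ?M - A)|?M. u z) = (LINT z:A|?M. u z) + (LINT z:space ?M - A|?M. u z)"
      using A by (intro set_integral_Un si) auto
    moreover have "A \<union> (space ?M - A) = space ?M" using sets.sets_into_space[OF A] by blast
    ultimately show ?case using compl(2) zero[OF sp] by simp
  next
    case (union A)
    have A: "A i \<in> sets ?M" for i using union(2) sets_cube_boxes[OF I(2,1)] by auto
    have "(LINT z:(\<Union>i. A i)|?M. u z) = (\<Sum>i. LINT z:A i|?M. u z)"
    proof (rule lebesgue_integral_countable_add[OF A])
      show "A i \<inter> A j = {}" if "i \<noteq> j" for i j using union(1) that by (auto simp: disjoint_family_on_def)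
      show "set_integrable ?M (\<Union>i. A i) u" using A by (intro si) auto
    qed
    then show ?case using union(3) by simp
  qed
  then show ?thesis
    using sets_cube_boxes[OF I(2,1)] by (intro density_unique_real[OF u, of "\<lambda>_. 0"]) auto
qed

text \<open>Products of the bumps \<open>exp (- c / (t - a) - c / (b - t))\<close> converge to indicators of boxes as \<open>c \<rightarrow> 0\<close>.\<close>
lemma fundamental_lemma:
  assumes "l > 0" and u: "u \<in> L2 (cube_measure {..<n} l)"
    and zero: "\<And>\<phi>. test_function n l \<phi> \<Longrightarrow> (LINT z|cube_measure {..<n} l. u z * \<phi> z) = 0"
  shows "AE z in cube_measure {..<n} l. u z = 0"
proof -
  let ?M = "cube_measure {..<n} l"
  note [measurable] = L2_borel[OF u]
  have "(\<lambda>_. 1) \<in> L2 ?M" by (rule L2_bounded[OF finite_measure_cube, where C = 1]) auto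
  from L2_mult_integrable[OF u this] have ui: "integrable ?M u" by simp
  have box: "(LINT z|?M. indicator B z *\<^sub>R u z) = 0" if B: "B \<in> boxes {..<n} l" for B
  proof -
    obtain F where F: "B = PiE {..<n} F" "\<forall>i\<in>{..<n}. F i \<in> intervals l" using B unfolding boxes_def by auto
    have "\<forall>i\<in>{..<n}. \<exists>a b. F i = {a<..<b} \<and> 0 \<le> a \<and> b \<le> l" using F(2) unfolding intervals_def by blast
    then obtain a b where ab: "\<And>i. i < n \<Longrightarrow> F i = {a i<..<b i}" "\<And>i. i < n \<Longrightarrow> 0 \<le> a i" "\<And>i. i < n \<Longrightarrow> b i \<le> l"
      by (metis lessThan_iff)
    define \<epsilon> :: "nat \<Rightarrow> real" where "\<epsilon> k = 1 / Suc k" for k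
    have \<epsilon>: "\<epsilon> \<longlonglongrightarrow> 0" "\<epsilon> k > 0" for k
      unfolding \<epsilon>_def using LIMSEQ_inverse_real_of_nat by (auto simp: inverse_eq_divide)
    define \<phi> where "\<phi> k z = complex_of_real (\<Prod>i<n. bump (\<epsilon> k) (a i + \<epsilon> k) (b i - \<epsilon> k) (z i))" for k and z :: "nat \<Rightarrow> real"
    have test: "test_function n l (\<phi> k)" for k
      unfolding \<phi>_def
    proof (rule test_function_product[where a = "\<epsilon> k" and b = "l - \<epsilon> k"])
      fix i t assume "i < n" "t \<notin> {\<epsilon> k..l - \<epsilon> k}"
      then show "bump (\<epsilon> k) (a i + \<epsilon> k) (b i - \<epsilon> k) t = 0" using ab(2,3)[of i] by (intro bump_zero) auto
    qed (use \<epsilon>(2)[of k] smooth1_bump in auto)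
    note [measurable] = test_function_measurable(1)[OF test]
    have "(\<lambda>k. LINT z|?M. u z * \<phi> k z) \<longlonglongrightarrow> (LINT z|?M. indicator B z *\<^sub>R u z)"
    proof (rule integral_dominated_convergence[where w = "\<lambda>z. cmod (u z)"])
      have Bm: "B \<in> sets ?M" using B sets_cube_boxes[OF assms(1), of "{..<n}"] by (auto intro: sigma_sets.Basic)
      then show "(\<lambda>z. indicator B z *\<^sub>R u z) \<in> borel_measurable ?M" by measurable
      show "AE z in ?M. (\<lambda>k. u z * \<phi> k z) \<longlonglongrightarrow> indicator B z *\<^sub>R u z"
      proof (rule AE_I2)
        fix z assume z: "z \<in> space ?M"
        have "(\<lambda>k. \<phi> k z) \<longlonglongrightarrow> of_real (\<Prod>i<n. indicator {a i<..<b i} (z i))"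
          unfolding \<phi>_def by (intro tendsto_of_real tendsto_prod bump_tendsto_indicator \<epsilon>)
        also have "(\<Prod>i<n. indicator {a i<..<b i} (z i)) = (indicator B z :: real)"
        proof (cases "z \<in> B")
          case True then show ?thesis using ab(1) by (auto simp: F(1) PiE_def Pi_def intro!: prod.neutral)
        next
          case False
          then obtain i where "i < n" "z i \<notin> {a i<..<b i}"
            using ab(1) cube_extensional[OF z] by (auto simp: F(1) PiE_def Pi_def)
          then have "(\<Prod>i<n. indicator {a i<..<b i} (z i)) = (0::real)" by (intro prod_zero bexI[of _ i]) auto
          then show ?thesis using False by simp
        qed
        finally have "(\<lambda>k. u z * \<phi> k z) \<longlonglongrightarrow> u z * of_real (indicator B z)" by (intro tendsto_mult tendsto_const)
        then show "(\<lambda>k. u z * \<phi> k z) \<longlonglongrightarrow> indicator B z *\<^sub>R u z" by (simp add: scaleR_conv_of_real mult.commute)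
      qed
      show "AE z in ?M. norm (u z * \<phi> k z) \<le> cmod (u z)" for k
      proof (rule AE_I2)
        fix z
        have "\<bar>\<Prod>i<n. bump (\<epsilon> k) (a i + \<epsilon> k) (b i - \<epsilon> k) (z i)\<bar> \<le> 1"
          using bump_range[OF \<epsilon>(2)] by (simp add: abs_prod prod_le_1)
        then show "norm (u z * \<phi> k z) \<le> cmod (u z)"
          by (simp add: \<phi>_def norm_mult mult_left_le del: of_real_prod)
      qed
      show "(\<lambda>z. u z * \<phi> k z) \<in> borel_measurable ?M" for k by measurable
      show "integrable ?M (\<lambda>z. cmod (u z))" using ui by simp
    qed
    then show ?thesis using zero[OF test] by (simp add: LIMSEQ_const_iff)
  qed
  \<comment> \<open>Real and imaginary part are treated separately because densities are compared
    for real functions.\<close>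
  have "AE z in ?M. Re (u z) = 0"
  proof (rule AE_zero_if_box_integrals_zero)
    fix B assume B: "B \<in> boxes {..<n} l"
    then have Bm: "B \<in> sets ?M" using sets_cube_boxes[OF assms(1), of "{..<n}"] by (auto intro: sigma_sets.Basic)
    have "(LINT z:B|?M. Re (u z)) = Re (LINT z|?M. indicator B z *\<^sub>R u z)"
      unfolding set_lebesgue_integral_def
      by (subst integral_Re[symmetric]) (auto intro: integrable_mult_indicator[OF Bm ui])
    then show "(LINT z:B|?M. Re (u z)) = 0" using box[OF B] by simp
  qed (use ui assms in auto)
  moreover have "AE z in ?M. Im (u z) = 0"
  proof (rule AE_zero_if_box_integrals_zero)
    fix B assume B: "B \<in> boxes {..<n} l"
    then have Bm: "B \<in> sets ?M" using sets_cube_boxes[OF assms(1), of "{..<n}"] by (auto intro: sigma_sets.Basic)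
    have "(LINT z:B|?M. Im (u z)) = Im (LINT z|?M. indicator B z *\<^sub>R u z)"
      unfolding set_lebesgue_integral_def
      by (subst integral_Im[symmetric]) (auto intro: integrable_mult_indicator[OF Bm ui])
    then show "(LINT z:B|?M. Im (u z)) = 0" using box[OF B] by simp
  qed (use ui assms in auto)
  ultimately show ?thesis by eventually_elim (simp add: complex_eq_iff)
qed

section \<open>Linear combinations of test functions and integration by parts\<close>

lemma smooth_lincomb:
  assumes "smooth n \<phi>" "smooth n \<psi>" shows "smooth n (\<lambda>z. \<phi> z + c * \<psi> z)"
proof -
  obtain D where D: "D [] = \<phi>"
    "\<And>is. is \<in> lists {..<n} \<Longrightarrow> continuous_on (extensional {..<n}) (D is)"
    "\<And>is j z. is \<in> lists {..<n} \<Longrightarrow> j < n \<Longrightarrow> z \<in> extensional {..<n} \<Longrightarrow>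
       ((\<lambda>t. D is (z(j := t))) has_vector_derivative D (j # is) z) (at (z j))"
    using assms(1) unfolding smooth_def by metis
  obtain E where E: "E [] = \<psi>"
    "\<And>is. is \<in> lists {..<n} \<Longrightarrow> continuous_on (extensional {..<n}) (E is)"
    "\<And>is j z. is \<in> lists {..<n} \<Longrightarrow> j < n \<Longrightarrow> z \<in> extensional {..<n} \<Longrightarrow>
       ((\<lambda>t. E is (z(j := t))) has_vector_derivative E (j # is) z) (at (z j))"
    using assms(2) unfolding smooth_def by metis
  show ?thesis unfolding smooth_def
  proof (intro exI[of _ "\<lambda>is z. D is z + c * E is z"] conjI ballI allI impI)
    show "(\<lambda>z. D [] z + c * E [] z) = (\<lambda>z. \<phi> z + c * \<psi> z)" by (simp only: D(1) E(1))
    fix "is" assume is_lists: "is \<in> lists {..<n}"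
    show "continuous_on (extensional {..<n}) (\<lambda>z. D is z + c * E is z)"
      by (intro continuous_on_add continuous_on_mult continuous_on_const D(2) E(2) is_lists)
    fix i and z :: "nat \<Rightarrow> real" assume "i < n" "z \<in> extensional {..<n}"
    then show "((\<lambda>t. D is (z(i := t)) + c * E is (z(i := t))) has_vector_derivative D (i # is) z + c * E (i # is) z) (at (z i))"
      by (intro has_vector_derivative_add has_vector_derivative_mult_right D(3) E(3) is_lists)
  qed
qed

lemma test_function_lincomb:
  assumes "test_function n l \<phi>" "test_function n l \<psi>" shows "test_function n l (\<lambda>z. \<phi> z + c * \<psi> z)"
proof -
  obtain K where K: "compact K" "K \<subseteq> {..<n} \<rightarrow>\<^sub>E {0<..<l}" "\<forall>z\<in>extensional {..<n} - K. \<phi> z = 0" "smooth n \<phi>"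
    using assms(1) unfolding test_function_def by metis
  obtain L where L: "compact L" "L \<subseteq> {..<n} \<rightarrow>\<^sub>E {0<..<l}" "\<forall>z\<in>extensional {..<n} - L. \<psi> z = 0" "smooth n \<psi>"
    using assms(2) unfolding test_function_def by metis
  show ?thesis unfolding test_function_def
    using K L by (intro conjI smooth_lincomb exI[of _ "K \<union> L"] compact_Un) auto
qed

lemma partial_deriv_lincomb:
  assumes "test_function n l \<phi>" "test_function n l \<psi>" "i < n" "z \<in> extensional {..<n}"
  shows "partial_deriv i (\<lambda>z. \<phi> z + c * \<psi> z) z = partial_deriv i \<phi> z + c * partial_deriv i \<psi> z"
proof -
  have "smooth n \<phi>" "smooth n \<psi>" using assms unfolding test_function_def by metis+
  from smooth_partial(2)[OF this(1) assms(3,4), of "z i"] smooth_partial(2)[OF this(2) assms(3,4), of "z i"]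
  show ?thesis
    unfolding partial_deriv_def[of i "\<lambda>z. \<phi> z + c * \<psi> z"]
    by (intro vector_derivative_at has_vector_derivative_add has_vector_derivative_mult_right) simp_all
qed

lemma integral_product_derivative_zero:
  fixes p q p' q' :: "real \<Rightarrow> complex"
  assumes p: "\<And>t. (p has_vector_derivative p' t) (at t)" and q: "\<And>t. (q has_vector_derivative q' t) (at t)"
    and p': "continuous_on UNIV p'" and q': "continuous_on UNIV q'"
    and p0: "\<And>t. t \<notin> {0<..<l} \<Longrightarrow> p t = 0" and q0: "\<And>t. t \<notin> {0<..<l} \<Longrightarrow> q t = 0" and "l > 0"
  shows "(LINT t|segment_measure l. q t * p' t + q' t * p t) = 0"
proof -
  have c: "continuous_on UNIV p" "continuous_on UNIV q"
    using has_vector_derivative_continuous[OF p] has_vector_derivative_continuous[OF q]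
    by (simp_all add: continuous_at_imp_continuous_on)
  have cF: "continuous_on {0..l} (\<lambda>t. q t * p' t + q' t * p t)"
    by (rule continuous_on_subset[OF _ subset_UNIV]) (intro continuous_intros c p' q')
  have D: "((\<lambda>t. q t * p t) has_vector_derivative q t * p' t + q' t * p t) (at t within {0..l})" for t
    using has_vector_derivative_mult[OF q p, of t] by (rule has_vector_derivative_at_within)
  have "has_bochner_integral lborel (\<lambda>t. indicator {0..l} t *\<^sub>R (q t * p' t + q' t * p t)) (q l * p l - q 0 * p 0)"
    by (rule has_bochner_integral_FTC_Icc[OF less_imp_le[OF \<open>l > 0\<close>] D cF])
  then have "(LINT t|lborel. indicator {0..l} t *\<^sub>R (q t * p' t + q' t * p t)) = 0"
    using p0[of 0] p0[of l] by (simp add: has_bochner_integral_iff)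
  moreover have "(LINT t|segment_measure l. q t * p' t + q' t * p t)
      = (LINT t|lborel. indicator {0<..<l} t *\<^sub>R (q t * p' t + q' t * p t))"
    by (subst integral_restrict_space) auto
  moreover have "indicator {0<..<l} t *\<^sub>R (q t * p' t + q' t * p t) = indicator {0..l} t *\<^sub>R (q t * p' t + q' t * p t)" for t
    using p0[of t] q0[of t] by (cases "t \<in> {0<..<l}") auto
  ultimately show ?thesis by simp
qed

text \<open>On every line in direction \<open>i\<close> the sum of the two integrands is the
  derivative of \<open>\<psi> * \<phi>\<close>, which vanishes at both ends of the segment.\<close>

lemma integration_by_parts:
  assumes "test_function n l \<phi>" "test_function n l \<psi>" "i < n" "l > 0"
  shows "(LINT z|cube_measure {..<n} l. \<psi> z * partial_deriv i \<phi> z) =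
    - (LINT z|cube_measure {..<n} l. partial_deriv i \<psi> z * \<phi> z)"
proof -
  let ?M = "cube_measure {..<n} l"
  obtain A where A: "A \<ge> 0" "\<And>z. z \<in> extensional {..<n} \<Longrightarrow> cmod (\<phi> z) \<le> A"
    "\<And>i z. i < n \<Longrightarrow> z \<in> extensional {..<n} \<Longrightarrow> cmod (partial_deriv i \<phi> z) \<le> A"
    using test_function_bounded[OF assms(1)] by metis
  obtain B where B: "B \<ge> 0" "\<And>z. z \<in> extensional {..<n} \<Longrightarrow> cmod (\<psi> z) \<le> B"
    "\<And>i z. i < n \<Longrightarrow> z \<in> extensional {..<n} \<Longrightarrow> cmod (partial_deriv i \<psi> z) \<le> B"
    using test_function_bounded[OF assms(2)] by metis
  define F where "F z = \<psi> z * partial_deriv i \<phi> z + partial_deriv i \<psi> z * \<phi> z" for z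
  note [measurable] = test_function_measurable(1)[OF assms(1)] test_function_measurable(2)[OF assms(1,3)]
     test_function_measurable(1)[OF assms(2)] test_function_measurable(2)[OF assms(2,3)]
  have Fm: "F \<in> borel_measurable ?M" unfolding F_def by measurable
  have Fb: "cmod (F z) \<le> B * A + B * A" if "z \<in> space ?M" for z
  proof -
    have z: "z \<in> extensional {..<n}" using that by (rule cube_extensional)
    show ?thesis unfolding F_def
      by (rule norm_triangle_le, unfold norm_mult, rule add_mono)
        (rule mult_mono; simp add: A B z assms(3))+
  qed
  have "(LINT z|?M. F z) = (LINT z|cube_measure ({..<n} - {i}) l. LINT t|segment_measure l. F (z(i := t)))"
    by (rule fubini[OF Fm Fb assms(3)])
  also have "\<dots> = (LINT z|cube_measure ({..<n} - {i}) l. 0)"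
  proof (rule Bochner_Integration.integral_cong[OF refl])
    fix z assume z: "z \<in> space (cube_measure ({..<n} - {i}) l)"
    note d1 = slice_derivative[OF assms(1,3) z] and d2 = slice_derivative[OF assms(2,3) z]
    show "(LINT t|segment_measure l. F (z(i := t))) = 0"
      unfolding F_def
      by (rule integral_product_derivative_zero[OF d1(1) d2(1) d1(2) d2(2) d1(3) d2(3) assms(4)])
  qed
  finally have "(LINT z|?M. F z) = 0" by simp
  moreover have "(LINT z|?M. F z) = (LINT z|?M. \<psi> z * partial_deriv i \<phi> z) + (LINT z|?M. partial_deriv i \<psi> z * \<phi> z)"
    unfolding F_def
    by (intro Bochner_Integration.integral_add L2_mult_integrable test_function_L2 assms)
  ultimately show ?thesis by (simp add: eq_neg_iff_add_eq_0)
qed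


section \<open>Sobolev functions, their weak derivatives and traces\<close>

abbreviation cube :: "nat \<Rightarrow> real \<Rightarrow> (nat \<Rightarrow> real) measure" where
  "cube n l \<equiv> cube_measure {..<n} l"

abbreviation face :: "nat \<Rightarrow> real \<Rightarrow> nat \<Rightarrow> (nat \<Rightarrow> real) measure" where
  "face n l k \<equiv> cube_measure ({..<n} - {k}) l"

definition diag_restr :: "nat \<Rightarrow> nat \<Rightarrow> ((nat \<Rightarrow> real) \<Rightarrow> complex) \<Rightarrow> (nat \<Rightarrow> real) \<Rightarrow> complex" where
  "diag_restr i k \<phi> z = \<phi> (z(k := z i))"

text \<open>Integration by parts holds for each \<open>\<Phi> m\<close>, and both sides are inner
  products with a fixed square-integrable function, hence pass to the limit. The conjugate in
  \<open>eq\<close> compensates the one in \<open>L2_inner\<close>.\<close>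

lemma is_weak_deriv_limit:
  assumes "l > 0" "i < n" and test: "\<And>m. test_function n l (\<Phi> m)"
    and lim: "L2_lim (cube n l) \<Phi> \<psi>" "L2_lim (cube n l) (\<lambda>m. partial_deriv i (\<Phi> m)) v"
  shows "is_weak_deriv n l i \<psi> v"
  unfolding is_weak_deriv_def
proof (intro conjI allI impI)
  show "v \<in> L2 (cube n l)" using lim(2) by (simp add: L2_lim_def)
  fix \<phi> assume \<phi>: "test_function n l \<phi>"
  have eq: "(LINT z|cube n l. f z * h z) = L2_inner (cube n l) (\<lambda>z. cnj (h z)) f" for f h
    by (simp add: L2_inner_def mult.commute)
  have "(\<lambda>m. LINT z|cube n l. \<Phi> m z * partial_deriv i \<phi> z) \<longlonglongrightarrow> (LINT z|cube n l. \<psi> z * partial_deriv i \<phi> z)"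
    unfolding eq by (rule L2.conv_B_right[OF lim(1) L2_cnj[OF test_function_L2(2)[OF \<phi> assms(2)]]])
  moreover have "(\<lambda>m. - (LINT z|cube n l. partial_deriv i (\<Phi> m) z * \<phi> z)) \<longlonglongrightarrow> - (LINT z|cube n l. v z * \<phi> z)"
    unfolding eq by (rule tendsto_minus[OF L2.conv_B_right[OF lim(2) L2_cnj[OF test_function_L2(1)[OF \<phi>]]]])
  moreover have "(LINT z|cube n l. \<Phi> m z * partial_deriv i \<phi> z) = - (LINT z|cube n l. partial_deriv i (\<Phi> m) z * \<phi> z)" for m
    by (rule integration_by_parts[OF \<phi> test assms(2,1)])
  ultimately show "(LINT z|cube n l. \<psi> z * partial_deriv i \<phi> z) = - (LINT z|cube n l. v z * \<phi> z)"
    by (simp add: LIMSEQ_unique)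
qed

lemma is_weak_deriv_unique:
  assumes "l > 0" "is_weak_deriv n l i \<psi> v" "is_weak_deriv n l i \<psi> w"
  shows "AE z in cube n l. v z = w z"
proof -
  have vw: "v \<in> L2 (cube n l)" "w \<in> L2 (cube n l)" using assms by (simp_all add: is_weak_deriv_def)
  have "AE z in cube n l. v z - w z = 0"
  proof (rule fundamental_lemma[OF assms(1) L2.diff[OF vw]])
    fix \<phi> assume \<phi>: "test_function n l \<phi>"
    have "(LINT z|cube n l. (v z - w z) * \<phi> z) = (LINT z|cube n l. v z * \<phi> z) - (LINT z|cube n l. w z * \<phi> z)"
      unfolding left_diff_distrib
      by (intro Bochner_Integration.integral_diff L2_mult_integrable vw test_function_L2(1)[OF \<phi>])
    moreover have "(LINT z|cube n l. v z * \<phi> z) = (LINT z|cube n l. w z * \<phi> z)"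
      using assms(2,3) \<phi> unfolding is_weak_deriv_def by (metis neg_equal_iff_equal)
    ultimately show "(LINT z|cube n l. (v z - w z) * \<phi> z) = 0" by simp
  qed
  then show ?thesis by eventually_elim simp
qed

lemma is_weak_deriv_weak_deriv: "is_weak_deriv n l i \<psi> v \<Longrightarrow> is_weak_deriv n l i \<psi> (weak_deriv n l i \<psi>)"
  unfolding weak_deriv_def by (rule someI[of "is_weak_deriv n l i \<psi>"])

text \<open>\<open>H10\<close> is phrased through the choice \<open>weak_deriv\<close>. Closedness
  and uniqueness of weak derivatives show that any limit \<open>v i\<close> of the partial
  derivatives agrees with the chosen representative almost everywhere, so limits may be computed
  with whatever representative is at hand.\<close>

lemma H10_limit:
  assumes "l > 0" and test: "\<And>m. test_function n l (\<Phi> m)"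
    and lim: "L2_lim (cube n l) \<Phi> \<psi>"
    and lim': "\<And>i. i < n \<Longrightarrow> L2_lim (cube n l) (\<lambda>m. partial_deriv i (\<Phi> m)) (v i)"
  shows "\<psi> \<in> H10 n l" "test_approx n l \<Phi> \<psi>" "\<And>i. i < n \<Longrightarrow> AE z in cube n l. v i z = weak_deriv n l i \<psi> z"
proof -
  have w: "is_weak_deriv n l i \<psi> (v i)" if "i < n" for i
    by (rule is_weak_deriv_limit[OF assms(1) that test lim lim'[OF that]])
  have w': "is_weak_deriv n l i \<psi> (weak_deriv n l i \<psi>)" if "i < n" for i
    by (rule is_weak_deriv_weak_deriv[OF w[OF that]])
  show AE: "AE z in cube n l. v i z = weak_deriv n l i \<psi> z" if "i < n" for i
    by (rule is_weak_deriv_unique[OF assms(1) w[OF that] w'[OF that]])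
  show ta: "test_approx n l \<Phi> \<psi>"
    unfolding test_approx_def
  proof (intro conjI allI impI test lim)
    fix i assume i: "i < n"
    have "weak_deriv n l i \<psi> \<in> borel_measurable (cube n l)"
      using w'[OF i] unfolding is_weak_deriv_def by (intro L2_borel) simp
    then show "L2_lim (cube n l) (\<lambda>m. partial_deriv i (\<Phi> m)) (weak_deriv n l i \<psi>)"
      using L2_lim_cong_AE[OF lim'[OF i] _ AE[OF i]] by simp
  qed
  have "\<psi> \<in> L2 (cube n l)" using lim by (simp add: L2_lim_def)
  then have "\<psi> \<in> H1 n l" unfolding H1_def using w by (intro CollectI conjI) auto
  then show "\<psi> \<in> H10 n l" unfolding H10_def using ta by (intro CollectI conjI) auto
qed

lemma test_approxD:
  assumes "test_approx n l \<Phi> \<psi>"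
  shows "test_function n l (\<Phi> m)" "L2_lim (cube n l) \<Phi> \<psi>"
    "i < n \<Longrightarrow> L2_lim (cube n l) (\<lambda>m. partial_deriv i (\<Phi> m)) (weak_deriv n l i \<psi>)"
  using assms by (simp_all add: test_approx_def)

lemma H10_test_approx: assumes "\<psi> \<in> H10 n l" obtains \<Phi> where "test_approx n l \<Phi> \<psi>"
  using assms unfolding H10_def by auto

lemma H10_L2: "\<psi> \<in> H10 n l \<Longrightarrow> \<psi> \<in> L2 (cube n l)"
  by (simp add: H10_def H1_def)

lemma weak_deriv_L2:
  assumes "\<psi> \<in> H10 n l" "i < n" shows "weak_deriv n l i \<psi> \<in> L2 (cube n l)"
proof -
  obtain \<Phi> where "test_approx n l \<Phi> \<psi>" using assms(1) by (rule H10_test_approx)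
  from test_approxD(3)[OF this assms(2)] show ?thesis by (simp add: L2_lim_def)
qed

text \<open>On the line in direction \<open>k\<close> through a point of the face, \<phi> starts
  from the boundary value 0, so its squared modulus at \<open>z i\<close> is at most
  \<open>l\<close> times the integral of the squared derivative over the line. Integration over the
  face produces the norm over the cube.\<close>

lemma trace_inequality:
  assumes "test_function n l \<phi>" "k < n" "i < n" "i \<noteq> k" "l > 0"
  shows "L2_norm (face n l k) (diag_restr i k \<phi>) \<le> sqrt l * L2_norm (cube n l) (partial_deriv k \<phi>)"
proof -
  obtain A where A: "A \<ge> 0" "\<And>i z. i < n \<Longrightarrow> z \<in> extensional {..<n} \<Longrightarrow> cmod (partial_deriv i \<phi> z) \<le> A"
    using test_function_bounded[OF assms(1)] by metis
  define F where "F z = (cmod (partial_deriv k \<phi> z))\<^sup>2" for z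
  note [measurable] = test_function_measurable(2)[OF assms(1,2)]
  have Fm: "F \<in> borel_measurable (cube n l)" unfolding F_def by measurable
  have Fb: "norm (F z) \<le> A\<^sup>2" if "z \<in> space (cube n l)" for z
    using A(2)[OF assms(2) cube_extensional[OF that]] by (simp add: F_def power_mono)
  have L2r: "diag_restr i k \<phi> \<in> L2 (face n l k)"
    using diagonal_restriction_L2[OF assms(1-4)] by (simp add: diag_restr_def[abs_def])
  have "(LINT z|face n l k. (cmod (diag_restr i k \<phi> z))\<^sup>2)
      \<le> (LINT z|face n l k. l * (LINT t|segment_measure l. F (z(k := t))))"
  proof (rule integral_mono[OF L2_integrable[OF L2r]])
    show "integrable (face n l k) (\<lambda>z. l * (LINT t|segment_measure l. F (z(k := t))))"
      by (rule integrable_mult_right[OF fubini_integrable_inner[OF Fm Fb assms(2)]])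
    fix z assume z: "z \<in> space (face n l k)"
    have "z i \<in> {0<..<l}" using z assms(3,4) by (auto simp: space_cube PiE_iff)
    then have zi: "z i \<in> {0..l}" by simp
    have "(cmod (\<phi> (z(k := z i)) - \<phi> (z(k := 0))))\<^sup>2 \<le> \<bar>z i - 0\<bar> * (LINT t|segment_measure l. F (z(k := t)))"
      unfolding F_def using zi \<open>l > 0\<close> by (intro slice_diff_sq_le[OF assms(1,2) z]) auto
    also have "\<dots> \<le> l * (LINT t|segment_measure l. F (z(k := t)))"
      using zi by (intro mult_right_mono) (auto simp: F_def)
    finally show "(cmod (diag_restr i k \<phi> z))\<^sup>2 \<le> l * (LINT t|segment_measure l. F (z(k := t)))"
      using slice_derivative(3)[OF assms(1,2) z, of 0] by (simp add: diag_restr_def)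
  qed
  also have "\<dots> = l * (LINT z|cube n l. F z)"
    by (simp add: fubini[OF Fm Fb assms(2)])
  finally have "(L2_norm (face n l k) (diag_restr i k \<phi>))\<^sup>2 \<le> (sqrt l * L2_norm (cube n l) (partial_deriv k \<phi>))\<^sup>2"
    using \<open>l > 0\<close> by (simp add: L2_norm_sq F_def[abs_def] power_mult_distrib)
  then show ?thesis by (rule power2_le_imp_le) (use \<open>l > 0\<close> in \<open>simp add: L2_norm_nonneg\<close>)
qed

lemma diag_restr_L2:
  "test_function n l \<phi> \<Longrightarrow> k < n \<Longrightarrow> i < n \<Longrightarrow> i \<noteq> k \<Longrightarrow> diag_restr i k \<phi> \<in> L2 (face n l k)"
  using diagonal_restriction_L2 by (simp add: diag_restr_def[abs_def])

lemma trace_distance: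
  assumes "test_function n l \<phi>" "test_function n l \<psi>" "k < n" "i < n" "i \<noteq> k" "l > 0"
  shows "L2_norm (face n l k) (\<lambda>z. diag_restr i k \<phi> z - diag_restr i k \<psi> z) \<le>
    sqrt l * L2_norm (cube n l) (\<lambda>z. partial_deriv k \<phi> z - partial_deriv k \<psi> z)"
proof -
  have t: "test_function n l (\<lambda>z. \<phi> z + (-1) * \<psi> z)" by (rule test_function_lincomb[OF assms(1,2)])
  have 1: "diag_restr i k (\<lambda>z. \<phi> z + (-1) * \<psi> z) = (\<lambda>z. diag_restr i k \<phi> z - diag_restr i k \<psi> z)"
    by (simp add: diag_restr_def fun_eq_iff)
  have 2: "L2_norm (cube n l) (partial_deriv k (\<lambda>z. \<phi> z + (-1) * \<psi> z)) =
      L2_norm (cube n l) (\<lambda>z. partial_deriv k \<phi> z - partial_deriv k \<psi> z)"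
    unfolding L2_norm_def
  proof (intro arg_cong[of _ _ sqrt] Bochner_Integration.integral_cong refl)
    fix z assume "z \<in> space (cube n l)"
    then have "z \<in> extensional {..<n}" by (rule cube_extensional)
    from partial_deriv_lincomb[OF assms(1-3) this, of "-1"]
    show "(cmod (partial_deriv k (\<lambda>z. \<phi> z + (-1) * \<psi> z) z))\<^sup>2 = (cmod (partial_deriv k \<phi> z - partial_deriv k \<psi> z))\<^sup>2"
      by simp
  qed
  show ?thesis using trace_inequality[OF t assms(3-6)] unfolding 1 2 .
qed

lemma traces_converge:
  assumes "test_approx n l \<Phi> \<psi>" "k < n" "i < n" "i \<noteq> k" "l > 0"
  shows "\<exists>\<tau>. L2_lim (face n l k) (\<lambda>m. diag_restr i k (\<Phi> m)) \<tau>"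
proof (rule L2_complete, unfold L2.cauchy_def, intro conjI allI impI)
  fix m show "diag_restr i k (\<Phi> m) \<in> L2 (face n l k)" by (rule diag_restr_L2[OF test_approxD(1)[OF assms(1)] assms(2-4)])
next
  fix e :: real assume e: "e > 0"
  have "hermitian_form.cauchy (L2 (cube n l)) (L2_inner (cube n l)) (\<lambda>m. partial_deriv k (\<Phi> m))"
    by (rule L2.conv_imp_cauchy[OF test_approxD(3)[OF assms(1,2)]])
  then obtain N where N: "\<And>m n'. m \<ge> N \<Longrightarrow> n' \<ge> N \<Longrightarrow>
      L2_norm (cube n l) (\<lambda>z. partial_deriv k (\<Phi> m) z - partial_deriv k (\<Phi> n') z) < e / sqrt l"
    unfolding L2.cauchy_def using e assms(5) by (meson divide_pos_pos real_sqrt_gt_zero)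
  show "\<exists>N. \<forall>m\<ge>N. \<forall>n'\<ge>N. L2_norm (face n l k) (\<lambda>z. diag_restr i k (\<Phi> m) z - diag_restr i k (\<Phi> n') z) < e"
  proof (intro exI[of _ N] allI impI)
    fix m n' assume mn: "m \<ge> N" "n' \<ge> N"
    have "L2_norm (face n l k) (\<lambda>z. diag_restr i k (\<Phi> m) z - diag_restr i k (\<Phi> n') z) \<le>
        sqrt l * L2_norm (cube n l) (\<lambda>z. partial_deriv k (\<Phi> m) z - partial_deriv k (\<Phi> n') z)"
      by (rule trace_distance[OF test_approxD(1)[OF assms(1)] test_approxD(1)[OF assms(1)] assms(2-5)])
    also have "\<dots> < sqrt l * (e / sqrt l)" using N[OF mn] assms(5) by (intro mult_strict_left_mono) auto
    also have "\<dots> = e" using assms(5) by simp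
    finally show "L2_norm (face n l k) (\<lambda>z. diag_restr i k (\<Phi> m) z - diag_restr i k (\<Phi> n') z) < e" .
  qed
qed

text \<open>The choice in \<open>diag_trace\<close> fixes a limit along some approximating sequence.
  Two such sequences for the same \<psi> have partial derivatives with the same limit, so by
  \<open>trace_distance\<close> their restrictions approach each other, and the chosen trace is the
  limit along every sequence.\<close>

lemma diag_trace_lim:
  assumes ta: "test_approx n l \<Phi> \<psi>" and k: "k < n" "i < n" "i \<noteq> k" and "l > 0"
  shows "L2_lim (face n l k) (\<lambda>m. diag_restr i k (\<Phi> m)) (diag_trace n l i k \<psi>)"
proof -
  obtain \<tau> where "L2_lim (face n l k) (\<lambda>m. diag_restr i k (\<Phi> m)) \<tau>" using traces_converge[OF assms] by blast
  then have "\<exists>\<tau> \<Phi>. test_approx n l \<Phi> \<psi> \<and> L2_lim (face n l k) (\<lambda>m z. \<Phi> m (z(k := z i))) \<tau>"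
    using ta unfolding diag_restr_def by (intro exI[of _ \<tau>] exI[of _ \<Phi>] conjI)
  then have "\<exists>\<Phi>. test_approx n l \<Phi> \<psi> \<and> L2_lim (face n l k) (\<lambda>m z. \<Phi> m (z(k := z i))) (diag_trace n l i k \<psi>)"
    unfolding diag_trace_def by (rule someI_ex)
  then obtain \<Psi> where \<Psi>: "test_approx n l \<Psi> \<psi>" "L2_lim (face n l k) (\<lambda>m. diag_restr i k (\<Psi> m)) (diag_trace n l i k \<psi>)"
    unfolding diag_restr_def by blast
  let ?\<tau> = "diag_trace n l i k \<psi>" and ?T = "\<lambda>\<Phi> m. diag_restr i k (\<Phi> m)"
  have V: "?T \<Phi> m \<in> L2 (face n l k)" "?T \<Psi> m \<in> L2 (face n l k)" "?\<tau> \<in> L2 (face n l k)" for m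
    using diag_restr_L2[OF test_approxD(1)[OF ta] k] diag_restr_L2[OF test_approxD(1)[OF \<Psi>(1)] k] \<Psi>(2)
    by (simp_all add: L2_lim_def)
  let ?D = "\<lambda>m. L2_norm (cube n l) (\<lambda>z. partial_deriv k (\<Phi> m) z - partial_deriv k (\<Psi> m) z)"
  let ?w = "weak_deriv n l k \<psi>"
  have "L2_lim (cube n l) (\<lambda>m z. partial_deriv k (\<Phi> m) z + (-1) * partial_deriv k (\<Psi> m) z) (\<lambda>z. ?w z + (-1) * ?w z)"
    by (rule L2.conv_add[OF test_approxD(3)[OF ta k(1)] test_approxD(3)[OF \<Psi>(1) k(1)]])
  from L2.conv_nrm[OF this] have D: "?D \<longlonglongrightarrow> 0" by (simp add: L2_norm_def)
  have "(\<lambda>m. L2_norm (face n l k) (\<lambda>z. ?T \<Phi> m z - ?\<tau> z)) \<longlonglongrightarrow> 0"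
  proof (rule tendsto_sandwich[OF always_eventually always_eventually tendsto_const])
    show "\<forall>m. 0 \<le> L2_norm (face n l k) (\<lambda>z. ?T \<Phi> m z - ?\<tau> z)" by (simp add: L2_norm_nonneg)
    show "\<forall>m. L2_norm (face n l k) (\<lambda>z. ?T \<Phi> m z - ?\<tau> z) \<le>
        sqrt l * ?D m + L2_norm (face n l k) (\<lambda>z. ?T \<Psi> m z - ?\<tau> z)"
    proof
      fix m
      have "L2_norm (face n l k) (\<lambda>z. ?T \<Phi> m z - ?\<tau> z) \<le>
          L2_norm (face n l k) (\<lambda>z. ?T \<Phi> m z - ?T \<Psi> m z) + L2_norm (face n l k) (\<lambda>z. ?T \<Psi> m z - ?\<tau> z)"
        by (rule L2.nrm_diff_triangle[OF V])
      also have "L2_norm (face n l k) (\<lambda>z. ?T \<Phi> m z - ?T \<Psi> m z) \<le> sqrt l * ?D m"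
        by (rule trace_distance[OF test_approxD(1)[OF ta] test_approxD(1)[OF \<Psi>(1)] k assms(5)])
      finally show "L2_norm (face n l k) (\<lambda>z. ?T \<Phi> m z - ?\<tau> z) \<le>
          sqrt l * ?D m + L2_norm (face n l k) (\<lambda>z. ?T \<Psi> m z - ?\<tau> z)" by simp
    qed
    show "(\<lambda>m. sqrt l * ?D m + L2_norm (face n l k) (\<lambda>z. ?T \<Psi> m z - ?\<tau> z)) \<longlonglongrightarrow> 0"
      using tendsto_add[OF tendsto_mult_right_zero[OF D, of "sqrt l"], of "\<lambda>m. L2_norm (face n l k) (\<lambda>z. ?T \<Psi> m z - ?\<tau> z)" 0]
        \<Psi>(2) by (simp add: L2_lim_def)
  qed
  then show ?thesis using V by (simp add: L2_lim_def)
qed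

lemma diag_trace_L2:
  assumes "\<psi> \<in> H10 n l" "k < n" "i < n" "i \<noteq> k" "l > 0"
  shows "diag_trace n l i k \<psi> \<in> L2 (face n l k)"
proof -
  obtain \<Phi> where "test_approx n l \<Phi> \<psi>" using assms(1) by (rule H10_test_approx)
  from diag_trace_lim[OF this assms(2-5)] show ?thesis by (simp add: L2_lim_def)
qed

lemma L2_lim_cong:
  assumes "\<And>m z. z \<in> space M \<Longrightarrow> H m z = F m z" "L2_lim M F f" "\<And>m. H m \<in> borel_measurable M"
  shows "L2_lim M H f"
proof -
  have F: "F m \<in> L2 M" "f \<in> L2 M" for m using assms(2) by (simp_all add: L2_lim_def)
  have H: "H m \<in> L2 M" for m
    by (rule L2_cong_AE[OF F(1)[of m] assms(3)]) (simp add: assms(1))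
  have "L2_norm M (\<lambda>z. H m z - f z) = L2_norm M (\<lambda>z. F m z - f z)" for m
    unfolding L2_norm_def by (intro arg_cong[of _ _ sqrt] Bochner_Integration.integral_cong refl) (simp add: assms(1))
  then show ?thesis using assms(2) H by (simp add: L2_lim_def)
qed

lemma test_approx_lincomb:
  assumes "l > 0" and a: "test_approx n l \<Phi> \<psi>" and b: "test_approx n l \<Psi> \<zeta>"
  shows "test_approx n l (\<lambda>m z. \<Phi> m z + c * \<Psi> m z) (\<lambda>z. \<psi> z + c * \<zeta> z)"
    and "(\<lambda>z. \<psi> z + c * \<zeta> z) \<in> H10 n l"
    and "i < n \<Longrightarrow> AE z in cube n l. weak_deriv n l i \<psi> z + c * weak_deriv n l i \<zeta> z = weak_deriv n l i (\<lambda>z. \<psi> z + c * \<zeta> z) z"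
proof -
  have t: "test_function n l (\<lambda>z. \<Phi> m z + c * \<Psi> m z)" for m
    by (rule test_function_lincomb[OF test_approxD(1)[OF a] test_approxD(1)[OF b]])
  have 1: "L2_lim (cube n l) (\<lambda>m z. \<Phi> m z + c * \<Psi> m z) (\<lambda>z. \<psi> z + c * \<zeta> z)"
    by (rule L2.conv_add[OF test_approxD(2)[OF a] test_approxD(2)[OF b]])
  have 2: "L2_lim (cube n l) (\<lambda>m. partial_deriv i (\<lambda>z. \<Phi> m z + c * \<Psi> m z))
      (\<lambda>z. weak_deriv n l i \<psi> z + c * weak_deriv n l i \<zeta> z)" if i: "i < n" for i
    by (rule L2_lim_cong[OF partial_deriv_lincomb[OF test_approxD(1)[OF a] test_approxD(1)[OF b] i cube_extensional]
          L2.conv_add[OF test_approxD(3)[OF a i] test_approxD(3)[OF b i]] test_function_measurable(2)[OF t i]])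
  note H = H10_limit[OF assms(1), of n "\<lambda>m z. \<Phi> m z + c * \<Psi> m z" "\<lambda>z. \<psi> z + c * \<zeta> z"
      "\<lambda>i z. weak_deriv n l i \<psi> z + c * weak_deriv n l i \<zeta> z", OF t 1 2]
  show "test_approx n l (\<lambda>m z. \<Phi> m z + c * \<Psi> m z) (\<lambda>z. \<psi> z + c * \<zeta> z)" by (rule H(2))
  show "(\<lambda>z. \<psi> z + c * \<zeta> z) \<in> H10 n l" by (rule H(1))
  show "i < n \<Longrightarrow> AE z in cube n l. weak_deriv n l i \<psi> z + c * weak_deriv n l i \<zeta> z = weak_deriv n l i (\<lambda>z. \<psi> z + c * \<zeta> z) z"
    by (rule H(3))
qed

text \<open>Linearity holds only almost everywhere, since the representatives chosen by
  \<open>weak_deriv\<close> and \<open>diag_trace\<close> need not be chosen linearly.\<close>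

lemma H10_lincomb:
  assumes "l > 0" "\<psi> \<in> H10 n l" "\<zeta> \<in> H10 n l"
  shows "(\<lambda>z. \<psi> z + c * \<zeta> z) \<in> H10 n l"
    and "i < n \<Longrightarrow> AE z in cube n l. weak_deriv n l i \<psi> z + c * weak_deriv n l i \<zeta> z = weak_deriv n l i (\<lambda>z. \<psi> z + c * \<zeta> z) z"
    and "k < n \<Longrightarrow> j < n \<Longrightarrow> j \<noteq> k \<Longrightarrow> AE z in face n l k.
      diag_trace n l j k \<psi> z + c * diag_trace n l j k \<zeta> z = diag_trace n l j k (\<lambda>z. \<psi> z + c * \<zeta> z) z"
proof -
  obtain \<Phi> where a: "test_approx n l \<Phi> \<psi>" using assms(2) by (rule H10_test_approx)
  obtain \<Psi> where b: "test_approx n l \<Psi> \<zeta>" using assms(3) by (rule H10_test_approx)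
  note H = test_approx_lincomb[OF assms(1) a b, where c = c]
  show "(\<lambda>z. \<psi> z + c * \<zeta> z) \<in> H10 n l" by (rule H(2))
  show "i < n \<Longrightarrow> AE z in cube n l. weak_deriv n l i \<psi> z + c * weak_deriv n l i \<zeta> z = weak_deriv n l i (\<lambda>z. \<psi> z + c * \<zeta> z) z"
    by (rule H(3))
  assume k: "k < n" "j < n" "j \<noteq> k"
  have "L2_lim (face n l k) (\<lambda>m z. diag_restr j k (\<Phi> m) z + c * diag_restr j k (\<Psi> m) z)
      (\<lambda>z. diag_trace n l j k \<psi> z + c * diag_trace n l j k \<zeta> z)"
    by (rule L2.conv_add[OF diag_trace_lim[OF a k assms(1)] diag_trace_lim[OF b k assms(1)]])
  moreover have "L2_lim (face n l k) (\<lambda>m. diag_restr j k (\<lambda>z. \<Phi> m z + c * \<Psi> m z)) (diag_trace n l j k (\<lambda>z. \<psi> z + c * \<zeta> z))"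
    by (rule diag_trace_lim[OF H(1) k assms(1)])
  moreover have "(\<lambda>m. diag_restr j k (\<lambda>z. \<Phi> m z + c * \<Psi> m z)) = (\<lambda>m z. diag_restr j k (\<Phi> m) z + c * diag_restr j k (\<Psi> m) z)"
    by (simp add: diag_restr_def fun_eq_iff)
  ultimately show "AE z in face n l k.
      diag_trace n l j k \<psi> z + c * diag_trace n l j k \<zeta> z = diag_trace n l j k (\<lambda>z. \<psi> z + c * \<zeta> z) z"
    using L2_lim_unique by simp
qed

lemma test_approx_const:
  assumes "l > 0" "test_function n l \<phi>"
  shows "test_approx n l (\<lambda>_. \<phi>) \<phi>" "\<phi> \<in> H10 n l"
    "i < n \<Longrightarrow> AE z in cube n l. partial_deriv i \<phi> z = weak_deriv n l i \<phi> z"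
    "k < n \<Longrightarrow> j < n \<Longrightarrow> j \<noteq> k \<Longrightarrow> AE z in face n l k. diag_restr j k \<phi> z = diag_trace n l j k \<phi> z"
proof -
  have c: "L2_lim M (\<lambda>_. f) f" if "f \<in> L2 M" for f M using that by (simp add: L2_lim_def L2_norm_def)
  note H = H10_limit[OF assms(1), of n "\<lambda>_. \<phi>" \<phi> "\<lambda>i. partial_deriv i \<phi>",
      OF assms(2) c[OF test_function_L2(1)[OF assms(2)]] c[OF test_function_L2(2)[OF assms(2)]]]
  show ta: "test_approx n l (\<lambda>_. \<phi>) \<phi>" by (rule H(2))
  show "\<phi> \<in> H10 n l" by (rule H(1))
  show "i < n \<Longrightarrow> AE z in cube n l. partial_deriv i \<phi> z = weak_deriv n l i \<phi> z" by (rule H(3))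
  assume k: "k < n" "j < n" "j \<noteq> k"
  show "AE z in face n l k. diag_restr j k \<phi> z = diag_trace n l j k \<phi> z"
    by (rule L2_lim_unique[OF c[OF diag_restr_L2[OF assms(2) k]] diag_trace_lim[OF ta k assms(1)]])
qed

lemma zero_H10: assumes "l > 0" shows "(\<lambda>_. 0) \<in> H10 n l"
proof (rule test_approx_const(2)[OF assms])
  have "smooth n (\<lambda>_. 0)" unfolding smooth_def by (intro exI[of _ "\<lambda>_ _. 0"]) simp
  then show "test_function n l (\<lambda>_. 0)" unfolding test_function_def by (intro conjI exI[of _ "{}"]) simp_all
qed

lemma H10_scale:
  assumes "l > 0" "\<psi> \<in> H10 n l" shows "(\<lambda>z. c * \<psi> z) \<in> H10 n l"
  using H10_lincomb(1)[OF assms(1) zero_H10[OF assms(1)] assms(2), of c] by simp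

text \<open>The estimate for test functions passes to the limit along approximating sequences of the
  two functions.\<close>

lemma H10_trace_distance:
  assumes "l > 0" "\<psi> \<in> H10 n l" "\<zeta> \<in> H10 n l" "k < n" "i < n" "i \<noteq> k"
  shows "L2_norm (face n l k) (\<lambda>z. diag_trace n l i k \<psi> z - diag_trace n l i k \<zeta> z) \<le>
    sqrt l * L2_norm (cube n l) (\<lambda>z. weak_deriv n l k \<psi> z - weak_deriv n l k \<zeta> z)"
proof -
  obtain \<Phi> where a: "test_approx n l \<Phi> \<psi>" using assms(2) by (rule H10_test_approx)
  obtain \<Psi> where b: "test_approx n l \<Psi> \<zeta>" using assms(3) by (rule H10_test_approx)
  have "(\<lambda>m. L2_norm (face n l k) (\<lambda>z. diag_restr i k (\<Phi> m) z + (-1) * diag_restr i k (\<Psi> m) z)) \<longlonglongrightarrow>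
      L2_norm (face n l k) (\<lambda>z. diag_trace n l i k \<psi> z + (-1) * diag_trace n l i k \<zeta> z)"
    by (rule L2.conv_nrm[OF L2.conv_add[OF diag_trace_lim[OF a assms(4-6,1)] diag_trace_lim[OF b assms(4-6,1)]]])
  moreover have "(\<lambda>m. sqrt l * L2_norm (cube n l) (\<lambda>z. partial_deriv k (\<Phi> m) z + (-1) * partial_deriv k (\<Psi> m) z)) \<longlonglongrightarrow>
      sqrt l * L2_norm (cube n l) (\<lambda>z. weak_deriv n l k \<psi> z + (-1) * weak_deriv n l k \<zeta> z)"
    by (rule tendsto_mult[OF tendsto_const L2.conv_nrm[OF L2.conv_add[OF test_approxD(3)[OF a assms(4)] test_approxD(3)[OF b assms(4)]]]])
  ultimately show ?thesis
    using trace_distance[OF test_approxD(1)[OF a] test_approxD(1)[OF b] assms(4-6,1)]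
    by (intro LIMSEQ_le) (auto)
qed

lemma L2_lim_nearby:
  assumes "L2_lim M F f" "\<And>m. H m \<in> L2 M" "\<And>m. L2_norm M (\<lambda>z. H m z - F m z) \<le> a m" "a \<longlonglongrightarrow> 0"
  shows "L2_lim M H f"
proof -
  have F: "F m \<in> L2 M" "f \<in> L2 M" for m using assms(1) by (simp_all add: L2_lim_def)
  have b: "L2_norm M (\<lambda>z. H m z - f z) \<le> a m + L2_norm M (\<lambda>z. F m z - f z)" for m
    using L2.nrm_diff_triangle[OF assms(2) F, of m m] assms(3)[of m] by linarith
  have "(\<lambda>m. a m + L2_norm M (\<lambda>z. F m z - f z)) \<longlonglongrightarrow> 0"
    using tendsto_add[OF assms(4), of "\<lambda>m. L2_norm M (\<lambda>z. F m z - f z)" 0] assms(1) by (simp add: L2_lim_def)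
  note lim = this
  have "(\<lambda>m. L2_norm M (\<lambda>z. H m z - f z)) \<longlonglongrightarrow> 0"
    by (rule tendsto_sandwich[OF always_eventually always_eventually tendsto_const lim]) (simp_all add: b L2_norm_nonneg)
  then show ?thesis using assms(2) F by (simp add: L2_lim_def)
qed

lemma H10_approx_close:
  assumes "\<psi> \<in> H10 n l" "e > 0"
  shows "\<exists>\<phi>. test_function n l \<phi> \<and> L2_norm (cube n l) (\<lambda>z. \<phi> z - \<psi> z) \<le> e \<and>
    (\<forall>i<n. L2_norm (cube n l) (\<lambda>z. partial_deriv i \<phi> z - weak_deriv n l i \<psi> z) \<le> e)"
proof -
  obtain \<Phi> where a: "test_approx n l \<Phi> \<psi>" using assms(1) by (rule H10_test_approx)
  have "\<forall>\<^sub>F m in sequentially. L2_norm (cube n l) (\<lambda>z. \<Phi> m z - \<psi> z) < e"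
    using test_approxD(2)[OF a] assms(2) unfolding L2_lim_def by (intro order_tendstoD(2)) auto
  moreover have "\<forall>\<^sub>F m in sequentially. \<forall>i\<in>{..<n}. L2_norm (cube n l) (\<lambda>z. partial_deriv i (\<Phi> m) z - weak_deriv n l i \<psi> z) < e"
  proof (rule eventually_ball_finite[OF finite_lessThan ballI])
    fix i assume "i \<in> {..<n}"
    then have "i < n" by simp
    from test_approxD(3)[OF a this] show "\<forall>\<^sub>F m in sequentially. L2_norm (cube n l) (\<lambda>z. partial_deriv i (\<Phi> m) z - weak_deriv n l i \<psi> z) < e"
      using assms(2) unfolding L2_lim_def by (intro order_tendstoD(2)) auto
  qed
  ultimately have "\<forall>\<^sub>F m in sequentially. L2_norm (cube n l) (\<lambda>z. \<Phi> m z - \<psi> z) < e \<and>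
      (\<forall>i\<in>{..<n}. L2_norm (cube n l) (\<lambda>z. partial_deriv i (\<Phi> m) z - weak_deriv n l i \<psi> z) < e)"
    by (rule eventually_conj)
  then obtain m where "L2_norm (cube n l) (\<lambda>z. \<Phi> m z - \<psi> z) < e"
      "\<forall>i\<in>{..<n}. L2_norm (cube n l) (\<lambda>z. partial_deriv i (\<Phi> m) z - weak_deriv n l i \<psi> z) < e"
    using eventually_happens'[OF sequentially_bot] by blast
  then show ?thesis using test_approxD(1)[OF a, of m] by (intro exI[of _ "\<Phi> m"]) (simp add: less_imp_le)
qed

text \<open>The limit lies in \<open>H10\<close> because every \<open>\<psi> m\<close> can be
  replaced by a test function within \<open>inverse (Suc m)\<close>, in norm and in all partial
  derivatives, without changing any limit. Convergence of the traces then follows from the trace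
  inequality.\<close>

lemma H10_complete:
  assumes "l > 0" and H: "\<And>m. \<psi> m \<in> H10 n l"
    and c: "hermitian_form.cauchy (L2 (cube n l)) (L2_inner (cube n l)) \<psi>"
    and c': "\<And>i. i < n \<Longrightarrow> hermitian_form.cauchy (L2 (cube n l)) (L2_inner (cube n l)) (\<lambda>m. weak_deriv n l i (\<psi> m))"
  obtains \<zeta> where "\<zeta> \<in> H10 n l" "L2_lim (cube n l) \<psi> \<zeta>"
    "\<And>i. i < n \<Longrightarrow> L2_lim (cube n l) (\<lambda>m. weak_deriv n l i (\<psi> m)) (weak_deriv n l i \<zeta>)"
    "\<And>k i. k < n \<Longrightarrow> i < n \<Longrightarrow> i \<noteq> k \<Longrightarrow> L2_lim (face n l k) (\<lambda>m. diag_trace n l i k (\<psi> m)) (diag_trace n l i k \<zeta>)"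
proof -
  obtain \<zeta> where \<zeta>: "L2_lim (cube n l) \<psi> \<zeta>" using L2_complete[OF c] by blast
  have "\<exists>v. \<forall>i<n. L2_lim (cube n l) (\<lambda>m. weak_deriv n l i (\<psi> m)) (v i)"
    using L2_complete[OF c'] by metis
  then obtain v where v: "\<And>i. i < n \<Longrightarrow> L2_lim (cube n l) (\<lambda>m. weak_deriv n l i (\<psi> m)) (v i)" by blast
  have "\<forall>m. \<exists>\<phi>. test_function n l \<phi> \<and> L2_norm (cube n l) (\<lambda>z. \<phi> z - \<psi> m z) \<le> inverse (real (Suc m)) \<and>
    (\<forall>i<n. L2_norm (cube n l) (\<lambda>z. partial_deriv i \<phi> z - weak_deriv n l i (\<psi> m) z) \<le> inverse (real (Suc m)))"
    by (intro allI H10_approx_close[OF H]) simp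
  then obtain \<Phi> where \<Phi>: "\<And>m. test_function n l (\<Phi> m)"
      "\<And>m. L2_norm (cube n l) (\<lambda>z. \<Phi> m z - \<psi> m z) \<le> inverse (real (Suc m))"
      "\<And>m i. i < n \<Longrightarrow> L2_norm (cube n l) (\<lambda>z. partial_deriv i (\<Phi> m) z - weak_deriv n l i (\<psi> m) z) \<le> inverse (real (Suc m))"
    by (metis choice)
  have 1: "L2_lim (cube n l) \<Phi> \<zeta>"
    by (rule L2_lim_nearby[OF \<zeta> test_function_L2(1)[OF \<Phi>(1)] \<Phi>(2) LIMSEQ_inverse_real_of_nat])
  have 2: "L2_lim (cube n l) (\<lambda>m. partial_deriv i (\<Phi> m)) (v i)" if "i < n" for i
    by (rule L2_lim_nearby[OF v[OF that] test_function_L2(2)[OF \<Phi>(1) that] \<Phi>(3)[OF that] LIMSEQ_inverse_real_of_nat])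
  have HL1: "\<zeta> \<in> H10 n l" by (rule H10_limit(1)[OF assms(1) \<Phi>(1) 1 2])
  have HL3: "AE z in cube n l. v i z = weak_deriv n l i \<zeta> z" if "i < n" for i
    by (rule H10_limit(3)[OF assms(1) \<Phi>(1) 1 2 that])
  have wd: "L2_lim (cube n l) (\<lambda>m. weak_deriv n l i (\<psi> m)) (weak_deriv n l i \<zeta>)" if "i < n" for i
    by (rule L2_lim_cong_AE[OF v[OF that] L2_borel[OF weak_deriv_L2[OF HL1 that]] HL3[OF that]])
  show thesis
  proof (rule that[OF HL1 \<zeta> wd])
    fix k i assume k: "k < n" "i < n" "i \<noteq> k"
    let ?\<tau> = "\<lambda>\<psi>. diag_trace n l i k \<psi>" and ?w = "\<lambda>\<psi>. weak_deriv n l k \<psi>"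
    have "(\<lambda>m. sqrt l * L2_norm (cube n l) (\<lambda>z. ?w (\<psi> m) z - ?w \<zeta> z)) \<longlonglongrightarrow> 0"
      using wd[OF k(1)] unfolding L2_lim_def by (intro tendsto_mult_right_zero) simp
    note lim = this
    have "(\<lambda>m. L2_norm (face n l k) (\<lambda>z. ?\<tau> (\<psi> m) z - ?\<tau> \<zeta> z)) \<longlonglongrightarrow> 0"
      by (rule tendsto_sandwich[OF always_eventually always_eventually tendsto_const lim])
        (simp_all add: L2_norm_nonneg H10_trace_distance[OF assms(1) H HL1 k])
    then show "L2_lim (face n l k) (\<lambda>m. ?\<tau> (\<psi> m)) (?\<tau> \<zeta>)"
      using diag_trace_L2[OF H k assms(1)] diag_trace_L2[OF HL1 k assms(1)] by (simp add: L2_lim_def)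
  qed
qed

section \<open>Permutations of the coordinates and symmetric functions\<close>

lemma distr_cube_permute:
  assumes "\<pi> permutes {..<n}"
  shows "distr (cube n l) (cube n l) (\<lambda>z. z \<circ> \<pi>) = cube n l"
    and "(\<lambda>z. z \<circ> \<pi>) \<in> measurable (cube n l) (cube n l)"
proof -
  have ext: "z \<circ> \<pi> \<in> {..<n} \<rightarrow>\<^sub>E A" if "z \<in> {..<n} \<rightarrow>\<^sub>E A" for z and A :: "real set"
    using that permutes_in_image[OF assms] permutes_not_in[OF assms] by (auto simp: PiE_iff extensional_def)
  show meas: "(\<lambda>z. z \<circ> \<pi>) \<in> measurable (cube n l) (cube n l)"
    unfolding cube_measure_def
  proof (rule measurable_PiM_single')
    fix i assume "i \<in> {..<n}"
    then show "(\<lambda>z. (z \<circ> \<pi>) i) \<in> measurable (Pi\<^sub>M {..<n} (\<lambda>_. segment_measure l)) (segment_measure l)"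
      using permutes_in_image[OF assms, of i] unfolding comp_def by (intro measurable_component_singleton) auto
  next
    show "(\<lambda>z i. (z \<circ> \<pi>) i) \<in> space (Pi\<^sub>M {..<n} (\<lambda>_. segment_measure l)) \<rightarrow> (\<Pi>\<^sub>E i\<in>{..<n}. space (segment_measure l))"
    proof (rule funcsetI)
      fix z assume "z \<in> space (Pi\<^sub>M {..<n} (\<lambda>_. segment_measure l))"
      then have "z \<circ> \<pi> \<in> {..<n} \<rightarrow>\<^sub>E {0<..<l}" by (intro ext) (simp add: space_PiM)
      then show "(\<lambda>i. (z \<circ> \<pi>) i) \<in> (\<Pi>\<^sub>E i\<in>{..<n}. space (segment_measure l))" by (simp add: comp_def)
    qed
  qed
  show "distr (cube n l) (cube n l) (\<lambda>z. z \<circ> \<pi>) = cube n l"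
    unfolding cube_measure_def
  proof (rule cube.PiM_eqI)
    let ?M = "Pi\<^sub>M {..<n} (\<lambda>_. segment_measure l)"
    fix A :: "nat \<Rightarrow> real set" assume A: "\<And>i. i \<in> {..<n} \<Longrightarrow> A i \<in> sets (segment_measure l)"
    let ?\<sigma> = "inv \<pi>"
    have \<sigma>: "?\<sigma> permutes {..<n}" by (rule permutes_inv[OF assms])
    have A\<sigma>: "A (?\<sigma> i) \<in> sets (segment_measure l)" if "i \<in> {..<n}" for i
      using that permutes_in_image[OF \<sigma>] by (intro A) auto
    have Asub: "A i \<subseteq> {0<..<l}" if "i \<in> {..<n}" for i using sets.sets_into_space[OF A[OF that]] by simp
    \<comment> \<open>The preimage of a rectangle is the rectangle with sides permuted by
      \<open>inv \<pi>\<close>; the product of the side measures does not change, and rectangles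
      determine the measure.\<close>
    have vim: "(\<lambda>z. z \<circ> \<pi>) -` (PiE {..<n} A) \<inter> space ?M = PiE {..<n} (\<lambda>i. A (?\<sigma> i))"
    proof (intro equalityI subsetI)
      fix z assume z: "z \<in> (\<lambda>z. z \<circ> \<pi>) -` (PiE {..<n} A) \<inter> space ?M"
      then have zP: "z \<circ> \<pi> \<in> PiE {..<n} A" by (elim IntE vimageE) simp
      have zS: "z \<in> {..<n} \<rightarrow>\<^sub>E {0<..<l}" using IntD2[OF z] unfolding space_PiM space_segment_measure .
      show "z \<in> PiE {..<n} (\<lambda>i. A (?\<sigma> i))"
      proof (rule PiE_I)
        fix i assume "i \<in> {..<n}"
        then have "?\<sigma> i \<in> {..<n}" using permutes_in_image[OF \<sigma>] by blast
        then have "(z \<circ> \<pi>) (?\<sigma> i) \<in> A (?\<sigma> i)" by (rule PiE_mem[OF zP])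
        then show "z i \<in> A (?\<sigma> i)" using permutes_inverses(1)[OF assms] by simp
      next
        fix i assume "i \<notin> {..<n}"
        then show "z i = undefined" by (rule PiE_arb[OF zS])
      qed
    next
      fix z assume z: "z \<in> PiE {..<n} (\<lambda>i. A (?\<sigma> i))"
      have m: "z i \<in> A (?\<sigma> i)" if "i \<in> {..<n}" for i using z that by (rule PiE_mem)
      have sp: "z \<in> space ?M" unfolding space_PiM
      proof (rule PiE_I)
        fix i assume i: "i \<in> {..<n}"
        have "A (?\<sigma> i) \<subseteq> {0<..<l}" using i permutes_in_image[OF \<sigma>] by (intro Asub) auto
        then show "z i \<in> space (segment_measure l)" unfolding space_segment_measure using m[OF i] by (rule subsetD)
      next
        fix i assume "i \<notin> {..<n}"
        then show "z i = undefined" by (rule PiE_arb[OF z])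
      qed
      have "z \<circ> \<pi> \<in> PiE {..<n} A"
      proof (rule PiE_I)
        fix i assume "i \<in> {..<n}"
        then have "\<pi> i \<in> {..<n}" using permutes_in_image[OF assms] by blast
        from m[OF this] show "(z \<circ> \<pi>) i \<in> A i" using permutes_inverses(2)[OF assms] by simp
      next
        fix i assume "i \<notin> {..<n}"
        then show "(z \<circ> \<pi>) i = undefined" using permutes_not_in[OF assms, of i] PiE_arb[OF z, of i] by simp
      qed
      then show "z \<in> (\<lambda>z. z \<circ> \<pi>) -` (PiE {..<n} A) \<inter> space ?M" using sp by simp
    qed
    have "emeasure (distr ?M ?M (\<lambda>z. z \<circ> \<pi>)) (PiE {..<n} A) = emeasure ?M (PiE {..<n} (\<lambda>i. A (?\<sigma> i)))"
      using meas A vim unfolding cube_measure_def by (subst emeasure_distr) (auto intro!: sets_PiM_I_finite)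
    also have "\<dots> = (\<Prod>i<n. emeasure (segment_measure l) (A (?\<sigma> i)))"
      by (rule cube.emeasure_PiM[OF finite_lessThan A\<sigma>])
    also have "\<dots> = (\<Prod>i<n. emeasure (segment_measure l) (A i))"
      by (rule prod.reindex_bij_betw[OF permutes_imp_bij[OF \<sigma>], of "\<lambda>i. emeasure (segment_measure l) (A i)"])
    finally show "emeasure (distr ?M ?M (\<lambda>z. z \<circ> \<pi>)) (PiE {..<n} A) = (\<Prod>i<n. emeasure (segment_measure l) (A i))" .
  qed simp_all
qed

lemma L2_permute:
  assumes "\<pi> permutes {..<n}" "f \<in> L2 (cube n l)"
  shows "(\<lambda>z. f (z \<circ> \<pi>)) \<in> L2 (cube n l)" "L2_norm (cube n l) (\<lambda>z. f (z \<circ> \<pi>)) = L2_norm (cube n l) f"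
proof -
  note D = distr_cube_permute[OF assms(1), of l]
  note [measurable] = L2_borel[OF assms(2)]
  have sq: "(\<lambda>z. (cmod (f z))\<^sup>2) \<in> borel_measurable (cube n l)" by measurable
  have "integrable (distr (cube n l) (cube n l) (\<lambda>z. z \<circ> \<pi>)) (\<lambda>z. (cmod (f z))\<^sup>2)"
    unfolding D(1) by (rule L2_integrable[OF assms(2)])
  then have "integrable (cube n l) (\<lambda>z. (cmod (f (z \<circ> \<pi>)))\<^sup>2)"
    by (rule integrable_distr[OF D(2)])
  then show "(\<lambda>z. f (z \<circ> \<pi>)) \<in> L2 (cube n l)"
    by (intro L2I measurable_compose[OF D(2) L2_borel[OF assms(2)]])
  have "(LINT z|distr (cube n l) (cube n l) (\<lambda>z. z \<circ> \<pi>). (cmod (f z))\<^sup>2) = (LINT z|cube n l. (cmod (f (z \<circ> \<pi>)))\<^sup>2)"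
    by (rule integral_distr[OF D(2) sq])
  then show "L2_norm (cube n l) (\<lambda>z. f (z \<circ> \<pi>)) = L2_norm (cube n l) f"
    unfolding D(1) L2_norm_def by simp
qed

text \<open>The permuted sequence tends to the permuted limit, because permutations preserve the
  norm, and to \<open>f\<close>, because it agrees with \<open>F m\<close> almost everywhere; limits
  are unique up to null sets.\<close>

lemma symmetric_limit:
  assumes "L2_lim (cube n l) F f" "\<And>m. symmetric_on_cube n l (F m)"
  shows "symmetric_on_cube n l f"
  unfolding symmetric_on_cube_def
proof (intro allI impI)
  fix \<pi> assume \<pi>: "\<pi> permutes {..<n}"
  have F: "F m \<in> L2 (cube n l)" "f \<in> L2 (cube n l)" for m using assms(1) by (simp_all add: L2_lim_def)
  have "L2_lim (cube n l) (\<lambda>m z. F m (z \<circ> \<pi>)) (\<lambda>z. f (z \<circ> \<pi>))"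
    using assms(1) L2_permute[OF \<pi> F(1)] L2_permute[OF \<pi> F(2)] L2_permute(2)[OF \<pi> L2.diff[OF F]]
    by (simp add: L2_lim_def)
  moreover have "L2_lim (cube n l) (\<lambda>m z. F m (z \<circ> \<pi>)) f"
  proof (rule L2_lim_nearby[OF assms(1) L2_permute(1)[OF \<pi> F(1)]])
    fix m
    have "AE z in cube n l. F m (z \<circ> \<pi>) = F m z" using assms(2) \<pi> unfolding symmetric_on_cube_def by blast
    then have "AE z in cube n l. F m (z \<circ> \<pi>) - F m z = 0" by eventually_elim simp
    then show "L2_norm (cube n l) (\<lambda>z. F m (z \<circ> \<pi>) - F m z) \<le> 0"
      using L2_norm_eq_0_iff[OF L2.diff[OF L2_permute(1)[OF \<pi> F(1)[of m]] F(1)[of m]]] by simp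
  qed simp
  ultimately show "AE z in cube n l. f (z \<circ> \<pi>) = f z" by (rule L2_lim_unique)
qed

lemma symmetric_lincomb:
  assumes "symmetric_on_cube n l f" "symmetric_on_cube n l h"
  shows "symmetric_on_cube n l (\<lambda>z. f z + c * h z)"
  unfolding symmetric_on_cube_def
proof (intro allI impI)
  fix \<pi> assume "\<pi> permutes {..<n}"
  then have "AE z in cube n l. f (z \<circ> \<pi>) = f z" "AE z in cube n l. h (z \<circ> \<pi>) = h z"
    using assms unfolding symmetric_on_cube_def by auto
  then show "AE z in cube n l. f (z \<circ> \<pi>) + c * h (z \<circ> \<pi>) = f z + c * h z" by eventually_elim simp
qed


section \<open>The ground-state energy as the bottom of the form\<close>

lemma energy_form_lincomb_right:
  assumes l: "l > 0" and H: "\<phi> \<in> H10 n l" "\<psi> \<in> H10 n l" "\<zeta> \<in> H10 n l"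
  shows "energy_form n l g \<phi> (\<lambda>z. \<psi> z + c * \<zeta> z) = energy_form n l g \<phi> \<psi> + c * energy_form n l g \<phi> \<zeta>"
proof -
  let ?s = "\<lambda>z. \<psi> z + c * \<zeta> z"
  have s: "?s \<in> H10 n l" by (rule H10_lincomb(1)[OF l H(2,3)])
  have lin: "L2_inner M a h = L2_inner M a f + c * L2_inner M a k"
    if "AE z in M. f z + c * k z = h z" "a \<in> L2 M" "f \<in> L2 M" "k \<in> L2 M" "h \<in> L2 M" for M a f h k
  proof -
    have "L2_inner M a h = L2_inner M a (\<lambda>z. f z + c * k z)"
      by (rule L2_inner_cong_AE[OF that(2,2,5) L2_add[OF that(3) L2_scale[OF that(4)]]]) (use that(1) in auto)
    also have "\<dots> = L2_inner M a f + L2_inner M a (\<lambda>z. c * k z)"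
      by (rule L2.B_add_right[OF that(2,3) L2_scale[OF that(4)]])
    also have "L2_inner M a (\<lambda>z. c * k z) = c * L2_inner M a k" by (rule L2.B_scale_right[OF that(2,4)])
    finally show ?thesis .
  qed
  have 1: "L2_inner (cube n l) (weak_deriv n l i \<phi>) (weak_deriv n l i ?s) =
      L2_inner (cube n l) (weak_deriv n l i \<phi>) (weak_deriv n l i \<psi>) +
      c * L2_inner (cube n l) (weak_deriv n l i \<phi>) (weak_deriv n l i \<zeta>)" if i: "i < n" for i
    by (rule lin[OF H10_lincomb(2)[OF l H(2,3) i] weak_deriv_L2[OF H(1) i] weak_deriv_L2[OF H(2) i]
          weak_deriv_L2[OF H(3) i] weak_deriv_L2[OF s i]])
  have 2: "L2_inner (face n l k) (diag_trace n l i k \<phi>) (diag_trace n l i k ?s) =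
      L2_inner (face n l k) (diag_trace n l i k \<phi>) (diag_trace n l i k \<psi>) +
      c * L2_inner (face n l k) (diag_trace n l i k \<phi>) (diag_trace n l i k \<zeta>)" if k: "k < n" "i < n" "i \<noteq> k" for i k
    by (rule lin[OF H10_lincomb(3)[OF l H(2,3) k] diag_trace_L2[OF H(1) k l] diag_trace_L2[OF H(2) k l]
          diag_trace_L2[OF H(3) k l] diag_trace_L2[OF s k l]])
  have s1: "(\<Sum>i<n. L2_inner (cube n l) (weak_deriv n l i \<phi>) (weak_deriv n l i ?s)) =
      (\<Sum>i<n. L2_inner (cube n l) (weak_deriv n l i \<phi>) (weak_deriv n l i \<psi>)) +
      c * (\<Sum>i<n. L2_inner (cube n l) (weak_deriv n l i \<phi>) (weak_deriv n l i \<zeta>))"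
    unfolding sum_distrib_left sum.distrib[symmetric] by (rule sum.cong[OF refl]) (simp add: 1)
  have s2: "(\<Sum>k<n. \<Sum>i<k. L2_inner (face n l k) (diag_trace n l i k \<phi>) (diag_trace n l i k ?s)) =
      (\<Sum>k<n. \<Sum>i<k. L2_inner (face n l k) (diag_trace n l i k \<phi>) (diag_trace n l i k \<psi>)) +
      c * (\<Sum>k<n. \<Sum>i<k. L2_inner (face n l k) (diag_trace n l i k \<phi>) (diag_trace n l i k \<zeta>))"
    unfolding sum_distrib_left sum.distrib[symmetric] by (intro sum.cong refl 2) auto
  show ?thesis unfolding energy_form_def s1 s2 by (simp add: algebra_simps)
qed

lemma energy_form_herm:
  assumes l: "l > 0" and H: "\<phi> \<in> H10 n l" "\<psi> \<in> H10 n l"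
  shows "energy_form n l g \<psi> \<phi> = cnj (energy_form n l g \<phi> \<psi>)"
proof -
  have 1: "L2_inner (cube n l) (weak_deriv n l i \<psi>) (weak_deriv n l i \<phi>) =
      cnj (L2_inner (cube n l) (weak_deriv n l i \<phi>) (weak_deriv n l i \<psi>))" if "i < n" for i
    by (rule L2.B_herm[OF weak_deriv_L2[OF H(1) that] weak_deriv_L2[OF H(2) that]])
  have 2: "L2_inner (face n l k) (diag_trace n l i k \<psi>) (diag_trace n l i k \<phi>) =
      cnj (L2_inner (face n l k) (diag_trace n l i k \<phi>) (diag_trace n l i k \<psi>))" if k: "k < n" "i < n" "i \<noteq> k" for i k
    by (rule L2.B_herm[OF diag_trace_L2[OF H(1) k l] diag_trace_L2[OF H(2) k l]])
  have s1: "(\<Sum>i<n. L2_inner (cube n l) (weak_deriv n l i \<psi>) (weak_deriv n l i \<phi>)) =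
      (\<Sum>i<n. cnj (L2_inner (cube n l) (weak_deriv n l i \<phi>) (weak_deriv n l i \<psi>)))"
    by (rule sum.cong[OF refl]) (simp add: 1)
  have s2: "(\<Sum>k<n. \<Sum>i<k. L2_inner (face n l k) (diag_trace n l i k \<psi>) (diag_trace n l i k \<phi>)) =
      (\<Sum>k<n. \<Sum>i<k. cnj (L2_inner (face n l k) (diag_trace n l i k \<phi>) (diag_trace n l i k \<psi>)))"
    by (intro sum.cong refl 2) auto
  show ?thesis unfolding energy_form_def s1 s2 by simp
qed

definition energy :: "nat \<Rightarrow> real \<Rightarrow> real \<Rightarrow> ((nat \<Rightarrow> real) \<Rightarrow> complex) \<Rightarrow> real" where
  "energy n l g \<psi> = (\<Sum>i<n. (L2_norm (cube n l) (weak_deriv n l i \<psi>))\<^sup>2) +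
     g * (\<Sum>k<n. \<Sum>i<k. (L2_norm (face n l k) (diag_trace n l i k \<psi>))\<^sup>2)"

lemma Re_energy_form: "Re (energy_form n l g \<psi> \<psi>) = energy n l g \<psi>"
  by (simp add: energy_form_def energy_def L2_inner_self L2_norm_sq)

lemma energy_nonneg: "0 \<le> g \<Longrightarrow> 0 \<le> energy n l g \<psi>"
  unfolding energy_def by (intro add_nonneg_nonneg mult_nonneg_nonneg sum_nonneg) auto

lemma weak_deriv_le_energy:
  assumes "0 \<le> g" "i < n" shows "(L2_norm (cube n l) (weak_deriv n l i \<psi>))\<^sup>2 \<le> energy n l g \<psi>"
proof -
  have "(L2_norm (cube n l) (weak_deriv n l i \<psi>))\<^sup>2 \<le> (\<Sum>i<n. (L2_norm (cube n l) (weak_deriv n l i \<psi>))\<^sup>2)"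
    using assms(2) by (intro member_le_sum) auto
  moreover have "0 \<le> g * (\<Sum>k<n. \<Sum>i<k. (L2_norm (face n l k) (diag_trace n l i k \<psi>))\<^sup>2)"
    using assms(1) by (intro mult_nonneg_nonneg sum_nonneg) auto
  ultimately show ?thesis unfolding energy_def by linarith
qed

lemma form_domain_H10: "\<psi> \<in> form_domain n l \<Longrightarrow> \<psi> \<in> H10 n l"
  by (simp add: form_domain_def)

lemma form_domain_L2_sym: "\<psi> \<in> form_domain n l \<Longrightarrow> \<psi> \<in> L2_sym n l"
  by (simp add: form_domain_def L2_sym_def H10_L2)

lemma form_domain_lincomb:
  "l > 0 \<Longrightarrow> \<psi> \<in> form_domain n l \<Longrightarrow> \<zeta> \<in> form_domain n l \<Longrightarrow> (\<lambda>z. \<psi> z + c * \<zeta> z) \<in> form_domain n l"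
  using H10_lincomb(1) symmetric_lincomb unfolding form_domain_def by blast

lemma zero_form_domain: "l > 0 \<Longrightarrow> (\<lambda>_. 0) \<in> form_domain n l"
  by (simp add: form_domain_def zero_H10 symmetric_on_cube_def)

text \<open>The form of \<open>H - e\<close>. For \<open>e\<close> strictly below the form it is the
  inner product in which the resolvent equation becomes a Riesz representation problem.\<close>

definition shifted_form :: "nat \<Rightarrow> real \<Rightarrow> real \<Rightarrow> real \<Rightarrow> ((nat \<Rightarrow> real) \<Rightarrow> complex) \<Rightarrow>
    ((nat \<Rightarrow> real) \<Rightarrow> complex) \<Rightarrow> complex" where
  "shifted_form n l g e \<phi> \<psi> = energy_form n l g \<phi> \<psi> - of_real e * L2_inner (cube n l) \<phi> \<psi>"

lemma Re_shifted_form: "Re (shifted_form n l g e \<psi> \<psi>) = energy n l g \<psi> - e * (L2_norm (cube n l) \<psi>)\<^sup>2"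
  by (simp add: shifted_form_def Re_energy_form L2_inner_self L2_norm_sq)

lemma hermitian_shifted_form:
  assumes l: "l > 0" and e: "\<And>\<psi>. \<psi> \<in> form_domain n l \<Longrightarrow> e * (L2_norm (cube n l) \<psi>)\<^sup>2 \<le> energy n l g \<psi>"
  shows "hermitian_form (form_domain n l) (shifted_form n l g e)"
proof
  note D = form_domain_H10
  have lin: "shifted_form n l g e f (\<lambda>z. h z + c * k z) = shifted_form n l g e f h + c * shifted_form n l g e f k"
    if "f \<in> form_domain n l" "h \<in> form_domain n l" "k \<in> form_domain n l" for f h k c
    unfolding shifted_form_def energy_form_lincomb_right[OF l that[THEN D]]
      L2.B_add_right[OF H10_L2[OF D[OF that(1)]] H10_L2[OF D[OF that(2)]] L2_scale[OF H10_L2[OF D[OF that(3)]]]]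
      L2.B_scale_right[OF H10_L2[OF D[OF that(1)]] H10_L2[OF D[OF that(3)]]]
    by (simp add: algebra_simps)
  fix f h k :: "(nat \<Rightarrow> real) \<Rightarrow> complex" and c
  show "(\<lambda>_. 0) \<in> form_domain n l" by (rule zero_form_domain[OF l])
  assume f: "f \<in> form_domain n l"
  show "(\<lambda>z. c * f z) \<in> form_domain n l" using form_domain_lincomb[OF l zero_form_domain[OF l] f, of c] by simp
  show "0 \<le> Re (shifted_form n l g e f f)" using e[OF f] by (simp add: Re_shifted_form)
  assume h: "h \<in> form_domain n l"
  show "(\<lambda>z. f z + h z) \<in> form_domain n l" using form_domain_lincomb[OF l f h, of 1] by simp
  show "shifted_form n l g e h f = cnj (shifted_form n l g e f h)"
    unfolding shifted_form_def energy_form_herm[OF l D[OF f] D[OF h]] L2.B_herm[OF H10_L2[OF D[OF f]] H10_L2[OF D[OF h]]]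
    by simp
  have z: "shifted_form n l g e f (\<lambda>_. 0) = 0" using lin[OF f h h, of "-1"] lin[OF f h h, of "0"] lin[OF f zero_form_domain[OF l] h, of 0]
    lin[OF f zero_form_domain[OF l] zero_form_domain[OF l], of 1] by simp
  show "shifted_form n l g e f (\<lambda>z. c * h z) = c * shifted_form n l g e f h"
    using lin[OF f zero_form_domain[OF l] h, of c] z by simp
  assume k: "k \<in> form_domain n l"
  show "shifted_form n l g e f (\<lambda>z. h z + k z) = shifted_form n l g e f h + shifted_form n l g e f k"
    using lin[OF f h k, of 1] by simp
qed

lemma weak_deriv_diff:
  assumes "l > 0" "\<psi> \<in> H10 n l" "\<zeta> \<in> H10 n l" "i < n"
  shows "L2_norm (cube n l) (weak_deriv n l i (\<lambda>z. \<psi> z - \<zeta> z)) = L2_norm (cube n l) (\<lambda>z. weak_deriv n l i \<psi> z - weak_deriv n l i \<zeta> z)"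
proof (rule L2_norm_cong_AE[symmetric])
  show "AE z in cube n l. weak_deriv n l i \<psi> z - weak_deriv n l i \<zeta> z = weak_deriv n l i (\<lambda>z. \<psi> z - \<zeta> z) z"
    using H10_lincomb(2)[OF assms, of "-1"] by simp
  have "(\<lambda>z. \<psi> z - \<zeta> z) \<in> H10 n l" using H10_lincomb(1)[OF assms(1-3), of "-1"] by simp
  then show "weak_deriv n l i (\<lambda>z. \<psi> z - \<zeta> z) \<in> borel_measurable (cube n l)" by (rule L2_borel[OF weak_deriv_L2[OF _ assms(4)]])
  show "(\<lambda>z. weak_deriv n l i \<psi> z - weak_deriv n l i \<zeta> z) \<in> borel_measurable (cube n l)"
    by (rule L2_borel[OF L2.diff[OF weak_deriv_L2[OF assms(2,4)] weak_deriv_L2[OF assms(3,4)]]])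
qed

lemma diag_trace_diff:
  assumes "l > 0" "\<psi> \<in> H10 n l" "\<zeta> \<in> H10 n l" "k < n" "i < n" "i \<noteq> k"
  shows "L2_norm (face n l k) (diag_trace n l i k (\<lambda>z. \<psi> z - \<zeta> z)) = L2_norm (face n l k) (\<lambda>z. diag_trace n l i k \<psi> z - diag_trace n l i k \<zeta> z)"
proof (rule L2_norm_cong_AE[symmetric])
  show "AE z in face n l k. diag_trace n l i k \<psi> z - diag_trace n l i k \<zeta> z = diag_trace n l i k (\<lambda>z. \<psi> z - \<zeta> z) z"
    using H10_lincomb(3)[OF assms, of "-1"] by simp
  have "(\<lambda>z. \<psi> z - \<zeta> z) \<in> H10 n l" using H10_lincomb(1)[OF assms(1-3), of "-1"] by simp
  then show "diag_trace n l i k (\<lambda>z. \<psi> z - \<zeta> z) \<in> borel_measurable (face n l k)"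
    by (rule L2_borel[OF diag_trace_L2[OF _ assms(4-6,1)]])
  show "(\<lambda>z. diag_trace n l i k \<psi> z - diag_trace n l i k \<zeta> z) \<in> borel_measurable (face n l k)"
    by (rule L2_borel[OF L2.diff[OF diag_trace_L2[OF assms(2,4-6,1)] diag_trace_L2[OF assms(3,4-6,1)]]])
qed

text \<open>For \<open>e < \<mu>\<close> the shifted norm controls the L2 norm, with factor
  \<open>\<kappa> = 1 / (\<mu> - e)\<close> for the squares, hence also the unshifted energy and, as
  \<open>0 \<le> g\<close>, every weak derivative. A Cauchy sequence therefore satisfies the
  hypotheses of \<open>H10_complete\<close>, and symmetry survives the limit.\<close>

lemma form_domain_complete:
  assumes l: "l > 0" and g: "0 \<le> g"
    and lower: "\<And>\<psi>. \<psi> \<in> form_domain n l \<Longrightarrow> \<mu> * (L2_norm (cube n l) \<psi>)\<^sup>2 \<le> energy n l g \<psi>" and e: "e < \<mu>"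
    and c: "hermitian_form.cauchy (form_domain n l) (shifted_form n l g e) F"
  shows "\<exists>f. hermitian_form.conv (form_domain n l) (shifted_form n l g e) F f"
proof -
  let ?N = "L2_norm (cube n l)"
  have low: "e * (?N \<psi>)\<^sup>2 \<le> energy n l g \<psi>" if "\<psi> \<in> form_domain n l" for \<psi>
    using lower[OF that] mult_right_mono[OF less_imp_le[OF e], of "(?N \<psi>)\<^sup>2"] by simp
  interpret S: hermitian_form "form_domain n l" "shifted_form n l g e" by (rule hermitian_shifted_form[OF l low])
  have F: "F m \<in> form_domain n l" for m using c by (simp add: S.cauchy_def)
  have cau: "\<exists>N. \<forall>m\<ge>N. \<forall>m'\<ge>N. S.nrm (\<lambda>z. F m z - F m' z) < r" if "r > 0" for r
    using c that by (simp add: S.cauchy_def)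
  have sq: "(S.nrm \<psi>)\<^sup>2 = energy n l g \<psi> - e * (?N \<psi>)\<^sup>2" if "\<psi> \<in> form_domain n l" for \<psi>
    using S.nrm_sq[OF that] by (simp add: Re_shifted_form)
  define \<kappa> where "\<kappa> = 1 / (\<mu> - e)"
  have \<kappa>: "\<kappa> > 0" using e by (simp add: \<kappa>_def)
  have N_le: "(?N \<psi>)\<^sup>2 \<le> \<kappa> * (S.nrm \<psi>)\<^sup>2" if "\<psi> \<in> form_domain n l" for \<psi>
    using lower[OF that] sq[OF that] e by (simp add: \<kappa>_def field_simps)
  have E_le: "energy n l g \<psi> \<le> (1 + \<bar>e\<bar> * \<kappa>) * (S.nrm \<psi>)\<^sup>2" if "\<psi> \<in> form_domain n l" for \<psi>
  proof -
    have "energy n l g \<psi> = (S.nrm \<psi>)\<^sup>2 + e * (?N \<psi>)\<^sup>2" using sq[OF that] by simp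
    also have "e * (?N \<psi>)\<^sup>2 \<le> \<bar>e\<bar> * (?N \<psi>)\<^sup>2" by (intro mult_right_mono) auto
    also have "\<dots> \<le> \<bar>e\<bar> * (\<kappa> * (S.nrm \<psi>)\<^sup>2)" by (intro mult_left_mono N_le that) simp
    finally show ?thesis by (simp add: algebra_simps)
  qed
  have cauchyI: "hermitian_form.cauchy (L2 (cube n l)) (L2_inner (cube n l)) G"
    if "\<And>m. G m \<in> L2 (cube n l)" "0 \<le> C"
      "\<And>m m'. (?N (\<lambda>z. G m z - G m' z))\<^sup>2 \<le> C * (S.nrm (\<lambda>z. F m z - F m' z))\<^sup>2" for G C
    unfolding L2.cauchy_def
  proof (intro conjI allI impI that(1))
    fix r :: real assume r: "r > 0"
    then have "r / (sqrt C + 1) > 0" using that(2) by (intro divide_pos_pos add_nonneg_pos) auto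
    then obtain N where N: "\<And>m m'. m \<ge> N \<Longrightarrow> m' \<ge> N \<Longrightarrow> S.nrm (\<lambda>z. F m z - F m' z) < r / (sqrt C + 1)"
      using cau by blast
    show "\<exists>N. \<forall>m\<ge>N. \<forall>m'\<ge>N. ?N (\<lambda>z. G m z - G m' z) < r"
    proof (intro exI[of _ N] allI impI)
      fix m m' assume mm: "m \<ge> N" "m' \<ge> N"
      let ?s = "S.nrm (\<lambda>z. F m z - F m' z)"
      have s: "0 \<le> ?s" by (rule S.nrm_ge0[OF S.diff[OF F F]])
      have "(?N (\<lambda>z. G m z - G m' z))\<^sup>2 \<le> (sqrt C * ?s)\<^sup>2" using that(2,3) by (simp add: power_mult_distrib)
      then have "?N (\<lambda>z. G m z - G m' z) \<le> sqrt C * ?s" by (rule power2_le_imp_le) (use s that(2) in simp)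
      also have "\<dots> \<le> (sqrt C + 1) * ?s" using s by (intro mult_right_mono) auto
      also have "\<dots> < r" using N[OF mm] that(2) by (simp add: pos_less_divide_eq add_nonneg_pos mult.commute)
      finally show "?N (\<lambda>z. G m z - G m' z) < r" .
    qed
  qed
  note FH = form_domain_H10[OF F]
  have c1: "hermitian_form.cauchy (L2 (cube n l)) (L2_inner (cube n l)) F"
    by (rule cauchyI[OF H10_L2[OF FH] less_imp_le[OF \<kappa>] N_le[OF S.diff[OF F F]]])
  have c2: "hermitian_form.cauchy (L2 (cube n l)) (L2_inner (cube n l)) (\<lambda>m. weak_deriv n l i (F m))" if i: "i < n" for i
  proof (rule cauchyI[where C = "1 + \<bar>e\<bar> * \<kappa>"])
    show "weak_deriv n l i (F m) \<in> L2 (cube n l)" for m by (rule weak_deriv_L2[OF FH i])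
    show "0 \<le> 1 + \<bar>e\<bar> * \<kappa>" using \<kappa> by simp
    fix m m'
    have "(?N (\<lambda>z. weak_deriv n l i (F m) z - weak_deriv n l i (F m') z))\<^sup>2 \<le> energy n l g (\<lambda>z. F m z - F m' z)"
      unfolding weak_deriv_diff[OF l FH FH i, symmetric] by (rule weak_deriv_le_energy[OF g i])
    also have "\<dots> \<le> (1 + \<bar>e\<bar> * \<kappa>) * (S.nrm (\<lambda>z. F m z - F m' z))\<^sup>2" by (rule E_le[OF S.diff[OF F F]])
    finally show "(?N (\<lambda>z. weak_deriv n l i (F m) z - weak_deriv n l i (F m') z))\<^sup>2 \<le> \<dots>" .
  qed
  obtain \<zeta> where \<zeta>: "\<zeta> \<in> H10 n l" "L2_lim (cube n l) F \<zeta>"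
    "\<And>i. i < n \<Longrightarrow> L2_lim (cube n l) (\<lambda>m. weak_deriv n l i (F m)) (weak_deriv n l i \<zeta>)"
    "\<And>k i. k < n \<Longrightarrow> i < n \<Longrightarrow> i \<noteq> k \<Longrightarrow> L2_lim (face n l k) (\<lambda>m. diag_trace n l i k (F m)) (diag_trace n l i k \<zeta>)"
    using H10_complete[OF l FH c1 c2] by blast
  have \<zeta>D: "\<zeta> \<in> form_domain n l"
    using \<zeta>(1) symmetric_limit[OF \<zeta>(2)] F by (simp add: form_domain_def)
  have "(\<lambda>m. energy n l g (\<lambda>z. F m z - \<zeta> z) - e * (?N (\<lambda>z. F m z - \<zeta> z))\<^sup>2) \<longlonglongrightarrow> 
      ((\<Sum>i<n. 0\<^sup>2) + g * (\<Sum>k<n. \<Sum>i<k. 0\<^sup>2)) - e * 0\<^sup>2"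
    unfolding energy_def
  proof (intro tendsto_diff tendsto_add tendsto_mult tendsto_const tendsto_sum tendsto_power)
    show "(\<lambda>m. ?N (\<lambda>z. F m z - \<zeta> z)) \<longlonglongrightarrow> 0" using \<zeta>(2) by (simp add: L2_lim_def)
    show "(\<lambda>m. ?N (weak_deriv n l i (\<lambda>z. F m z - \<zeta> z))) \<longlonglongrightarrow> 0" if "i \<in> {..<n}" for i
      using \<zeta>(3)[of i] that weak_deriv_diff[OF l FH \<zeta>(1), of i] by (simp add: L2_lim_def)
    show "(\<lambda>m. L2_norm (face n l k) (diag_trace n l i k (\<lambda>z. F m z - \<zeta> z))) \<longlonglongrightarrow> 0"
      if "k \<in> {..<n}" "i \<in> {..<k}" for i k
      using \<zeta>(4)[of k i] that diag_trace_diff[OF l FH \<zeta>(1), of k i] by (simp add: L2_lim_def)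
  qed
  then have "(\<lambda>m. (S.nrm (\<lambda>z. F m z - \<zeta> z))\<^sup>2) \<longlonglongrightarrow> 0"
    using sq[OF S.diff[OF F \<zeta>D]] by simp
  then have "(\<lambda>m. sqrt ((S.nrm (\<lambda>z. F m z - \<zeta> z))\<^sup>2)) \<longlonglongrightarrow> sqrt 0" by (rule tendsto_real_sqrt)
  then have "(\<lambda>m. S.nrm (\<lambda>z. F m z - \<zeta> z)) \<longlonglongrightarrow> 0"
    using S.nrm_ge0[OF S.diff[OF F \<zeta>D]] by simp
  then have "S.conv F \<zeta>" unfolding S.conv_def using F \<zeta>D by simp
  then show "\<exists>f. S.conv F f" by (intro exI[of _ "\<zeta>"])
qed

text \<open>The gap \<open>\<mu> - e\<close> does everything: it gives injectivity, the boundedness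
  of the functional that Riesz represents, and the bound \<open>1 / (\<mu> - e)\<close> for the
  inverse.\<close>

lemma resolvent_below_form:
  assumes l: "l > 0" and g: "0 \<le> g"
    and lower: "\<And>\<psi>. \<psi> \<in> form_domain n l \<Longrightarrow> \<mu> * (L2_norm (cube n l) \<psi>)\<^sup>2 \<le> energy n l g \<psi>" and e: "e < \<mu>"
  shows "complex_of_real e \<in> resolvent_set n l g"
proof -
  let ?N = "L2_norm (cube n l)"
  have low: "e * (?N \<psi>)\<^sup>2 \<le> energy n l g \<psi>" if "\<psi> \<in> form_domain n l" for \<psi>
    using lower[OF that] mult_right_mono[OF less_imp_le[OF e], of "(?N \<psi>)\<^sup>2"] by simp
  interpret S: hermitian_form "form_domain n l" "shifted_form n l g e" by (rule hermitian_shifted_form[OF l low])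
  have gap: "(\<mu> - e) * (?N \<psi>)\<^sup>2 \<le> Re (shifted_form n l g e \<psi> \<psi>)" if "\<psi> \<in> form_domain n l" for \<psi>
    using lower[OF that] by (simp add: Re_shifted_form algebra_simps)
  have "AE z in cube n l. \<psi> z = 0" if h: "hamiltonian n l g \<psi> (\<lambda>z. of_real e * \<psi> z)" for \<psi>
  proof -
    have \<psi>: "\<psi> \<in> form_domain n l" and "energy_form n l g \<psi> \<psi> = L2_inner (cube n l) \<psi> (\<lambda>z. of_real e * \<psi> z)"
      using h unfolding hamiltonian_def by auto
    then have "shifted_form n l g e \<psi> \<psi> = 0"
      unfolding shifted_form_def using L2.B_scale_right[OF H10_L2[OF form_domain_H10[OF \<psi>]] H10_L2[OF form_domain_H10[OF \<psi>]]] by simp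
    then have "(\<mu> - e) * (?N \<psi>)\<^sup>2 \<le> 0" using gap[OF \<psi>] by simp
    then have "(?N \<psi>)\<^sup>2 \<le> 0" using e by (simp add: mult_le_0_iff)
    then have "?N \<psi> = 0" by simp
    then show ?thesis using L2_norm_eq_0_iff[OF H10_L2[OF form_domain_H10[OF \<psi>]]] by simp
  qed
  moreover have "\<exists>\<psi>. hamiltonian n l g \<psi> (\<lambda>z. of_real e * \<psi> z + f z) \<and> ?N \<psi> \<le> 1 / (\<mu> - e) * ?N f"
    if f: "f \<in> L2_sym n l" for f
  proof -
    have fL: "f \<in> L2 (cube n l)" using f by (simp add: L2_sym_def)
    have DL: "\<phi> \<in> L2 (cube n l)" if "\<phi> \<in> form_domain n l" for \<phi> by (rule H10_L2[OF form_domain_H10[OF that]])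
    have "\<exists>u\<in>form_domain n l. \<forall>\<phi>\<in>form_domain n l. shifted_form n l g e \<phi> u = L2_inner (cube n l) \<phi> f"
    proof (rule S.riesz[where C = "?N f / sqrt (\<mu> - e)"])
      show "\<exists>f. S.conv F f" if "S.cauchy F" for F by (rule form_domain_complete[OF l g lower e that])
      show "L2_inner (cube n l) (\<lambda>z. a z + b z) f = L2_inner (cube n l) a f + L2_inner (cube n l) b f"
        if "a \<in> form_domain n l" "b \<in> form_domain n l" for a b
        by (rule L2.B_add_left[OF DL[OF that(1)] DL[OF that(2)] fL])
      show "L2_inner (cube n l) (\<lambda>z. c * a z) f = cnj c * L2_inner (cube n l) a f" if "a \<in> form_domain n l" for a c
        by (rule L2.B_scale_left[OF DL[OF that] fL])
      show "cmod (L2_inner (cube n l) a f) \<le> ?N f / sqrt (\<mu> - e) * S.nrm a" if a: "a \<in> form_domain n l" for a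
      proof -
        have "sqrt (\<mu> - e) * ?N a \<le> S.nrm a"
          unfolding S.nrm_def using gap[OF a] e by (intro real_le_rsqrt) (simp add: power_mult_distrib)
        then have "?N a \<le> S.nrm a / sqrt (\<mu> - e)" using e by (simp add: pos_le_divide_eq mult.commute)
        then have "?N a * ?N f \<le> S.nrm a / sqrt (\<mu> - e) * ?N f" by (rule mult_right_mono) (rule L2_norm_nonneg)
        with L2.Cauchy_Schwarz[OF DL[OF a] fL] show ?thesis by (simp add: mult.commute)
      qed
    qed
    then obtain u where u: "u \<in> form_domain n l" "\<And>\<phi>. \<phi> \<in> form_domain n l \<Longrightarrow> shifted_form n l g e \<phi> u = L2_inner (cube n l) \<phi> f"
      by blast
    have "hamiltonian n l g u (\<lambda>z. of_real e * u z + f z)"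
      unfolding hamiltonian_def
    proof (intro conjI ballI u(1))
      have "symmetric_on_cube n l (\<lambda>z. f z + of_real e * u z)"
        using f u(1) by (intro symmetric_lincomb) (simp_all add: L2_sym_def form_domain_def)
      then show "(\<lambda>z. of_real e * u z + f z) \<in> L2_sym n l"
        using L2_add[OF L2_scale[OF DL[OF u(1)], of "of_real e"] fL] by (simp add: L2_sym_def add.commute)
      fix \<phi> assume \<phi>: "\<phi> \<in> form_domain n l"
      show "energy_form n l g \<phi> u = L2_inner (cube n l) \<phi> (\<lambda>z. of_real e * u z + f z)"
        using u(2)[OF \<phi>] unfolding shifted_form_def L2.B_add_right[OF DL[OF \<phi>] L2_scale[OF DL[OF u(1)]] fL]
          L2.B_scale_right[OF DL[OF \<phi>] DL[OF u(1)]] by (simp add: algebra_simps)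
    qed
    moreover have "?N u \<le> 1 / (\<mu> - e) * ?N f"
    proof (cases "?N u = 0")
      case True then show ?thesis using e by (simp add: L2_norm_nonneg)
    next
      case False
      then have pos: "?N u > 0" using L2_norm_nonneg[of "cube n l" u] by linarith
      have "(\<mu> - e) * (?N u)\<^sup>2 \<le> Re (L2_inner (cube n l) u f)" using gap[OF u(1)] u(2)[OF u(1)] by simp
      also have "\<dots> \<le> ?N u * ?N f" using L2.Cauchy_Schwarz[OF DL[OF u(1)] fL] complex_Re_le_cmod order_trans by blast
      finally have "?N u * ((\<mu> - e) * ?N u) \<le> ?N u * ?N f" by (simp add: power2_eq_square algebra_simps)
      then have "(\<mu> - e) * ?N u \<le> ?N f" using pos by simp
      then show ?thesis using e by (simp add: field_simps)
    qed
    ultimately show ?thesis by blast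
  qed
  ultimately show ?thesis unfolding resolvent_set_def by blast
qed

definition form_bottom :: "nat \<Rightarrow> real \<Rightarrow> real \<Rightarrow> real" where
  "form_bottom n l g = Inf {energy n l g \<psi> |\<psi>. \<psi> \<in> form_domain n l \<and> L2_norm (cube n l) \<psi> = 1}"

lemma energy_scale:
  assumes l: "l > 0" and "\<psi> \<in> H10 n l"
  shows "energy n l g (\<lambda>z. c * \<psi> z) = (cmod c)\<^sup>2 * energy n l g \<psi>"
proof -
  have z: "(\<lambda>_. 0) \<in> H10 n l" by (rule zero_H10[OF l])
  have z0: "energy_form n l g \<phi> (\<lambda>_. 0) = 0" if "\<phi> \<in> H10 n l" for \<phi>
    using energy_form_lincomb_right[OF l that z z, of g 1] by simp
  have r: "energy_form n l g \<phi> (\<lambda>z. c * \<psi> z) = c * energy_form n l g \<phi> \<psi>" if "\<phi> \<in> H10 n l" for \<phi>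
    using energy_form_lincomb_right[OF l that z assms(2), of g c] z0[OF that] by simp
  have s: "(\<lambda>z. c * \<psi> z) \<in> H10 n l" by (rule H10_scale[OF assms])
  have "energy_form n l g (\<lambda>z. c * \<psi> z) (\<lambda>z. c * \<psi> z) = c * cnj (c * energy_form n l g \<psi> \<psi>)"
    unfolding r[OF s] energy_form_herm[OF l assms(2) s] r[OF assms(2)] ..
  also have "\<dots> = of_real ((cmod c)\<^sup>2) * cnj (energy_form n l g \<psi> \<psi>)"
    using complex_norm_square[of c] by (simp add: mult.assoc)
  finally show ?thesis unfolding Re_energy_form[symmetric] by simp
qed

lemma form_bottom_lower:
  assumes l: "l > 0" and g: "0 \<le> g" and \<psi>: "\<psi> \<in> form_domain n l"
  shows "form_bottom n l g * (L2_norm (cube n l) \<psi>)\<^sup>2 \<le> energy n l g \<psi>"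
proof (cases "L2_norm (cube n l) \<psi> = 0")
  case True then show ?thesis using energy_nonneg[OF g] by simp
next
  case False
  let ?N = "L2_norm (cube n l)"
  have pos: "?N \<psi> > 0" using False L2_norm_nonneg[of "cube n l" \<psi>] by linarith
  let ?\<phi> = "\<lambda>z. of_real (1 / ?N \<psi>) * \<psi> z"
  have \<phi>: "?\<phi> \<in> form_domain n l" using form_domain_lincomb[OF l zero_form_domain[OF l] \<psi>, of "of_real (1 / ?N \<psi>)"] by simp
  have "?N ?\<phi> = 1" using L2.nrm_scale[OF H10_L2[OF form_domain_H10[OF \<psi>]], of "of_real (1 / ?N \<psi>)"] pos by (simp add: norm_divide)
  then have "form_bottom n l g \<le> energy n l g ?\<phi>"
    unfolding form_bottom_def using \<phi> energy_nonneg[OF g]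
    by (intro cInf_lower bdd_belowI[of _ 0]) auto
  also have "\<dots> = energy n l g \<psi> / (?N \<psi>)\<^sup>2"
    unfolding energy_scale[OF l form_domain_H10[OF \<psi>]] using pos by (simp add: power_divide norm_divide)
  finally show ?thesis using pos by (simp add: field_simps)
qed

text \<open>If \<open>H - m\<close> had an inverse of norm \<open>C\<close>, then testing \<open>u = (H - m)\<^sup>-\<^sup>1 \<psi>\<close> against a unit vector \<open>\<psi>\<close> and
  the Cauchy--Schwarz inequality for the form of \<open>H - m\<close> would give \<open>energy \<psi> \<ge> m + 1 / C\<close>.\<close>
lemma form_bottom_in_spectrum:
  assumes l: "l > 0" and g: "0 \<le> g" and ne: "\<psi>0 \<in> form_domain n l" "L2_norm (cube n l) \<psi>0 = 1"
  shows "complex_of_real (form_bottom n l g) \<in> spectrum n l g"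
proof (rule ccontr)
  let ?N = "L2_norm (cube n l)" and ?m = "form_bottom n l g"
  assume "\<not> ?thesis"
  then have "complex_of_real ?m \<in> resolvent_set n l g" by (simp add: spectrum_def)
  then obtain C where C: "\<And>f. f \<in> L2_sym n l \<Longrightarrow>
      \<exists>\<psi>. hamiltonian n l g \<psi> (\<lambda>z. of_real ?m * \<psi> z + f z) \<and> ?N \<psi> \<le> C * ?N f"
    unfolding resolvent_set_def by blast
  interpret S: hermitian_form "form_domain n l" "shifted_form n l g ?m"
    by (rule hermitian_shifted_form[OF l form_bottom_lower[OF l g]])
  have gap: "1 \<le> (energy n l g \<psi> - ?m) * C" if \<psi>: "\<psi> \<in> form_domain n l" "?N \<psi> = 1" for \<psi>
  proof -
    obtain u where u: "hamiltonian n l g u (\<lambda>z. of_real ?m * u z + \<psi> z)" "?N u \<le> C * ?N \<psi>"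
      using C[OF form_domain_L2_sym[OF \<psi>(1)]] by blast
    have uD: "u \<in> form_domain n l" using u(1) by (simp add: hamiltonian_def)
    have L: "u \<in> L2 (cube n l)" "\<psi> \<in> L2 (cube n l)"
      using H10_L2[OF form_domain_H10[OF uD]] H10_L2[OF form_domain_H10[OF \<psi>(1)]] .
    have eq: "shifted_form n l g ?m \<phi> u = L2_inner (cube n l) \<phi> \<psi>" if \<phi>: "\<phi> \<in> form_domain n l" for \<phi>
    proof -
      have "\<phi> \<in> L2 (cube n l)" by (rule H10_L2[OF form_domain_H10[OF \<phi>]])
      then have "L2_inner (cube n l) \<phi> (\<lambda>z. of_real ?m * u z + \<psi> z) = of_real ?m * L2_inner (cube n l) \<phi> u + L2_inner (cube n l) \<phi> \<psi>"
        using L2.B_add_right[OF _ L2_scale[OF L(1)] L(2)] L2.B_scale_right[OF _ L(1)] by simp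
      moreover have "energy_form n l g \<phi> u = L2_inner (cube n l) \<phi> (\<lambda>z. of_real ?m * u z + \<psi> z)"
        using u(1) \<phi> unfolding hamiltonian_def by blast
      ultimately show ?thesis unfolding shifted_form_def by simp
    qed
    have one: "L2_inner (cube n l) \<psi> \<psi> = 1" using \<psi>(2) unfolding L2_inner_self L2_norm_sq[symmetric] by simp
    have "1 = (cmod (shifted_form n l g ?m \<psi> u))\<^sup>2" unfolding eq[OF \<psi>(1)] one by simp
    also have "\<dots> \<le> Re (shifted_form n l g ?m \<psi> \<psi>) * Re (shifted_form n l g ?m u u)"
      by (rule S.Cauchy_Schwarz_sq[OF \<psi>(1) uD])
    also have "Re (shifted_form n l g ?m \<psi> \<psi>) = energy n l g \<psi> - ?m" using \<psi>(2) by (simp add: Re_shifted_form)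
    also have "(energy n l g \<psi> - ?m) * Re (shifted_form n l g ?m u u) \<le> (energy n l g \<psi> - ?m) * C"
    proof (rule mult_left_mono)
      have "Re (shifted_form n l g ?m u u) \<le> ?N u * ?N \<psi>"
        unfolding eq[OF uD] using L2.Cauchy_Schwarz[OF L] complex_Re_le_cmod order_trans by blast
      then show "Re (shifted_form n l g ?m u u) \<le> C" using u(2) \<psi>(2) by simp
      show "0 \<le> energy n l g \<psi> - ?m" using form_bottom_lower[OF l g \<psi>(1)] \<psi>(2) by simp
    qed
    finally show ?thesis .
  qed
  have C0: "C > 0"
  proof (rule ccontr)
    assume "\<not> C > 0"
    then have "(energy n l g \<psi>0 - ?m) * C \<le> 0"
      using form_bottom_lower[OF l g ne(1)] ne(2) by (intro mult_nonneg_nonpos) auto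
    then show False using gap[OF ne] by simp
  qed
  have "?m + 1 / C \<le> ?m"
    unfolding form_bottom_def[of n l g]
  proof (rule cInf_greatest)
    show "{energy n l g \<psi> |\<psi>. \<psi> \<in> form_domain n l \<and> ?N \<psi> = 1} \<noteq> {}" using ne by blast
    fix x assume "x \<in> {energy n l g \<psi> |\<psi>. \<psi> \<in> form_domain n l \<and> ?N \<psi> = 1}"
    then obtain \<psi> where "x = energy n l g \<psi>" "\<psi> \<in> form_domain n l" "?N \<psi> = 1" by blast
    then have "1 \<le> (x - ?m) * C" using gap by simp
    then show "Inf {energy n l g \<psi> |\<psi>. \<psi> \<in> form_domain n l \<and> ?N \<psi> = 1} + 1 / C \<le> x"
      using C0 unfolding form_bottom_def by (simp add: field_simps)
  qed
  then show False using C0 by simp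
qed

text \<open>The infimum of the real spectrum is attained at \<open>form_bottom\<close>, with nothing
  below it. A domain function of nonzero norm is demanded because otherwise
  \<open>form_bottom\<close> would be the infimum of the empty set; \<open>trial_function\<close>
  supplies one later.\<close>

lemma E0_QM_eq_form_bottom:
  assumes "n > 0" and l: "l > 0" and g: "0 \<le> g" and ne: "\<psi>0 \<in> form_domain n l" "L2_norm (cube n l) \<psi>0 \<noteq> 0"
  shows "E0_QM n l g = form_bottom n l g"
proof -
  let ?N = "L2_norm (cube n l)"
  let ?\<phi> = "\<lambda>z. of_real (1 / ?N \<psi>0) * \<psi>0 z"
  have \<phi>: "?\<phi> \<in> form_domain n l" using form_domain_lincomb[OF l zero_form_domain[OF l] ne(1), of "of_real (1 / ?N \<psi>0)"] by simp
  have \<phi>1: "?N ?\<phi> = 1"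
    using L2.nrm_scale[OF H10_L2[OF form_domain_H10[OF ne(1)]], of "of_real (1 / ?N \<psi>0)"] ne(2)
      L2_norm_nonneg[of "cube n l" \<psi>0] by (simp add: norm_divide)
  have "Inf {e. complex_of_real e \<in> spectrum n l g} = form_bottom n l g"
  proof (rule cInf_eq_minimum)
    show "form_bottom n l g \<in> {e. complex_of_real e \<in> spectrum n l g}"
      using form_bottom_in_spectrum[OF l g \<phi> \<phi>1] by simp
    fix e assume "e \<in> {e. complex_of_real e \<in> spectrum n l g}"
    then have "complex_of_real e \<notin> resolvent_set n l g" by (simp add: spectrum_def)
    then show "form_bottom n l g \<le> e"
      using resolvent_below_form[OF l g form_bottom_lower[OF l g], of n e] by force
  qed
  then show ?thesis using assms(1) by (simp add: E0_QM_def)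
qed


section \<open>Bounds on the energies\<close>

text \<open>The energy with classical derivatives and literal restrictions to the diagonals, so that
  estimates for test functions avoid the representatives chosen by \<open>weak_deriv\<close> and
  \<open>diag_trace\<close>.\<close>

definition test_energy :: "nat \<Rightarrow> real \<Rightarrow> real \<Rightarrow> ((nat \<Rightarrow> real) \<Rightarrow> complex) \<Rightarrow> real" where
  "test_energy n l g \<phi> = (\<Sum>i<n. (L2_norm (cube n l) (partial_deriv i \<phi>))\<^sup>2) +
     g * (\<Sum>k<n. \<Sum>i<k. (L2_norm (face n l k) (diag_restr i k \<phi>))\<^sup>2)"

lemma test_energy_tendsto:
  assumes "test_approx n l \<Phi> \<psi>" "l > 0"
  shows "(\<lambda>m. test_energy n l g (\<Phi> m)) \<longlonglongrightarrow> energy n l g \<psi>"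
  unfolding test_energy_def energy_def
proof (intro tendsto_add tendsto_mult tendsto_const tendsto_sum tendsto_power)
  fix i assume "i \<in> {..<n}"
  then show "(\<lambda>m. L2_norm (cube n l) (partial_deriv i (\<Phi> m))) \<longlonglongrightarrow> L2_norm (cube n l) (weak_deriv n l i \<psi>)"
    by (intro L2.conv_nrm test_approxD(3)[OF assms(1)]) simp
next
  fix k i assume "k \<in> {..<n}" "i \<in> {..<k}"
  then show "(\<lambda>m. L2_norm (face n l k) (diag_restr i k (\<Phi> m))) \<longlonglongrightarrow> L2_norm (face n l k) (diag_trace n l i k \<psi>)"
    by (intro L2.conv_nrm diag_trace_lim[OF assms(1)]) (use assms(2) in auto)
qed

lemma energy_test:
  assumes "test_function n l \<phi>" "l > 0" shows "energy n l g \<phi> = test_energy n l g \<phi>"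
  using test_energy_tendsto[OF test_approx_const(1)[OF assms(2,1)] assms(2), of g] by (simp add: LIMSEQ_const_iff)

text \<open>The bound is demanded for all test functions, since the ones that approximate a
  symmetric \<psi> need not be symmetric.\<close>

lemma energy_lower_from_tests:
  assumes "l > 0" "\<psi> \<in> H10 n l"
    and "\<And>\<phi>. test_function n l \<phi> \<Longrightarrow> \<mu> * (L2_norm (cube n l) \<phi>)\<^sup>2 \<le> test_energy n l g \<phi>"
  shows "\<mu> * (L2_norm (cube n l) \<psi>)\<^sup>2 \<le> energy n l g \<psi>"
proof -
  obtain \<Phi> where a: "test_approx n l \<Phi> \<psi>" using assms(2) by (rule H10_test_approx)
  have "(\<lambda>m. \<mu> * (L2_norm (cube n l) (\<Phi> m))\<^sup>2) \<longlonglongrightarrow> \<mu> * (L2_norm (cube n l) \<psi>)\<^sup>2"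
    by (intro tendsto_mult tendsto_const tendsto_power L2.conv_nrm test_approxD(2)[OF a])
  then show ?thesis
    by (rule LIMSEQ_le[OF _ test_energy_tendsto[OF a assms(1)]]) (simp add: assms(3)[OF test_approxD(1)[OF a]])
qed

section \<open>Upper bound on the energy by smooth product states\<close>

lemma square_le_exp: "0 \<le> w \<Longrightarrow> w\<^sup>2 \<le> exp (w::real)"
proof -
  assume w: "0 \<le> w"
  have "w / 2 * 2 \<le> exp (w / 2 - 1) * exp 1"
    using exp_ge_add_one_self[of "w / 2 - 1"] exp_ge_add_one_self[of 1] w by (intro mult_mono) auto
  also have "\<dots> = exp (w / 2)" by (simp flip: exp_add)
  finally have "w\<^sup>2 \<le> (exp (w / 2))\<^sup>2" using w by (intro power_mono) auto
  also have "\<dots> = exp w" by (simp add: power2_eq_square flip: exp_add)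
  finally show ?thesis .
qed

text \<open>The derivative of \<open>exp (- c / s)\<close> is
  \<open>(c / s)\<^sup>2 * exp (- c / s) / c\<close>, at most \<open>1 / c\<close> by
  \<open>square_le_exp\<close>. The product rule gives two terms of opposite sign below this bound,
  so their difference obeys it as well.\<close>

lemma bump_deriv_bounded:
  assumes "c > 0"
  obtains \<beta>' where "\<And>t. (bump c a b has_real_derivative \<beta>' t) (at t)" "\<And>t. \<bar>\<beta>' t\<bar> \<le> 1 / c"
proof -
  define d where "d = poly_exp c (monom 1 2 * (smult c 1 - pderiv 1))"
  have d: "(poly_exp c 1 has_real_derivative d t) (at t)" for t unfolding d_def by (rule poly_exp_deriv[OF assms])
  have db: "0 \<le> d s \<and> d s \<le> 1 / c" for s
  proof (cases "s > 0")
    case True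
    have "d s = (c / s)\<^sup>2 / exp (c / s) / c" using True assms
      by (simp add: d_def poly_exp_def poly_monom exp_minus field_simps power2_eq_square)
    moreover have "(c / s)\<^sup>2 / exp (c / s) \<le> 1" using square_le_exp[of "c / s"] True assms by (simp add: divide_le_eq)
    then have "(c / s)\<^sup>2 / exp (c / s) / c \<le> 1 / c" by (rule divide_right_mono) (use assms in simp)
    moreover have "0 \<le> (c / s)\<^sup>2 / exp (c / s) / c" using assms by simp
    ultimately show ?thesis by simp
  qed (use assms in \<open>simp add: d_def poly_exp_def\<close>)
  have fb: "0 \<le> poly_exp c 1 s \<and> poly_exp c 1 s \<le> 1" for s using assms by (simp add: poly_exp_def)
  define \<beta>' where "\<beta>' t = d (t - a) * poly_exp c 1 (b - t) - poly_exp c 1 (t - a) * d (b - t)" for t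
  show thesis
  proof (rule that[of \<beta>'])
    fix t
    have 1: "((\<lambda>t. poly_exp c 1 (t - a)) has_real_derivative d (t - a) * 1) (at t)"
      by (rule DERIV_chain'[OF _ d]) (auto intro!: derivative_eq_intros)
    have 2: "((\<lambda>t. poly_exp c 1 (b - t)) has_real_derivative d (b - t) * (-1)) (at t)"
      by (rule DERIV_chain'[OF _ d]) (auto intro!: derivative_eq_intros)
    show "(bump c a b has_real_derivative \<beta>' t) (at t)"
      unfolding bump_def[abs_def] \<beta>'_def using DERIV_mult[OF 1 2] by (simp add: algebra_simps)
    have "d (t - a) * poly_exp c 1 (b - t) \<le> 1 / c * 1" using db fb assms by (intro mult_mono) auto
    moreover have "poly_exp c 1 (t - a) * d (b - t) \<le> 1 * (1 / c)" using db fb assms by (intro mult_mono) auto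
    moreover have "0 \<le> d (t - a) * poly_exp c 1 (b - t)" "0 \<le> poly_exp c 1 (t - a) * d (b - t)"
      using db fb by (auto intro!: mult_nonneg_nonneg)
    ultimately show "\<bar>\<beta>' t\<bar> \<le> 1 / c" unfolding \<beta>'_def by linarith
  qed
qed

lemma integral_product_cube:
  fixes f :: "nat \<Rightarrow> real \<Rightarrow> real"
  assumes "finite I" "\<And>i. i \<in> I \<Longrightarrow> integrable (segment_measure l) (f i)"
  shows "(LINT z|cube_measure I l. (\<Prod>i\<in>I. f i (z i))) = (\<Prod>i\<in>I. (LINT t|segment_measure l. f i t))"
    and "integrable (cube_measure I l) (\<lambda>z. \<Prod>i\<in>I. f i (z i))"
proof -
  show "(LINT z|cube_measure I l. (\<Prod>i\<in>I. f i (z i))) = (\<Prod>i\<in>I. (LINT t|segment_measure l. f i t))"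
    unfolding cube_measure_def by (rule cube.product_integral_prod[OF assms])
  show "integrable (cube_measure I l) (\<lambda>z. \<Prod>i\<in>I. f i (z i))"
    unfolding cube_measure_def by (rule cube.product_integrable_prod[OF assms])
qed

text \<open>The product of bumps supported in \<open>[l/8, 7l/8]\<close> with steepness
  \<open>l / 16\<close>. On the middle half both exponents are at least -1/2, so the bump is at
  least \<open>exp (-1) \<ge> 1/3\<close> there, whence \<open>A \<ge> (l / 2) / 9\<close>. Its
  derivative is at most \<open>16 / l\<close>, whose square integrates to \<open>256 / l\<close>;
  its values are at most 1, which bounds the traces. Being a test function, it needs no
  approximation.\<close>

lemma trial_function:
  assumes l: "l > 0"
  obtains \<psi> A where "A \<ge> l / 18" "\<psi> \<in> form_domain n l" "test_function n l \<psi>"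
    "(L2_norm (cube n l) \<psi>)\<^sup>2 = A ^ n"
    "\<And>i. i < n \<Longrightarrow> (L2_norm (cube n l) (partial_deriv i \<psi>))\<^sup>2 \<le> 256 / l * A ^ (n - 1)"
    "\<And>i k. k < n \<Longrightarrow> i < n \<Longrightarrow> i \<noteq> k \<Longrightarrow> (L2_norm (face n l k) (diag_restr i k \<psi>))\<^sup>2 \<le> A ^ (n - 1)"
proof -
  define \<beta> where "\<beta> = bump (l / 16) (l / 8) (7 * l / 8)"
  have c: "l / 16 > 0" using l by simp
  obtain \<beta>' where \<beta>': "\<And>t. (\<beta> has_real_derivative \<beta>' t) (at t)" "\<And>t. \<bar>\<beta>' t\<bar> \<le> 1 / (l / 16)"
    using bump_deriv_bounded[OF c, of "l / 8" "7 * l / 8"] unfolding \<beta>_def by metis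
  have r: "0 \<le> \<beta> t" "\<beta> t \<le> 1" for t using bump_range[OF c] unfolding \<beta>_def by auto
  have [measurable]: "\<beta> \<in> borel_measurable borel"
    using DERIV_isCont[OF \<beta>'(1)] by (intro borel_measurable_continuous_onI) (simp add: continuous_at_imp_continuous_on)
  have m: "\<beta> \<in> borel_measurable (segment_measure l)" by (intro measurable_restrict_space1) simp
  note [measurable] = m
  have i2: "integrable (segment_measure l) (\<lambda>t. (\<beta> t)\<^sup>2)"
    using r by (intro integrable_bounded[OF finite_measure_segment_measure, where C = 1]) (auto intro: power_le_one)
  define A where "A = (LINT t|segment_measure l. (\<beta> t)\<^sup>2)"
  define \<psi> where "\<psi> z = complex_of_real (\<Prod>i<n. \<beta> (z i))" for z :: "nat \<Rightarrow> real"
  have A0: "A \<ge> l / 18"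
  proof -
    have "(LINT t|segment_measure l. indicator {l/4..3*l/4} t * (1/9)) \<le> A"
      unfolding A_def
    proof (rule integral_mono[OF _ i2])
      show "integrable (segment_measure l) (\<lambda>t. indicator {l/4..3*l/4} t * (1/9::real))"
        by (intro integrable_bounded[OF finite_measure_segment_measure, where C = 1] measurable_restrict_space1) (auto simp: indicator_def)
      fix t
      show "indicator {l/4..3*l/4} t * (1/9) \<le> (\<beta> t)\<^sup>2"
      proof (cases "t \<in> {l/4..3*l/4}")
        case True
        have "- (l / 16) / (t - l / 8) \<ge> - (1/2)" "- (l / 16) / (7 * l / 8 - t) \<ge> - (1/2)"
          using True l by (auto simp: field_simps)
        then have "exp (- (1/2)) * exp (- (1/2)) \<le> \<beta> t"
          unfolding \<beta>_def bump_def poly_exp_def using True l by (auto intro!: mult_mono)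
        then have "exp (- 1) \<le> \<beta> t" by (simp flip: exp_add)
        moreover have "1 / 3 \<le> exp (- 1 :: real)" using exp_le by (simp add: exp_minus field_simps)
        ultimately have "(1/3)\<^sup>2 \<le> (\<beta> t)\<^sup>2" by (intro power_mono) auto
        then show ?thesis using True by (simp add: power2_eq_square)
      qed simp
    qed
    moreover have "(LINT t|segment_measure l. indicator {l/4..3*l/4} t * (1/9)) = l / 18"
    proof -
      have "(LINT t|segment_measure l. indicator {l/4..3*l/4} t * (1/9::real)) =
          (LINT t|lborel. indicator {0<..<l} t *\<^sub>R (indicator {l/4..3*l/4} t * (1/9)))"
        by (subst integral_restrict_space) auto
      also have "\<dots> = (LINT t|lborel. indicator {l/4..3*l/4} t * (1/9))"
        using l by (intro Bochner_Integration.integral_cong refl) (auto simp: indicator_def)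
      also have "\<dots> = l / 18" using l by simp
      finally show ?thesis .
    qed
    ultimately show ?thesis by simp
  qed
  have test: "test_function n l \<psi>"
    unfolding \<psi>_def
  proof (rule test_function_product[where a = "l / 8" and b = "7 * l / 8"])
    show "smooth1 \<beta>" unfolding \<beta>_def by (rule smooth1_bump[OF c])
    show "\<beta> t = 0" if "t \<notin> {l / 8..7 * l / 8}" for t unfolding \<beta>_def using that by (intro bump_zero) auto
  qed (use l in auto)
  have dom: "\<psi> \<in> form_domain n l"
    unfolding form_domain_def symmetric_on_cube_def
  proof (intro CollectI conjI allI impI test_approx_const(2)[OF l test] AE_I2)
    fix \<pi> z assume "\<pi> permutes {..<n}"
    from prod.permute[OF this, of "\<lambda>i. \<beta> (z i)"] show "\<psi> (z \<circ> \<pi>) = \<psi> z" by (simp add: \<psi>_def comp_def)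
  qed
  have norm: "(L2_norm (cube n l) \<psi>)\<^sup>2 = A ^ n"
  proof -
    have "(L2_norm (cube n l) \<psi>)\<^sup>2 = (LINT z|cube n l. (\<Prod>i<n. (\<beta> (z i))\<^sup>2))"
      unfolding L2_norm_sq \<psi>_def norm_of_real by (simp add: prod_power_distrib)
    also have "\<dots> = (\<Prod>i<n. A)" unfolding A_def by (rule integral_product_cube(1)[OF finite_lessThan i2])
    finally show ?thesis by simp
  qed
  have kin: "(L2_norm (cube n l) (partial_deriv i \<psi>))\<^sup>2 \<le> 256 / l * A ^ (n - 1)" if i: "i < n" for i
  proof -
    define f where "f j t = (if j = i then (16 / l)\<^sup>2 else (\<beta> t)\<^sup>2)" for j :: nat and t
    have fi: "integrable (segment_measure l) (f j)" for j unfolding f_def by (cases "j = i") (auto simp: i2)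
    have "(LINT z|cube n l. (cmod (partial_deriv i \<psi> z))\<^sup>2) \<le> (LINT z|cube n l. (\<Prod>j<n. f j (z j)))"
    proof (rule integral_mono[OF L2_integrable[OF test_function_L2(2)[OF test i]] integral_product_cube(2)[OF finite_lessThan fi]])
      fix z
      have "partial_deriv i \<psi> z = complex_of_real (\<beta>' (z i) * (\<Prod>j\<in>{..<n} - {i}. \<beta> (z j)))"
        unfolding \<psi>_def[abs_def] by (rule partial_deriv_product[OF i \<beta>'(1)])
      then have "(cmod (partial_deriv i \<psi> z))\<^sup>2 = (\<beta>' (z i))\<^sup>2 * (\<Prod>j\<in>{..<n} - {i}. (\<beta> (z j))\<^sup>2)"
        by (simp only: norm_of_real power2_abs power_mult_distrib prod_power_distrib)
      also have "\<dots> \<le> (16 / l)\<^sup>2 * (\<Prod>j\<in>{..<n} - {i}. (\<beta> (z j))\<^sup>2)"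
        using \<beta>'(2)[of "z i"] l by (intro mult_right_mono prod_nonneg) (auto simp: abs_le_square_iff[symmetric])
      also have "(\<Prod>j\<in>{..<n} - {i}. (\<beta> (z j))\<^sup>2) = (\<Prod>j\<in>{..<n} - {i}. f j (z j))"
        by (rule prod.cong) (auto simp: f_def)
      also have "(16 / l)\<^sup>2 * \<dots> = (\<Prod>j<n. f j (z j))"
        using i by (subst prod.remove[of "{..<n}" i]) (auto simp: f_def)
      finally show "(cmod (partial_deriv i \<psi> z))\<^sup>2 \<le> (\<Prod>j<n. f j (z j))" .
    qed
    also have "\<dots> = (\<Prod>j<n. (LINT t|segment_measure l. f j t))" by (rule integral_product_cube(1)[OF finite_lessThan fi])
    also have "\<dots> = (LINT t|segment_measure l. f i t) * (\<Prod>j\<in>{..<n} - {i}. (LINT t|segment_measure l. f j t))"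
      using i by (subst prod.remove[of "{..<n}" i]) auto
    also have "(LINT t|segment_measure l. f i t) = 256 / l"
      using l by (simp add: f_def measure_restrict_space power2_eq_square)
    also have "(\<Prod>j\<in>{..<n} - {i}. (LINT t|segment_measure l. f j t)) = (\<Prod>j\<in>{..<n} - {i}. A)"
      by (rule prod.cong) (auto simp: f_def A_def)
    also have "\<dots> = A ^ (n - 1)" using i by simp
    finally show ?thesis by (simp add: L2_norm_sq)
  qed
  have tr: "(L2_norm (face n l k) (diag_restr i k \<psi>))\<^sup>2 \<le> A ^ (n - 1)" if k: "k < n" "i < n" "i \<noteq> k" for i k
  proof -
    have "(LINT z|face n l k. (cmod (diag_restr i k \<psi> z))\<^sup>2) \<le> (LINT z|face n l k. (\<Prod>j\<in>{..<n} - {k}. (\<beta> (z j))\<^sup>2))"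
    proof (rule integral_mono[OF L2_integrable[OF diag_restr_L2[OF test k]] integral_product_cube(2)[OF _ i2]])
      fix z
      have "(\<Prod>j\<in>{..<n} - {k}. \<beta> ((z(k := z i)) j)) = (\<Prod>j\<in>{..<n} - {k}. \<beta> (z j))" by (rule prod.cong) auto
      then have "diag_restr i k \<psi> z = complex_of_real (\<beta> (z i) * (\<Prod>j\<in>{..<n} - {k}. \<beta> (z j)))"
        unfolding diag_restr_def \<psi>_def using k(1) by (subst prod.remove[of "{..<n}" k]) auto
      then have "(cmod (diag_restr i k \<psi> z))\<^sup>2 = (\<beta> (z i))\<^sup>2 * (\<Prod>j\<in>{..<n} - {k}. (\<beta> (z j))\<^sup>2)"
        by (simp only: norm_of_real power2_abs power_mult_distrib prod_power_distrib)
      also have "\<dots> \<le> 1 * (\<Prod>j\<in>{..<n} - {k}. (\<beta> (z j))\<^sup>2)"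
        using r by (intro mult_right_mono prod_nonneg) (auto intro: power_le_one)
      finally show "(cmod (diag_restr i k \<psi> z))\<^sup>2 \<le> (\<Prod>j\<in>{..<n} - {k}. (\<beta> (z j))\<^sup>2)" by simp
    qed simp
    also have "\<dots> = (\<Prod>j\<in>{..<n} - {k}. A)" unfolding A_def by (rule integral_product_cube(1)[OF _ i2]) simp
    also have "\<dots> = A ^ (n - 1)" using k(1) by simp
    finally show ?thesis by (simp add: L2_norm_sq)
  qed
  show thesis by (rule that[OF A0 dom test norm kin tr])
qed

lemma E0_QM_greatest:
  assumes "n > 0" "l > 0" "0 \<le> g"
    and "\<And>\<phi>. test_function n l \<phi> \<Longrightarrow> \<mu> * (L2_norm (cube n l) \<phi>)\<^sup>2 \<le> test_energy n l g \<phi>"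
  shows "\<mu> \<le> E0_QM n l g"
proof -
  obtain \<psi> A where \<psi>: "A \<ge> l / 18" "\<psi> \<in> form_domain n l" "(L2_norm (cube n l) \<psi>)\<^sup>2 = A ^ n"
    using trial_function[OF assms(2), of n] by metis
  have "A > 0" using \<psi>(1) assms(2) by (intro less_le_trans[of 0 "l / 18" A]) auto
  then have nz: "L2_norm (cube n l) \<psi> \<noteq> 0" using \<psi>(3) by auto
  have D: "(\<lambda>z. of_real (1 / L2_norm (cube n l) \<psi>) * \<psi> z) \<in> form_domain n l"
    using form_domain_lincomb[OF assms(2) zero_form_domain[OF assms(2)] \<psi>(2), of "of_real (1 / L2_norm (cube n l) \<psi>)"] by simp
  have N: "L2_norm (cube n l) (\<lambda>z. of_real (1 / L2_norm (cube n l) \<psi>) * \<psi> z) = 1"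
    using L2.nrm_scale[OF H10_L2[OF form_domain_H10[OF \<psi>(2)]], of "of_real (1 / L2_norm (cube n l) \<psi>)"] nz
      L2_norm_nonneg[of "cube n l" \<psi>] by (simp add: norm_divide)
  show ?thesis
    unfolding E0_QM_eq_form_bottom[OF assms(1-3) \<psi>(2) nz] form_bottom_def
  proof (rule cInf_greatest)
    show "{energy n l g \<psi> |\<psi>. \<psi> \<in> form_domain n l \<and> L2_norm (cube n l) \<psi> = 1} \<noteq> {}" using D N by blast
    fix x assume "x \<in> {energy n l g \<psi> |\<psi>. \<psi> \<in> form_domain n l \<and> L2_norm (cube n l) \<psi> = 1}"
    then obtain \<phi> where \<phi>: "x = energy n l g \<phi>" "\<phi> \<in> form_domain n l" "L2_norm (cube n l) \<phi> = 1" by blast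
    from energy_lower_from_tests[OF assms(2) form_domain_H10[OF \<phi>(2)] assms(4)] show "\<mu> \<le> x"
      using \<phi>(1,3) by simp
  qed
qed

lemma E0_QM_nonneg:
  assumes "l > 0" "0 \<le> g" shows "0 \<le> E0_QM n l g"
proof (cases "n = 0")
  case False
  have "0 * (L2_norm (cube n l) \<phi>)\<^sup>2 \<le> test_energy n l g \<phi>" for \<phi>
    unfolding test_energy_def using assms(2) by (simp add: add_nonneg_nonneg sum_nonneg)
  then show ?thesis using False assms by (intro E0_QM_greatest) auto
qed (simp add: E0_QM_def)

text \<open>Rayleigh quotient of the product state: \<open>A ^ (n - 1) / A ^ n \<le> 18 / l\<close>
  turns the kinetic constant 256 into 256 * 18 = 4608 and the interaction constant 1 into 18; the
  pairs are generously counted as n^2.\<close>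

lemma E0_QM_upper:
  assumes "l > 0" "0 \<le> g"
  shows "E0_QM n l g \<le> 4608 * real n / l\<^sup>2 + 18 * g * (real n)\<^sup>2 / l"
proof (cases "n = 0")
  case False
  obtain \<psi> A where A: "A \<ge> l / 18" and \<psi>: "\<psi> \<in> form_domain n l" "test_function n l \<psi>"
    and norm: "(L2_norm (cube n l) \<psi>)\<^sup>2 = A ^ n"
    and kin: "\<And>i. i < n \<Longrightarrow> (L2_norm (cube n l) (partial_deriv i \<psi>))\<^sup>2 \<le> 256 / l * A ^ (n - 1)"
    and tr: "\<And>i k. k < n \<Longrightarrow> i < n \<Longrightarrow> i \<noteq> k \<Longrightarrow> (L2_norm (face n l k) (diag_restr i k \<psi>))\<^sup>2 \<le> A ^ (n - 1)"
    using trial_function[OF assms(1), of n] by metis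
  have A0: "A > 0" using A assms(1) by (intro less_le_trans[of 0 "l / 18" A]) auto
  then have nz: "L2_norm (cube n l) \<psi> \<noteq> 0" using norm by auto
  have "(\<Sum>i<n. (L2_norm (cube n l) (partial_deriv i \<psi>))\<^sup>2) \<le> (\<Sum>i<n. 256 / l * A ^ (n - 1))"
    by (intro sum_mono kin) simp
  moreover have "(\<Sum>k<n. \<Sum>i<k. (L2_norm (face n l k) (diag_restr i k \<psi>))\<^sup>2) \<le> (\<Sum>k<n. \<Sum>i<n. A ^ (n - 1))"
  proof (rule sum_mono)
    fix k assume k: "k \<in> {..<n}"
    have "(\<Sum>i<k. (L2_norm (face n l k) (diag_restr i k \<psi>))\<^sup>2) \<le> (\<Sum>i<k. A ^ (n - 1))"
      using k by (intro sum_mono tr) auto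
    also have "\<dots> \<le> (\<Sum>i<n. A ^ (n - 1))" using k A0 by (intro sum_mono2) auto
    finally show "(\<Sum>i<k. (L2_norm (face n l k) (diag_restr i k \<psi>))\<^sup>2) \<le> \<dots>" .
  qed
  ultimately have "test_energy n l g \<psi> \<le> n * (256 / l * A ^ (n - 1)) + g * (n * (n * A ^ (n - 1)))"
    unfolding test_energy_def using assms(2) by (intro add_mono mult_left_mono) auto
  also have "\<dots> = (256 * real n / l + g * (real n)\<^sup>2) * A ^ (n - 1)" by (simp add: power2_eq_square algebra_simps)
  finally have te: "test_energy n l g \<psi> \<le> (256 * real n / l + g * (real n)\<^sup>2) * A ^ (n - 1)" .
  have An: "A ^ n = A * A ^ (n - 1)" using False by (simp add: power_eq_if)
  have "form_bottom n l g * A ^ n \<le> test_energy n l g \<psi>"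
    using form_bottom_lower[OF assms \<psi>(1)] unfolding norm energy_test[OF \<psi>(2) assms(1)] .
  with te have "(form_bottom n l g * A) * A ^ (n - 1) \<le> (256 * real n / l + g * (real n)\<^sup>2) * A ^ (n - 1)"
    unfolding An by (simp add: mult.assoc)
  then have "form_bottom n l g * A \<le> 256 * real n / l + g * (real n)\<^sup>2"
    using A0 by (simp add: mult_le_cancel_right)
  then have "form_bottom n l g \<le> (256 * real n / l + g * (real n)\<^sup>2) / A" using A0 by (simp add: pos_le_divide_eq)
  also have "\<dots> \<le> (256 * real n / l + g * (real n)\<^sup>2) / (l / 18)"
    using A A0 assms by (intro divide_left_mono add_nonneg_nonneg) auto
  also have "\<dots> = 4608 * real n / l\<^sup>2 + 18 * g * (real n)\<^sup>2 / l" using assms(1) by (simp add: field_simps power2_eq_square)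
  finally show ?thesis using E0_QM_eq_form_bottom[OF _ assms \<psi>(1) nz] False by simp
qed (simp add: E0_QM_def)

section \<open>Lower bound on the energy by counting pairs in boxes\<close>

lemma sum_pairs_symmetric:
  fixes u :: "nat \<Rightarrow> nat \<Rightarrow> real"
  assumes "\<And>i k. u i k = u k i" "\<And>i. u i i = 1"
  shows "(\<Sum>k<n. \<Sum>i<n. u i k) = 2 * (\<Sum>k<n. \<Sum>i<k. u i k) + n"
proof (induction n)
  case (Suc n)
  have "(\<Sum>k<n. u n k) = (\<Sum>i<n. u i n)" by (intro sum.cong refl assms(1))
  then show ?case using Suc assms(2) by (simp add: sum.distrib)
qed simp

text \<open>Cauchy-Schwarz for the occupation numbers \<open>m c\<close> of the boxes: they add up
  to \<open>n\<close>, and the sum of their squares counts the ordered pairs in a common box,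
  including the \<open>n\<close> diagonal ones.\<close>

lemma pairs_in_same_box:
  fixes b :: "nat \<Rightarrow> nat"
  assumes "\<And>i. i < n \<Longrightarrow> b i < p"
  shows "(real n)\<^sup>2 \<le> real p * (2 * (\<Sum>k<n. \<Sum>i<k. of_bool (b i = b k)) + real n)"
proof -
  define m where "m c = (\<Sum>i<n. of_bool (b i = c) :: real)" for c
  have "(\<Sum>c<p. m c) = (\<Sum>i<n. \<Sum>c<p. of_bool (b i = c))" unfolding m_def by (rule sum.swap)
  also have "\<dots> = (\<Sum>i<n. 1)"
    by (intro sum.cong refl) (use assms in \<open>simp add: of_bool_def\<close>)
  finally have tot: "(\<Sum>c<p. m c) = n" by simp
  have "(\<Sum>c<p. (m c)\<^sup>2) = (\<Sum>c<p. \<Sum>k<n. \<Sum>i<n. of_bool (b i = c) * of_bool (b k = c))"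
    unfolding m_def power2_eq_square sum_product by (intro sum.cong refl) (simp add: mult.commute)
  also have "\<dots> = (\<Sum>k<n. \<Sum>c<p. \<Sum>i<n. of_bool (b i = c) * of_bool (b k = c))" by (rule sum.swap)
  also have "\<dots> = (\<Sum>k<n. \<Sum>i<n. \<Sum>c<p. of_bool (b i = c) * of_bool (b k = c))"
    by (intro sum.cong refl sum.swap)
  also have "\<dots> = (\<Sum>k<n. \<Sum>i<n. of_bool (b i = b k))"
  proof (intro sum.cong refl)
    fix k i assume "k \<in> {..<n}" "i \<in> {..<n}"
    then have "(\<Sum>c<p. of_bool (b i = c) * of_bool (b k = c) :: real) = (\<Sum>c<p. if b i = c then of_bool (b i = b k) else 0)"
      by (intro sum.cong refl) auto
    also have "\<dots> = of_bool (b i = b k)" using assms \<open>i \<in> {..<n}\<close> by simp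
    finally show "(\<Sum>c<p. of_bool (b i = c) * of_bool (b k = c) :: real) = of_bool (b i = b k)" .
  qed
  also have "\<dots> = 2 * (\<Sum>k<n. \<Sum>i<k. of_bool (b i = b k)) + real n"
    by (rule sum_pairs_symmetric) (auto simp: eq_commute)
  finally have sq: "(\<Sum>c<p. (m c)\<^sup>2) = 2 * (\<Sum>k<n. \<Sum>i<k. of_bool (b i = b k)) + real n" .
  have "(\<Sum>c<p. m c)\<^sup>2 \<le> (\<Sum>c<p. (m c)\<^sup>2) * card {..<p}" by (rule sum_squared_le_sum_of_squares)
  then show ?thesis unfolding tot sq by (simp add: mult.commute)
qed

text \<open>The range of the smeared interaction is given by a partition into boxes instead of the
  condition \<open>\<bar>s - t\<bar> \<le> R\<close>, because pairs in a common box are counted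
  exactly by squares of occupation numbers.\<close>

definition same_box :: "real \<Rightarrow> real \<Rightarrow> real \<Rightarrow> real" where
  "same_box R s t = of_bool (\<lfloor>s / R\<rfloor> = \<lfloor>t / R\<rfloor>)"

lemma same_box_dist: "R > 0 \<Longrightarrow> same_box R s t \<noteq> 0 \<Longrightarrow> \<bar>s - t\<bar> \<le> R"
proof -
  assume R: "R > 0" and "same_box R s t \<noteq> 0"
  then have eq: "\<lfloor>s / R\<rfloor> = \<lfloor>t / R\<rfloor>" by (auto simp: same_box_def split: if_splits)
  have "\<bar>s / R - t / R\<bar> \<le> 1" using eq floor_correct[of "s / R"] floor_correct[of "t / R"] by linarith
  then show ?thesis using R by (simp add: diff_divide_distrib[symmetric] abs_divide)
qed

lemma same_box_measurable [measurable]: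
  assumes [measurable]: "f \<in> borel_measurable M" "h \<in> borel_measurable M"
  shows "(\<lambda>z. same_box R (f z) (h z)) \<in> borel_measurable M"
  unfolding same_box_def of_bool_def by measurable

lemma same_box_integral_le:
  assumes "R > 0" shows "(LINT t|segment_measure l. same_box R s t) \<le> R"
proof -
  let ?B = "{R * \<lfloor>s / R\<rfloor>..R * (\<lfloor>s / R\<rfloor> + 1)}"
  have sub: "same_box R s t \<le> indicator ?B t" for t
  proof (cases "\<lfloor>s / R\<rfloor> = \<lfloor>t / R\<rfloor>")
    case True
    have "R * \<lfloor>t / R\<rfloor> \<le> R * (t / R)" "R * (t / R) \<le> R * (\<lfloor>t / R\<rfloor> + 1)"
      using floor_correct[of "t / R"] assms by (intro mult_left_mono; simp)+
    then have "t \<in> ?B" using assms True by simp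
    then show ?thesis by (simp add: same_box_def)
  qed (simp add: same_box_def)
  have "(LINT t|segment_measure l. same_box R s t) = (LINT t|lborel. indicator {0<..<l} t *\<^sub>R same_box R s t)"
    by (subst integral_restrict_space) auto
  also have "\<dots> \<le> (LINT t|lborel. indicator ?B t)"
  proof (rule integral_mono')
    show "integrable lborel (indicator ?B :: real \<Rightarrow> real)" by (intro integrable_real_indicator) (simp_all add: emeasure_lborel_Icc_eq)
    show "indicator {0<..<l} t *\<^sub>R same_box R s t \<le> indicator ?B t" for t
      using sub[of t] by (cases "t \<in> {0<..<l}") auto
  qed auto
  also have "\<dots> = R" using assms by (simp add: algebra_simps)
  finally show ?thesis .
qed

lemma norm_sq_le_twice: "(cmod a)\<^sup>2 \<le> 2 * (cmod b)\<^sup>2 + 2 * (cmod (a - b))\<^sup>2"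
proof -
  have "cmod a \<le> cmod b + cmod (a - b)" using norm_triangle_ineq[of b "a - b"] by simp
  then have "(cmod a)\<^sup>2 \<le> (cmod b + cmod (a - b))\<^sup>2" by (intro power_mono) auto
  also have "\<dots> \<le> 2 * (cmod b)\<^sup>2 + 2 * (cmod (a - b))\<^sup>2"
    using sum_squares_bound[of "cmod b" "cmod (a - b)"] by (simp add: power2_sum)
  finally show ?thesis .
qed

text \<open>Trades a fraction of the kinetic energy of particle \<open>k\<close> for smearing the contact interaction
  over boxes of side \<open>R\<close>.\<close>
lemma smeared_interaction:
  assumes t: "test_function n l \<phi>" and k: "k < n" "i < n" "i \<noteq> k" and "l > 0" "R > 0"
  shows "(LINT z|cube n l. same_box R (z i) (z k) * (cmod (\<phi> z))\<^sup>2) \<le>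
    R * (2 * (L2_norm (face n l k) (diag_restr i k \<phi>))\<^sup>2 + 2 * R * (L2_norm (cube n l) (partial_deriv k \<phi>))\<^sup>2)"
proof -
  obtain A where A: "A \<ge> 0" "\<And>z. z \<in> extensional {..<n} \<Longrightarrow> cmod (\<phi> z) \<le> A"
    "\<And>i z. i < n \<Longrightarrow> z \<in> extensional {..<n} \<Longrightarrow> cmod (partial_deriv i \<phi> z) \<le> A"
    using test_function_bounded[OF t] by metis
  define F where "F z = same_box R (z i) (z k) * (cmod (\<phi> z))\<^sup>2" for z
  define G where "G z = (cmod (partial_deriv k \<phi> z))\<^sup>2" for z
  note [measurable] = test_function_measurable(1)[OF t] test_function_measurable(2)[OF t k(1)]
    measurable_cube_component[OF lessThan_iff[THEN iffD2, OF k(1)], of l]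
    measurable_cube_component[OF lessThan_iff[THEN iffD2, OF k(2)], of l]
  have Fm: "F \<in> borel_measurable (cube n l)" unfolding F_def by measurable
  have Gm: "G \<in> borel_measurable (cube n l)" unfolding G_def by measurable
  have sb: "0 \<le> same_box R s u \<and> same_box R s u \<le> 1" for s u by (simp add: same_box_def)
  have Fb: "norm (F z) \<le> A\<^sup>2" if "z \<in> space (cube n l)" for z
  proof -
    have "(cmod (\<phi> z))\<^sup>2 \<le> A\<^sup>2" using A(2)[OF cube_extensional[OF that]] by (intro power_mono) auto
    then have "same_box R (z i) (z k) * (cmod (\<phi> z))\<^sup>2 \<le> 1 * A\<^sup>2" using sb by (intro mult_mono) auto
    then show ?thesis using sb by (simp add: F_def abs_mult)
  qed
  have Gb: "norm (G z) \<le> A\<^sup>2" if "z \<in> space (cube n l)" for z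
    using A(3)[OF k(1) cube_extensional[OF that]] by (simp add: G_def power_mono)
  have L2r: "diag_restr i k \<phi> \<in> L2 (face n l k)" by (rule diag_restr_L2[OF t k])
  have "(LINT z|cube n l. F z) = (LINT z|face n l k. (LINT t|segment_measure l. F (z(k := t))))"
    by (rule fubini[OF Fm Fb k(1)])
  also have "\<dots> \<le> (LINT z|face n l k. R * (2 * (cmod (diag_restr i k \<phi> z))\<^sup>2 + 2 * R * (LINT t|segment_measure l. G (z(k := t)))))"
  proof (rule integral_mono[OF fubini_integrable_inner[OF Fm Fb k(1)]])
    show "integrable (face n l k) (\<lambda>z. R * (2 * (cmod (diag_restr i k \<phi> z))\<^sup>2 + 2 * R * (LINT t|segment_measure l. G (z(k := t)))))"
      by (intro integrable_mult_right Bochner_Integration.integrable_add L2_integrable[OF L2r] fubini_integrable_inner[OF Gm Gb k(1)])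
    fix z assume z: "z \<in> space (face n l k)"
    define y where "y = z i"
    define D where "D = (LINT t|segment_measure l. G (z(k := t)))"
    have D0: "0 \<le> D" unfolding D_def G_def by (intro integral_nonneg_AE) auto
    have "z i \<in> {0<..<l}" using z k(2,3) by (auto simp: space_cube PiE_iff)
    then have y: "y \<in> {0..l}" by (simp add: y_def)
    \<comment> \<open>\<open>V\<close> bounds the squared modulus at every point of the line that
      shares a box with \<open>y\<close>, in terms of the value on the diagonal and the integrated
      derivative only. It does not depend on the point, so integrating \<open>same_box R y\<close>
      costs a single factor \<open>R\<close>.\<close>
    define V where "V = 2 * (cmod (\<phi> (z(k := y))))\<^sup>2 + 2 * R * D"
    have V0: "0 \<le> V" unfolding V_def using D0 assms(6) by simp
    have bound: "F (z(k := t)) \<le> same_box R y t * V" if t': "t \<in> {0<..<l}" for t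
    proof -
      have eq: "F (z(k := t)) = same_box R y t * (cmod (\<phi> (z(k := t))))\<^sup>2"
        using k(3) by (simp add: F_def y_def)
      show ?thesis
      proof (cases "same_box R y t = 0")
        case False
        have "(cmod (\<phi> (z(k := t)) - \<phi> (z(k := y))))\<^sup>2 \<le> \<bar>t - y\<bar> * D"
          unfolding D_def G_def using y t' by (intro slice_diff_sq_le[OF t k(1) z]) auto
        also have "\<dots> \<le> R * D" using same_box_dist[OF assms(6) False] D0 by (intro mult_right_mono) auto
        finally have "(cmod (\<phi> (z(k := t))))\<^sup>2 \<le> V"
          unfolding V_def using norm_sq_le_twice[of "\<phi> (z(k := t))" "\<phi> (z(k := y))"] by linarith
        then show ?thesis unfolding eq using sb by (intro mult_left_mono) auto
      qed (simp add: eq)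
    qed
    have "(LINT t|segment_measure l. F (z(k := t))) \<le> (LINT t|segment_measure l. same_box R y t * V)"
    proof (rule integral_mono[OF fubini_slice[OF Fm Fb k(1) z]])
      have "(\<lambda>t. same_box R y t) \<in> borel_measurable (segment_measure l)"
        by (intro measurable_restrict_space1 same_box_measurable) simp_all
      then show "integrable (segment_measure l) (\<lambda>t. same_box R y t * V)"
        using sb by (intro integrable_mult_left integrable_bounded[OF finite_measure_segment_measure, where C = 1]) auto
      show "F (z(k := x)) \<le> same_box R y x * V" if "x \<in> space (segment_measure l)" for x
        by (rule bound) (use that in simp)
    qed
    also have "\<dots> = (LINT t|segment_measure l. same_box R y t) * V" by simp
    also have "\<dots> \<le> R * V" by (rule mult_right_mono[OF same_box_integral_le[OF assms(6)] V0])
    finally show "(LINT t|segment_measure l. F (z(k := t))) \<le> R * (2 * (cmod (diag_restr i k \<phi> z))\<^sup>2 + 2 * R * (LINT t|segment_measure l. G (z(k := t))))"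
      by (simp add: V_def D_def y_def diag_restr_def)
  qed
  also have "\<dots> = R * (2 * (LINT z|face n l k. (cmod (diag_restr i k \<phi> z))\<^sup>2) + 2 * R * (LINT z|face n l k. (LINT t|segment_measure l. G (z(k := t)))))"
    using L2_integrable[OF L2r] fubini_integrable_inner[OF Gm Gb k(1)] by simp
  also have "(LINT z|face n l k. (LINT t|segment_measure l. G (z(k := t)))) = (LINT z|cube n l. G z)"
    by (rule fubini[OF Gm Gb k(1), symmetric])
  finally show ?thesis by (simp add: L2_norm_sq F_def[abs_def] G_def[abs_def])
qed

text \<open>Summed over all pairs \<open>i < k\<close>, the smearing charges the kinetic energy of
  particle \<open>k\<close> exactly \<open>k\<close> times with weight \<open>g' * R\<close>;
  \<open>R \<le> 1 / (g' * n)\<close> keeps this within the kinetic energy available. The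
  coefficient that remains is \<open>g' * n * (n - p) / (4 * l)\<close>, and
  \<open>8 \<le> n\<close> with \<open>g' * l \<le> 1 / 8\<close> gives
  \<open>p \<le> n / 8 + 1 \<le> n / 4\<close>, hence the 3/16.\<close>

lemma test_energy_lower:
  assumes t: "test_function n l \<phi>" and n: "8 \<le> n" and l: "l > 0" and g': "0 < g'" "g' \<le> g" "g' * l \<le> 1 / 8"
  shows "3 / 16 * g' * (real n)\<^sup>2 / l * (L2_norm (cube n l) \<phi>)\<^sup>2 \<le> test_energy n l g \<phi>"
proof -
  \<comment> \<open>The number of boxes, rounded up so that boxes of side \<open>R = l / p\<close>
    fill the segment exactly and still \<open>g' * R * n \<le> 1\<close>.\<close>
  define p where "p = nat \<lceil>g' * n * l\<rceil>"
  have pos: "0 < g' * n * l" using g' n l by simp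
  have p: "g' * n * l \<le> p" "p \<le> g' * n * l + 1" using pos unfolding p_def by linarith+
  have p0: "p > 0" using pos p(1) by (cases p) auto
  define R where "R = l / p"
  have R: "R > 0" using l p0 by (simp add: R_def)
  define N where "N = (L2_norm (cube n l) \<phi>)\<^sup>2"
  define T where "T = (\<Sum>k<n. \<Sum>i<k. (L2_norm (face n l k) (diag_restr i k \<phi>))\<^sup>2)"
  define D where "D k = (L2_norm (cube n l) (partial_deriv k \<phi>))\<^sup>2" for k
  let ?u = "\<lambda>z. \<Sum>k<n. \<Sum>i<k. same_box R (z i) (z k)"
  note [measurable] = test_function_measurable(1)[OF t]
  have intF: "integrable (cube n l) (\<lambda>z. same_box R (z i) (z k) * (cmod (\<phi> z))\<^sup>2)" if "i < n" "k < n" for i k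
  proof (rule Bochner_Integration.integrable_bound[OF L2_integrable[OF test_function_L2(1)[OF t]]])
    note [measurable] = measurable_cube_component[OF lessThan_iff[THEN iffD2, OF that(1)], of l]
      measurable_cube_component[OF lessThan_iff[THEN iffD2, OF that(2)], of l]
    show "(\<lambda>z. same_box R (z i) (z k) * (cmod (\<phi> z))\<^sup>2) \<in> borel_measurable (cube n l)" by measurable
    show "AE z in cube n l. norm (same_box R (z i) (z k) * (cmod (\<phi> z))\<^sup>2) \<le> norm ((cmod (\<phi> z))\<^sup>2)"
      by (rule AE_I2) (simp add: same_box_def)
  qed
  have count: "((real n)\<^sup>2 / p - n) / 2 \<le> ?u z" if z: "z \<in> space (cube n l)" for z
  proof -
    have zi: "0 < z i" "z i < l" if "i < n" for i using z that by (auto simp: space_cube PiE_iff)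
    define b where "b i = nat \<lfloor>z i / R\<rfloor>" for i
    have "z i / R < p" if "i < n" for i using zi[OF that] l p0 by (simp add: R_def field_simps)
    then have "b i < p" if "i < n" for i using that zi[OF that] R unfolding b_def by (simp add: nat_less_iff floor_less_iff)
    from pairs_in_same_box[OF this] have "(real n)\<^sup>2 \<le> real p * (2 * (\<Sum>k<n. \<Sum>i<k. of_bool (b i = b k)) + real n)" .
    moreover have "(\<Sum>k<n. \<Sum>i<k. of_bool (b i = b k)) = ?u z"
    proof (intro sum.cong refl)
      fix k i assume "k \<in> {..<n}" "i \<in> {..<k}"
      then have "0 \<le> \<lfloor>z i / R\<rfloor>" "0 \<le> \<lfloor>z k / R\<rfloor>" using zi[of i] zi[of k] R by auto
      then show "of_bool (b i = b k) = same_box R (z i) (z k)" by (simp add: b_def same_box_def eq_nat_nat_iff)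
    qed
    ultimately have "(real n)\<^sup>2 / p \<le> 2 * ?u z + n" using p0 by (simp add: divide_le_eq mult.commute)
    then show ?thesis by simp
  qed
  have "((real n)\<^sup>2 / p - n) / 2 * N = (LINT z|cube n l. ((real n)\<^sup>2 / p - n) / 2 * (cmod (\<phi> z))\<^sup>2)"
    by (simp add: N_def L2_norm_sq)
  also have "\<dots> \<le> (LINT z|cube n l. (\<Sum>k<n. \<Sum>i<k. same_box R (z i) (z k) * (cmod (\<phi> z))\<^sup>2))"
  proof (rule integral_mono)
    show "integrable (cube n l) (\<lambda>z. ((real n)\<^sup>2 / p - n) / 2 * (cmod (\<phi> z))\<^sup>2)"
      by (intro integrable_mult_right L2_integrable[OF test_function_L2(1)[OF t]])
    show "integrable (cube n l) (\<lambda>z. \<Sum>k<n. \<Sum>i<k. same_box R (z i) (z k) * (cmod (\<phi> z))\<^sup>2)"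
      by (intro Bochner_Integration.integrable_sum intF) auto
    fix z assume "z \<in> space (cube n l)"
    then show "((real n)\<^sup>2 / p - n) / 2 * (cmod (\<phi> z))\<^sup>2 \<le> (\<Sum>k<n. \<Sum>i<k. same_box R (z i) (z k) * (cmod (\<phi> z))\<^sup>2)"
      unfolding sum_distrib_right[symmetric] by (intro mult_right_mono count) auto
  qed
  also have "\<dots> = (\<Sum>k<n. \<Sum>i<k. (LINT z|cube n l. same_box R (z i) (z k) * (cmod (\<phi> z))\<^sup>2))"
  proof -
    have "(LINT z|cube n l. (\<Sum>k<n. \<Sum>i<k. same_box R (z i) (z k) * (cmod (\<phi> z))\<^sup>2)) =
        (\<Sum>k<n. (LINT z|cube n l. (\<Sum>i<k. same_box R (z i) (z k) * (cmod (\<phi> z))\<^sup>2)))"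
      by (intro Bochner_Integration.integral_sum Bochner_Integration.integrable_sum intF) auto
    also have "\<dots> = (\<Sum>k<n. \<Sum>i<k. (LINT z|cube n l. same_box R (z i) (z k) * (cmod (\<phi> z))\<^sup>2))"
      by (intro sum.cong refl Bochner_Integration.integral_sum intF) auto
    finally show ?thesis .
  qed
  also have "\<dots> \<le> (\<Sum>k<n. \<Sum>i<k. R * (2 * (L2_norm (face n l k) (diag_restr i k \<phi>))\<^sup>2 + 2 * R * D k))"
    unfolding D_def by (intro sum_mono smeared_interaction[OF t _ _ _ l R]) auto
  also have "\<dots> = 2 * R * T + 2 * R\<^sup>2 * (\<Sum>k<n. k * D k)"
    by (simp add: T_def sum.distrib sum_distrib_left power2_eq_square algebra_simps)
  finally have main: "((real n)\<^sup>2 / p - n) / 2 * N \<le> 2 * R * T + 2 * R\<^sup>2 * (\<Sum>k<n. k * D k)" .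
  have gR: "g' * R * n \<le> 1" using p(1) p0 by (simp add: R_def field_simps)
  have "g' * R * (\<Sum>k<n. k * D k) = (\<Sum>k<n. (g' * R * k) * D k)" by (simp add: sum_distrib_left mult.assoc)
  also have "\<dots> \<le> (\<Sum>k<n. 1 * D k)"
  proof (intro sum_mono mult_right_mono)
    fix k assume "k \<in> {..<n}"
    then have "g' * R * k \<le> g' * R * n" using g' R by (intro mult_left_mono) auto
    then show "g' * R * k \<le> 1" using gR by linarith
  qed (simp add: D_def)
  finally have kin: "g' * R * (\<Sum>k<n. k * D k) \<le> (\<Sum>k<n. D k)" by simp
  \<comment> \<open>The factor \<open>g' / (2 * R)\<close> normalises the contact term to
    \<open>g' * T\<close> and leaves the weight \<open>g' * R\<close> on the kinetic sum.\<close>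
  have "g' / (2 * R) * (((real n)\<^sup>2 / p - n) / 2 * N) \<le> g' / (2 * R) * (2 * R * T + 2 * R\<^sup>2 * (\<Sum>k<n. k * D k))"
    using main g' R by (intro mult_left_mono) auto
  also have "\<dots> = g' * T + g' * R * (\<Sum>k<n. k * D k)" using R by (simp add: field_simps power2_eq_square)
  also have "\<dots> \<le> g * T + (\<Sum>k<n. D k)"
    using kin g' by (intro add_mono mult_right_mono) (auto simp: T_def intro!: sum_nonneg)
  also have "\<dots> = test_energy n l g \<phi>" by (simp add: test_energy_def T_def D_def)
  finally have e: "g' / (2 * R) * (((real n)\<^sup>2 / p - n) / 2 * N) \<le> test_energy n l g \<phi>" .
  have pn: "p \<le> n / 4"
  proof -
    have "g' * n * l = (g' * l) * n" by simp
    also have "\<dots> \<le> 1 / 8 * n" using g'(3) by (intro mult_right_mono) auto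
    finally show ?thesis using p(2) n by linarith
  qed
  have "g' / (2 * R) * (((real n)\<^sup>2 / p - n) / 2) = g' * n * (real n - real p) / (4 * l)"
    using p0 l by (simp add: R_def field_simps power2_eq_square)
  also have "\<dots> \<ge> g' * n * (3 / 4 * n) / (4 * l)"
    using pn g' l by (intro divide_right_mono mult_left_mono) auto
  finally have "3 / 16 * g' * (real n)\<^sup>2 / l \<le> g' / (2 * R) * (((real n)\<^sup>2 / p - n) / 2)"
    by (simp add: power2_eq_square)
  then have "3 / 16 * g' * (real n)\<^sup>2 / l * N \<le> g' / (2 * R) * (((real n)\<^sup>2 / p - n) / 2) * N"
    by (rule mult_right_mono) (simp add: N_def)
  with e show ?thesis by (simp add: N_def mult.assoc)
qed

lemma E0_QM_lower:
  assumes "8 \<le> n" "l > 0" "0 < g'" "g' \<le> g" "g' * l \<le> 1 / 8"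
  shows "3 / 16 * g' * (real n)\<^sup>2 / l \<le> E0_QM n l g"
proof (rule E0_QM_greatest)
  show "3 / 16 * g' * (real n)\<^sup>2 / l * (L2_norm (cube n l) \<phi>)\<^sup>2 \<le> test_energy n l g \<phi>"
    if "test_function n l \<phi>" for \<phi> by (rule test_energy_lower[OF that assms])
qed (use assms in auto)

section \<open>Lower bound on the Gross-Pitaevskii energy\<close>

lemma L2_lim_bounded:
  assumes lim: "L2_lim M F f" and b: "\<And>m z. z \<in> space M \<Longrightarrow> cmod (F m z) \<le> b"
  shows "AE z in M. cmod (f z) \<le> b"
proof -
  have L: "F m \<in> L2 M" "f \<in> L2 M" for m using lim by (simp_all add: L2_lim_def)
  note [measurable] = L2_borel[OF L(2)]
  \<comment> \<open>The excess of \<open>cmod (f z)\<close> over \<open>b\<close>. It is at most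
    \<open>cmod (F m z - f z)\<close> for every \<open>m\<close>, so its norm is 0.\<close>
  define h where "h z = complex_of_real (max 0 (cmod (f z) - b))" for z
  have hm: "h \<in> borel_measurable M" unfolding h_def by measurable
  have le: "cmod (h z) \<le> cmod (F m z - f z)" if "z \<in> space M" for z m
    using b[OF that, of m] norm_triangle_ineq2[of "f z" "F m z"] unfolding h_def norm_of_real
    by (simp add: norm_minus_commute)
  have hL: "h \<in> L2 M"
    by (rule L2_dominated[OF hm L2_integrable[OF L2.diff[OF L(1)[of 0] L(2)]]])
      (rule AE_I2, rule power_mono[OF le], simp_all)
  have "L2_norm M h \<le> L2_norm M (\<lambda>z. F m z - f z)" for m
    unfolding L2_norm_def
    by (intro real_sqrt_le_mono integral_mono L2_integrable[OF hL] L2_integrable[OF L2.diff[OF L]] power_mono le) auto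
  moreover have "(\<lambda>m. L2_norm M (\<lambda>z. F m z - f z)) \<longlonglongrightarrow> 0" using lim by (simp add: L2_lim_def)
  ultimately have "L2_norm M h \<le> 0" by (intro LIMSEQ_le_const) auto
  then have "AE z in M. h z = 0" using L2_norm_eq_0_iff[OF hL] L2_norm_nonneg[of M h] by simp
  then show ?thesis by eventually_elim (auto simp: h_def)
qed

text \<open>For \<open>n = 1\<close> the face in direction 0 is the single point \<open>w\<close>,
  \<open>undefined\<close> everywhere, so the slice estimate, started from the boundary value 0,
  already concerns the whole segment.\<close>

lemma test_function_sup_bound:
  assumes t: "test_function 1 l \<phi>" and l: "l > 0" and z: "z \<in> space (cube 1 l)"
  shows "(cmod (\<phi> z))\<^sup>2 \<le> l * (L2_norm (cube 1 l) (partial_deriv 0 \<phi>))\<^sup>2"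
proof -
  have e: "{..<1::nat} - {0} = {}" by auto
  define w :: "nat \<Rightarrow> real" where "w = (\<lambda>_. undefined)"
  have w: "w \<in> space (face 1 l 0)" unfolding e space_cube w_def by simp
  have z0: "z 0 \<in> {0<..<l}" using z by (auto simp: space_cube PiE_iff)
  have zw: "z = w(0 := z 0)" using cube_extensional[OF z] by (auto simp: w_def extensional_def)
  obtain A where A: "A \<ge> 0" "\<And>z. z \<in> extensional {..<1} \<Longrightarrow> cmod (partial_deriv 0 \<phi> z) \<le> A"
    using test_function_bounded[OF t] by (metis less_numeral_extra(1))
  define G where "G z = (cmod (partial_deriv 0 \<phi> z))\<^sup>2" for z
  note [measurable] = test_function_measurable(2)[OF t zero_less_one]
  have Gm: "G \<in> borel_measurable (cube 1 l)" unfolding G_def by measurable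
  have Gb: "norm (G z) \<le> A\<^sup>2" if "z \<in> space (cube 1 l)" for z
    using A(2)[OF cube_extensional[OF that]] by (simp add: G_def power_mono)
  have "(LINT z|cube 1 l. G z) = (LINT z|face 1 l 0. (LINT t|segment_measure l. G (z(0 := t))))"
    by (rule fubini[OF Gm Gb zero_less_one])
  also have "\<dots> = (LINT t|segment_measure l. G (w(0 := t)))"
    unfolding e cube_measure_def PiM_empty w_def[symmetric]
    by (simp add: lebesgue_integral_count_space_finite del: fun_upd_apply)
  finally have D: "(LINT t|segment_measure l. G (w(0 := t))) = (L2_norm (cube 1 l) (partial_deriv 0 \<phi>))\<^sup>2"
    by (simp add: L2_norm_sq G_def[abs_def])
  have "(cmod (\<phi> (w(0 := z 0)) - \<phi> (w(0 := 0))))\<^sup>2 \<le> \<bar>z 0 - 0\<bar> * (LINT t|segment_measure l. G (w(0 := t)))"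
    unfolding G_def using z0 by (intro slice_diff_sq_le[OF t zero_less_one w]) auto
  also have "\<dots> \<le> l * (LINT t|segment_measure l. G (w(0 := t)))"
    using z0 by (intro mult_right_mono) (auto simp: G_def)
  finally show ?thesis
    using slice_derivative(3)[OF t zero_less_one w, of 0] unfolding D zw[symmetric] by simp
qed

text \<open>The kinetic term is dropped, and on an interval of length 1 nonnegativity of the
  integral of \<open>((cmod (\<phi> z))\<^sup>2 - 1)\<^sup>2\<close> bounds the quartic integral
  below by 1. The work goes into integrability of the fourth power, without which its integral would
  be 0 by convention: the sup bound for test functions is carried over to \<phi>.\<close>

lemma E_GP_lower:
  assumes "0 \<le> K" shows "K / 2 \<le> E_GP 1 1 K"
  unfolding E_GP_def
proof (rule cInf_greatest)
  let ?S = "{(LINT z|cube 1 1. (cmod (weak_deriv 1 1 0 \<phi> z))\<^sup>2 + K / 2 * (cmod (\<phi> z)) ^ 4) |\<phi>.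
     \<phi> \<in> H10 1 1 \<and> (L2_norm (cube 1 1) \<phi>)\<^sup>2 = 1}"
  obtain \<psi> and A :: real where \<psi>: "A \<ge> 1 / 18" "\<psi> \<in> form_domain 1 1" "(L2_norm (cube 1 1) \<psi>)\<^sup>2 = A ^ 1"
    using trial_function[of 1 1] by (metis zero_less_one)
  have "A > 0" using \<psi>(1) by linarith
  then have nz: "L2_norm (cube 1 1) \<psi> \<noteq> 0" using \<psi>(3) by auto
  let ?\<phi> = "\<lambda>z. of_real (1 / L2_norm (cube 1 1) \<psi>) * \<psi> z"
  have "?\<phi> \<in> H10 1 1" by (rule H10_scale[OF zero_less_one form_domain_H10[OF \<psi>(2)]])
  moreover have "(L2_norm (cube 1 1) ?\<phi>)\<^sup>2 = 1"
    using L2.nrm_scale[OF H10_L2[OF form_domain_H10[OF \<psi>(2)]], of "of_real (1 / L2_norm (cube 1 1) \<psi>)"] nz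
      L2_norm_nonneg[of "cube 1 1" \<psi>] by (simp add: norm_divide)
  ultimately show "?S \<noteq> {}" by blast
  fix x assume "x \<in> ?S"
  then obtain \<phi> where x: "x = (LINT z|cube 1 1. (cmod (weak_deriv 1 1 0 \<phi> z))\<^sup>2 + K / 2 * (cmod (\<phi> z)) ^ 4)"
    and \<phi>: "\<phi> \<in> H10 1 1" "(L2_norm (cube 1 1) \<phi>)\<^sup>2 = 1" by blast
  interpret C: finite_measure "cube 1 1" by (rule finite_measure_cube) simp
  have one: "(LINT z|cube 1 1. 1) = (1::real)"
    using emeasure_cube[of "{..<1::nat}" 1] by (simp add: measure_def)
  obtain \<Phi> where a: "test_approx 1 1 \<Phi> \<phi>" using \<phi>(1) by (rule H10_test_approx)
  have "convergent (\<lambda>m. L2_norm (cube 1 1) (partial_deriv 0 (\<Phi> m)))"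
    using L2.conv_nrm[OF test_approxD(3)[OF a zero_less_one]] unfolding convergent_def by blast
  then obtain b where b: "b > 0" "\<And>m. L2_norm (cube 1 1) (partial_deriv 0 (\<Phi> m)) \<le> b"
    using convergent_imp_Bseq[THEN BseqD] L2_norm_nonneg by (metis abs_of_nonneg real_norm_def)
  have "cmod (\<Phi> m z) \<le> b" if z: "z \<in> space (cube 1 1)" for m z
  proof -
    have "(cmod (\<Phi> m z))\<^sup>2 \<le> 1 * (L2_norm (cube 1 1) (partial_deriv 0 (\<Phi> m)))\<^sup>2"
      by (rule test_function_sup_bound[OF test_approxD(1)[OF a] zero_less_one z])
    also have "\<dots> \<le> b\<^sup>2" using b(2)[of m] L2_norm_nonneg by (simp add: power_mono)
    finally show ?thesis by (rule power2_le_imp_le) (use b in simp)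
  qed
  from L2_lim_bounded[OF test_approxD(2)[OF a] this] have bd: "AE z in cube 1 1. cmod (\<phi> z) \<le> b" .
  note [measurable] = L2_borel[OF H10_L2[OF \<phi>(1)]]
  have i4: "integrable (cube 1 1) (\<lambda>z. (cmod (\<phi> z)) ^ 4)"
  proof (rule C.integrable_const_bound)
    show "AE z in cube 1 1. norm ((cmod (\<phi> z)) ^ 4) \<le> b ^ 4" using bd by eventually_elim (simp add: power_mono)
  qed measurable
  have i2: "integrable (cube 1 1) (\<lambda>z. (cmod (\<phi> z))\<^sup>2)" by (rule L2_integrable[OF H10_L2[OF \<phi>(1)]])
  have iw: "integrable (cube 1 1) (\<lambda>z. (cmod (weak_deriv 1 1 0 \<phi> z))\<^sup>2)"
    by (rule L2_integrable[OF weak_deriv_L2[OF \<phi>(1) zero_less_one]])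
  have "0 \<le> (LINT z|cube 1 1. ((cmod (\<phi> z))\<^sup>2 - 1)\<^sup>2)" by (intro integral_nonneg_AE) auto
  also have "\<dots> = (LINT z|cube 1 1. (cmod (\<phi> z)) ^ 4 - 2 * (cmod (\<phi> z))\<^sup>2 + 1)"
    by (intro Bochner_Integration.integral_cong refl) (simp add: power2_diff flip: power_mult)
  also have "\<dots> = (LINT z|cube 1 1. (cmod (\<phi> z)) ^ 4) - 2 * (LINT z|cube 1 1. (cmod (\<phi> z))\<^sup>2) + (LINT z|cube 1 1. 1)"
    using i4 i2 C.integrable_const[of "1::real"] by simp
  finally have four: "1 \<le> (LINT z|cube 1 1. (cmod (\<phi> z)) ^ 4)" using \<phi>(2) one unfolding L2_norm_sq by simp
  have "x = (LINT z|cube 1 1. (cmod (weak_deriv 1 1 0 \<phi> z))\<^sup>2) + K / 2 * (LINT z|cube 1 1. (cmod (\<phi> z)) ^ 4)"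
    unfolding x using iw i4 by simp
  moreover have "0 \<le> (LINT z|cube 1 1. (cmod (weak_deriv 1 1 0 \<phi> z))\<^sup>2)" by (intro integral_nonneg_AE) auto
  moreover have "K / 2 * 1 \<le> K / 2 * (LINT z|cube 1 1. (cmod (\<phi> z)) ^ 4)"
    using four assms by (intro mult_left_mono) auto
  ultimately show "K / 2 \<le> x" by linarith
qed


section \<open>Long cells of the Poisson process\<close>

lemma locally_finite_preimage:
  fixes y :: "int \<Rightarrow> real"
  assumes "strict_mono y" "finite (range y \<inter> B)" shows "finite {j. y j \<in> B}"
proof -
  have "inj_on y {j. y j \<in> B}" by (rule inj_on_subset[OF strict_mono_imp_inj_on[OF assms(1)] subset_UNIV])
  moreover have "y ` {j. y j \<in> B} \<subseteq> range y \<inter> B" by auto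
  ultimately show ?thesis using assms(2) finite_imageD finite_subset by metis
qed

lemma cell_length_nonneg: "0 \<le> cell_length \<rho> s y N j"
  by (simp add: cell_length_def)

text \<open>The hypotheses are in the unscaled coordinates of the process, where the window has
  half-length \<open>s * (N / \<rho>) / 2\<close>. They keep the gap inside the window, so that
  truncation costs nothing, and rescaling turns \<open>h\<close> into \<open>h / s\<close>.\<close>

lemma cell_length_ge:
  assumes "s > 0" "0 \<le> h" "y j \<le> a" "a + h \<le> y (j + 1)" "- (s * (N / \<rho>) / 2) \<le> a" "a + h \<le> s * (N / \<rho>) / 2"
  shows "h / s \<le> cell_length \<rho> s y N j"
proof -
  have "h / s = measure lborel {a / s<..<(a + h) / s}"
    using assms(1,2) by (simp add: divide_right_mono diff_divide_distrib[symmetric])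
  also have "\<dots> \<le> measure lborel (cell \<rho> s y N j)"
  proof (rule measure_mono_fmeasurable)
    have "{a / s<..<(a + h) / s} \<subseteq> {inverse s * y j<..<inverse s * y (j + 1)}"
      using assms(1,3,4) by (auto simp: field_simps)
    moreover have "{a / s<..<(a + h) / s} \<subseteq> window \<rho> N"
    proof -
      have "- (N / \<rho>) / 2 \<le> a / s" "(a + h) / s \<le> (N / \<rho>) / 2"
        using assms(1,5,6) by (simp_all add: pos_le_divide_eq pos_divide_le_eq mult.commute)
      then show ?thesis unfolding window_def by auto
    qed
    ultimately show "{a / s<..<(a + h) / s} \<subseteq> cell \<rho> s y N j" unfolding cell_def by blast
    show "cell \<rho> s y N j \<in> fmeasurable lborel"
    proof (rule fmeasurableI)
      show "cell \<rho> s y N j \<in> sets lborel" by (simp add: cell_def window_def)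
      have "bounded (cell \<rho> s y N j)" unfolding cell_def by (intro bounded_Int disjI1) simp
      then show "emeasure lborel (cell \<rho> s y N j) < \<infinity>" by (rule emeasure_bounded_finite)
    qed
  qed simp
  finally show ?thesis unfolding cell_length_def .
qed

text \<open>Makes \<open>Max\<close> of the lengths a genuine maximum. A cell of nonzero length has
  an endpoint in the closed window or extends beyond it on both sides; local finiteness handles the
  first kind, and at most one cell is of the second.\<close>

lemma finite_range_cell_length:
  assumes y: "strict_mono y" and fin: "\<And>B. bounded B \<Longrightarrow> finite (range y \<inter> B)" and s: "s > 0" and "\<rho> > 0"
  shows "finite (range (cell_length \<rho> s y N))"
proof -
  define T where "T = s * (N / \<rho>) / 2"
  have T: "0 \<le> T" using s \<open>\<rho> > 0\<close> by (simp add: T_def)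
  let ?B = "{-T..T}"
  let ?S1 = "{j. y j \<in> ?B}" and ?S2 = "{j. y (j + 1) \<in> ?B}" and ?S3 = "{j. y j < - T \<and> T < y (j + 1)}"
  have 1: "finite ?S1" by (rule locally_finite_preimage[OF y fin]) simp
  have "?S2 \<subseteq> (\<lambda>j. j - 1) ` ?S1"
  proof
    fix j assume "j \<in> ?S2"
    then show "j \<in> (\<lambda>j. j - 1) ` ?S1" by (intro image_eqI[where x = "j + 1"]) auto
  qed
  then have 2: "finite ?S2" using finite_imageI[OF 1] by (rule finite_subset)
  have 3: "finite ?S3"
  proof (cases "?S3 = {}")
    case False
    then obtain a where a: "y a < - T" "T < y (a + 1)" by auto
    have "b = a" if b: "y b < - T" "T < y (b + 1)" for b
    proof (rule ccontr)
      assume "b \<noteq> a"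
      then have "b + 1 \<le> a \<or> a + 1 \<le> b" by linarith
      then have "y (b + 1) \<le> y a \<or> y (a + 1) \<le> y b" using y by (auto simp: strict_mono_less_eq)
      then show False using a b T by linarith
    qed
    then have "?S3 \<subseteq> {a}" by auto
    then show ?thesis by (rule finite_subset) simp
  qed (simp only: finite.emptyI)
  have zero: "cell_length \<rho> s y N j = 0" if "j \<notin> ?S1 \<union> ?S2 \<union> ?S3" for j
  proof -
    have "y j < y (j + 1)" using y by (simp add: strict_mono_less)
    then have "T \<le> y j \<or> y (j + 1) \<le> - T" using that by auto
    moreover have "T / s = (N / \<rho>) / 2" using s by (simp add: T_def)
    ultimately have "(N / \<rho>) / 2 \<le> y j / s \<or> y (j + 1) / s \<le> - ((N / \<rho>) / 2)"
      using s divide_right_mono[of T "y j" s] divide_right_mono[of "y (j + 1)" "- T" s] by auto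
    then have "cell \<rho> s y N j = {}"
      unfolding cell_def window_def by (auto simp: inverse_eq_divide)
    then show ?thesis by (simp add: cell_length_def)
  qed
  have "range (cell_length \<rho> s y N) \<subseteq> insert 0 (cell_length \<rho> s y N ` (?S1 \<union> ?S2 \<union> ?S3))"
    using zero by blast
  then show ?thesis using 1 2 3 by (meson finite_UnI finite_imageI finite_insert finite_subset)
qed

text \<open>The last point before \<open>a\<close> starts the cell that covers the gap. The point
  \<open>y i\<close> guarantees that such a point exists and that it does not lie before
  \<open>b\<close>.\<close>

lemma gap_cell:
  fixes y :: "int \<Rightarrow> real"
  assumes y: "strict_mono y" and fin: "\<And>B. bounded B \<Longrightarrow> finite (range y \<inter> B)"
    and pt: "y i \<in> {b..<a}" and empty: "range y \<inter> {a..<a + h} = {}"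
  shows "\<exists>j. b \<le> y j \<and> y j < a \<and> a + h \<le> y (j + 1)"
proof -
  let ?S = "{j. y j \<in> {b..<a}}"
  have f: "finite ?S" by (rule locally_finite_preimage[OF y fin]) simp
  have ne: "?S \<noteq> {}" using pt by blast
  define j where "j = Max ?S"
  have "j \<in> ?S" unfolding j_def by (rule Max_in[OF f ne])
  then have j: "b \<le> y j" "y j < a" by auto
  have lt: "y j < y (j + 1)" using y by (simp add: strict_mono_less)
  have "a \<le> y (j + 1)"
  proof (rule ccontr)
    assume "\<not> ?thesis"
    then have "j + 1 \<in> ?S" using j lt by auto
    then have "j + 1 \<le> j" unfolding j_def by (rule Max_ge[OF f])
    then show False by simp
  qed
  moreover have "y (j + 1) \<notin> {a..<a + h}" using empty by blast
  ultimately show ?thesis using j by (intro exI[of _ j]) auto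
qed

text \<open>The point required in the separator of length \<open>sep\<close> at the start of each group makes the gaps
  found in different groups belong to different cells.\<close>
definition bad_groups :: "(nat \<Rightarrow> real) \<Rightarrow> real \<Rightarrow> real \<Rightarrow> nat \<Rightarrow> nat \<Rightarrow> real set \<Rightarrow> bool" where
  "bad_groups b sep h r m X \<longleftrightarrow> (\<exists>k<m. card (X \<inter> {b k..<b k + sep}) = 0 \<or>
     (\<forall>i<r. card (X \<inter> {b k + sep + real i * h..<b k + sep + (real i + 1) * h}) \<noteq> 0))"

text \<open>A union bound over the groups. Inside a group the \<open>r\<close> windows are disjoint,
  hence independent, and each is free of points with probability \<open>exp (- (\<nu> * h))\<close>;
  that none is free has probability \<open>(1 - exp (- (\<nu> * h))) ^ r\<close>, estimated by
  \<open>1 - u \<le> exp (- u)\<close>.\<close>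

lemma bad_groups_prob:
  assumes "prob_space P" and pp: "poisson_process P \<nu> X" and sep: "0 \<le> sep" and h: "0 \<le> h" and r: "r > 0"
    and "0 < \<nu>"
  shows "{\<omega> \<in> space P. bad_groups b sep h r m (X \<omega>)} \<in> sets P"
    and "measure P {\<omega> \<in> space P. bad_groups b sep h r m (X \<omega>)} \<le> m * (exp (- (\<nu> * sep)) + exp (- (r * exp (- (\<nu> * h)))))"
proof -
  interpret prob_space P by fact
  define S where "S k = {b k..<b k + sep}" for k
  define A where "A k i = {b k + sep + real i * h..<b k + sep + (real i + 1) * h}" for k i :: nat
  have meas: "(\<lambda>\<omega>. card (X \<omega> \<inter> B)) \<in> measurable P (count_space UNIV)" if "B \<in> sets borel" "bounded B" for B
    using pp that unfolding poisson_process_def by blast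
  have p0: "prob {\<omega> \<in> space P. card (X \<omega> \<inter> {u..<u + d}) = 0} = exp (- (\<nu> * d))" if "0 \<le> d" for u d
  proof -
    have "\<forall>k. prob {\<omega> \<in> space P. card (X \<omega> \<inter> {u..<u + d}) = k} =
           exp (- (\<nu> * measure lborel {u..<u + d})) * (\<nu> * measure lborel {u..<u + d}) ^ k / fact k"
      using pp unfolding poisson_process_def by auto
    from this[rule_format, of 0] show ?thesis using that by simp
  qed
  have mS: "(\<lambda>\<omega>. card (X \<omega> \<inter> S k)) \<in> measurable P (count_space UNIV)" for k
    unfolding S_def by (rule meas) auto
  have mA: "(\<lambda>\<omega>. card (X \<omega> \<inter> A k i)) \<in> measurable P (count_space UNIV)" for k i
    unfolding A_def by (rule meas) auto
  note [measurable] = mS mA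
  define E where "E k = {\<omega> \<in> space P. card (X \<omega> \<inter> S k) = 0}" for k
  define F where "F k = {\<omega> \<in> space P. \<forall>i<r. card (X \<omega> \<inter> A k i) \<noteq> 0}" for k
  have E: "E k \<in> events" for k unfolding E_def by measurable
  have F: "F k \<in> events" for k unfolding F_def by measurable
  have eq: "{\<omega> \<in> space P. bad_groups b sep h r m (X \<omega>)} = (\<Union>k<m. E k \<union> F k)"
    unfolding bad_groups_def E_def F_def S_def A_def by auto
  show "{\<omega> \<in> space P. bad_groups b sep h r m (X \<omega>)} \<in> sets P" unfolding eq using E F by auto
  have pE: "prob (E k) = exp (- (\<nu> * sep))" for k unfolding E_def S_def by (rule p0[OF sep])
  have pF: "prob (F k) \<le> exp (- (r * exp (- (\<nu> * h))))" for k
  proof -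
    have "disjoint_family_on (A k) {..<r}"
      unfolding disjoint_family_on_def
    proof (intro ballI impI)
      fix i j :: nat assume "i \<noteq> j"
      then have "i + 1 \<le> j \<or> j + 1 \<le> i" by linarith
      then have "real i + 1 \<le> real j \<or> real j + 1 \<le> real i" by linarith
      then have "(real i + 1) * h \<le> real j * h \<or> (real j + 1) * h \<le> real i * h"
        using h mult_right_mono by blast
      then show "A k i \<inter> A k j = {}" unfolding A_def by auto
    qed
    moreover have "\<forall>i<r. A k i \<in> sets borel \<and> bounded (A k i)" unfolding A_def by auto
    ultimately have ind: "indep_vars (\<lambda>_. count_space UNIV) (\<lambda>i \<omega>. card (X \<omega> \<inter> A k i)) {..<r}"
      using pp unfolding poisson_process_def by blast
    have "F k = (\<Inter>i\<in>{..<r}. (\<lambda>\<omega>. card (X \<omega> \<inter> A k i)) -` {0<..} \<inter> space P)"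
      unfolding F_def using r by auto
    also have "prob \<dots> = (\<Prod>i<r. prob ((\<lambda>\<omega>. card (X \<omega> \<inter> A k i)) -` {0<..} \<inter> space P))"
      using r by (intro indep_varsD[OF ind]) auto
    also have "\<dots> = (\<Prod>i<r. 1 - exp (- (\<nu> * h)))"
    proof (intro prod.cong refl)
      fix i
      have Aeq: "A k i = {(b k + sep + i * h)..<(b k + sep + i * h) + h}" unfolding A_def by (simp add: algebra_simps)
      have "prob ((\<lambda>\<omega>. card (X \<omega> \<inter> A k i)) -` {0<..} \<inter> space P) = prob (space P - {\<omega> \<in> space P. card (X \<omega> \<inter> A k i) = 0})"
        by (rule arg_cong[where f = prob]) auto
      also have "\<dots> = 1 - prob {\<omega> \<in> space P. card (X \<omega> \<inter> A k i) = 0}" by (intro prob_compl) measurable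
      finally show "prob ((\<lambda>\<omega>. card (X \<omega> \<inter> A k i)) -` {0<..} \<inter> space P) = 1 - exp (- (\<nu> * h))"
        unfolding Aeq p0[OF h] .
    qed
    also have "\<dots> = (1 - exp (- (\<nu> * h))) ^ r" by simp
    also have "\<dots> \<le> exp (- exp (- (\<nu> * h))) ^ r"
      using exp_ge_add_one_self[of "- exp (- (\<nu> * h))"] h \<open>0 < \<nu>\<close> by (intro power_mono) auto
    also have "\<dots> = exp (- (r * exp (- (\<nu> * h))))" by (simp flip: exp_of_nat_mult)
    finally show ?thesis .
  qed
  have "prob (\<Union>k<m. E k \<union> F k) \<le> (\<Sum>k<m. prob (E k \<union> F k))"
    using E F by (intro finite_measure_subadditive_finite) auto
  also have "\<dots> \<le> (\<Sum>k<m. exp (- (\<nu> * sep)) + exp (- (r * exp (- (\<nu> * h)))))"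
  proof (rule sum_mono)
    fix k
    have "prob (E k \<union> F k) \<le> prob (E k) + prob (F k)" by (rule measure_Un_le[OF E F])
    then show "prob (E k \<union> F k) \<le> exp (- (\<nu> * sep)) + exp (- (r * exp (- (\<nu> * h))))" using pE pF[of k] by simp
  qed
  finally show "measure P {\<omega> \<in> space P. bad_groups b sep h r m (X \<omega>)} \<le> m * (exp (- (\<nu> * sep)) + exp (- (r * exp (- (\<nu> * h)))))"
    unfolding eq by simp
qed

text \<open>In each group the separator contains a point, so the cell found has its left endpoint in
  that same group. Groups are disjoint, so different groups yield different indices, and
  \<open>m\<close> groups yield \<open>m\<close> cells.\<close>

lemma good_groups_cells:
  fixes y :: "int \<Rightarrow> real" and t G sep h :: real
  assumes y: "strict_mono y" and fin: "\<And>B. bounded B \<Longrightarrow> finite (range y \<inter> B)"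
    and good: "\<not> bad_groups (\<lambda>k. t + k * G) sep h r m (range y)" and G: "sep + r * h \<le> G" and sh: "0 \<le> sep" "0 \<le> h"
  shows "\<exists>J. finite J \<and> card J = m \<and> (\<forall>j\<in>J. \<exists>a. t \<le> a \<and> a + h \<le> t + m * G \<and> y j \<le> a \<and> a + h \<le> y (j + 1))"
proof -
  have G0: "0 \<le> G" using G sh by (meson add_nonneg_nonneg mult_nonneg_nonneg of_nat_0_le_iff order_trans)
  have ex: "\<exists>j a. t + k * G \<le> y j \<and> y j < t + (real k + 1) * G \<and> t \<le> a \<and> a + h \<le> t + m * G \<and> y j \<le> a \<and> a + h \<le> y (j + 1)"
    if k: "k < m" for k
  proof -
    define b where "b = t + k * G"
    have c0: "card (range y \<inter> {b..<b + sep}) \<noteq> 0"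
      and "\<exists>i<r. card (range y \<inter> {b + sep + real i * h..<b + sep + (real i + 1) * h}) = 0"
      using good k unfolding bad_groups_def b_def by auto
    then obtain i where i: "i < r" "card (range y \<inter> {b + sep + real i * h..<b + sep + (real i + 1) * h}) = 0" by blast
    define a where "a = b + sep + i * h"
    \<comment> \<open>A cardinality 0 is also assigned to infinite sets, so emptiness rests on local
      finiteness.\<close>
    have "range y \<inter> {a..<a + h} = {}"
    proof -
      have "finite (range y \<inter> {a..<a + h})" by (rule fin) simp
      moreover have "card (range y \<inter> {a..<a + h}) = 0" using i(2) by (simp add: a_def algebra_simps)
      ultimately show ?thesis by simp
    qed
    moreover obtain i0 where "y i0 \<in> {b..<b + sep}" using c0 by (metis card.empty disjoint_iff rangeE)
    then have "y i0 \<in> {b..<a}" using sh by (auto simp: a_def add_increasing2 intro: less_le_trans)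
    ultimately obtain j where j: "b \<le> y j" "y j < a" "a + h \<le> y (j + 1)"
      using gap_cell[OF y fin] by blast
    have "(real i + 1) * h \<le> r * h" using i(1) sh by (intro mult_right_mono) auto
    then have aG: "a + h \<le> b + G" using G by (simp add: a_def algebra_simps)
    have bt: "t \<le> b" using G0 by (simp add: b_def)
    have "(real k + 1) * G \<le> m * G" using k G0 by (intro mult_right_mono) auto
    then have bG: "b + G \<le> t + m * G" by (simp add: b_def algebra_simps)
    have e: "b + G = t + (real k + 1) * G" by (simp add: b_def algebra_simps)
    have "y j < t + (real k + 1) * G" using j(2) aG sh e by linarith
    moreover have "t \<le> a" using bt sh mult_nonneg_nonneg[of "real i" h] unfolding a_def by linarith
    moreover have "a + h \<le> t + m * G" using aG bG by linarith
    ultimately show ?thesis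
      using j unfolding b_def[symmetric] by (intro exI[of _ j] exI[of _ a]) simp
  qed
  then have "\<forall>k\<in>{..<m}. \<exists>j. \<exists>a. t + k * G \<le> y j \<and> y j < t + (real k + 1) * G \<and> t \<le> a \<and> a + h \<le> t + m * G \<and> y j \<le> a \<and> a + h \<le> y (j + 1)"
    by auto
  then obtain f where f: "\<And>k. k < m \<Longrightarrow> \<exists>a. t + k * G \<le> y (f k) \<and> y (f k) < t + (real k + 1) * G \<and> t \<le> a \<and> a + h \<le> t + m * G \<and> y (f k) \<le> a \<and> a + h \<le> y (f k + 1)"
    by (metis bchoice lessThan_iff)
  have less: "f k \<noteq> f k'" if "k < k'" "k' < m" for k k'
  proof
    assume "f k = f k'"
    moreover have "(real k + 1) * G \<le> k' * G" using that(1) G0 by (intro mult_right_mono) auto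
    ultimately show False using f[of k] f[of k'] that by (auto simp: algebra_simps)
  qed
  have "inj_on f {..<m}" by (rule linorder_inj_onI') (use less in auto)
  then have "card (f ` {..<m}) = m" by (simp add: card_image)
  moreover have "\<exists>a. t \<le> a \<and> a + h \<le> t + m * G \<and> y j \<le> a \<and> a + h \<le> y (j + 1)" if jf: "j \<in> f ` {..<m}" for j
  proof -
    obtain k where k: "k < m" "j = f k" using jf by auto
    show ?thesis using f[OF k(1)] unfolding k(2)[symmetric] by metis
  qed
  ultimately show ?thesis by (intro exI[of _ "f ` {..<m}"]) simp
qed

text \<open>The choice of \<open>h\<close> makes a window free of points with probability
  \<open>N powr (- c)\<close>, so that all of about \<open>3 * N powr c * ln N\<close> windows of a
  group are hit with probability at most \<open>1 / N ^ 3\<close>; \<open>sep\<close> gives the same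
  probability to an empty separator. With at most \<open>N\<close> groups the bad event has
  probability at most \<open>2 / N ^ 2\<close>, and Borel-Cantelli applies. The group length
  \<open>G\<close> has room for the separator and the windows, and the count of cells is the number
  of groups that fit into the window.\<close>

lemma eventually_many_long_cells:
  fixes P :: "'w measure" and x :: "'w \<Rightarrow> int \<Rightarrow> real" and s :: "nat \<Rightarrow> real"
  assumes P: "prob_space P" and pp: "poisson_process P \<nu> (\<lambda>\<omega>. range (x \<omega>))"
    and mono: "AE \<omega> in P. strict_mono (x \<omega>)" and \<nu>: "\<nu> > 0" and \<rho>: "\<rho> > 0"
    and s: "\<And>N. N \<ge> 1 \<Longrightarrow> 0 < s N \<and> s N \<le> 1" and c: "0 < c" "c \<le> 1 / 6"
  shows "AE \<omega> in P. \<forall>\<^sub>F N in sequentially. \<exists>J. finite J \<and>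
    card J = nat \<lfloor>\<nu> * s N * real N powr (1 - c) / (\<rho> * (ln (real N))\<^sup>2)\<rfloor> \<and>
    (\<forall>j\<in>J. c * ln (real N) / (\<nu> * s N) \<le> cell_length \<rho> (s N) (x \<omega>) N j)"
proof -
  interpret prob_space P by fact
  define L where "L N = ln (real N)" for N
  define h where "h N = c * L N / \<nu>" for N
  define sep where "sep N = 3 * L N / \<nu>" for N
  define r where "r N = nat \<lceil>3 * real N powr c * L N\<rceil>" for N
  define G where "G N = real N powr c * (L N)\<^sup>2 / \<nu>" for N
  define T where "T N = s N * (real N / \<rho>)" for N
  define m where "m N = nat \<lfloor>T N / G N\<rfloor>" for N
  define bad where "bad N = {\<omega> \<in> space P. bad_groups (\<lambda>k. - T N / 2 + k * G N) (sep N) (h N) (r N) (m N) (range (x \<omega>))}" for N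
  \<comment> \<open>With \<open>q = N powr c * ln N\<close>, a group has enough room if
    \<open>3 + c * r \<le> q\<close>; since \<open>c \<le> 1 / 6\<close> gives
    \<open>c * r \<le> q / 2 + 1 / 6\<close>, the bound \<open>7 \<le> q\<close> suffices. The next
    condition keeps the number of groups at most \<open>N\<close>.\<close>
  have "\<forall>\<^sub>F N in sequentially. 7 \<le> real N powr c * ln (real N)" using c by real_asymp
  moreover have "\<forall>\<^sub>F N in sequentially. \<nu> \<le> \<rho> * (real N powr c * (ln (real N))\<^sup>2)" using c \<rho> by real_asymp
  ultimately have "\<forall>\<^sub>F N in sequentially. 7 \<le> real N powr c * L N \<and> \<nu> \<le> \<rho> * (real N powr c * (L N)\<^sup>2) \<and> 3 \<le> N"
    using eventually_ge_at_top[of 3] unfolding L_def by eventually_elim simp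
  then obtain N0 where N0: "\<And>N. N \<ge> N0 \<Longrightarrow> 7 \<le> real N powr c * L N \<and> \<nu> \<le> \<rho> * (real N powr c * (L N)\<^sup>2) \<and> 3 \<le> N"
    unfolding eventually_sequentially by blast
  have L0: "0 < L N" if "N \<ge> N0" for N using N0[OF that] by (simp add: L_def)
  have G0: "0 < G N" if "N \<ge> N0" for N using N0[OF that] L0[OF that] \<nu> by (simp add: G_def)
  have sepr: "sep N + r N * h N \<le> G N" if N: "N \<ge> N0" for N
  proof -
    define q where "q = real N powr c * L N"
    have q: "7 \<le> q" using N0[OF N] by (simp add: q_def)
    have "r N = nat \<lceil>3 * q\<rceil>" by (simp add: r_def q_def mult.assoc)
    then have "r N \<le> 3 * q + 1" using q by linarith
    then have "c * r N \<le> c * (3 * q + 1)" using c by (intro mult_left_mono) auto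
    also have "\<dots> \<le> 1 / 6 * (3 * q + 1)" using c q by (intro mult_right_mono) auto
    finally have "c * r N \<le> q / 2 + 1 / 6" by simp
    moreover have "3 + (q / 2 + 1 / 6) \<le> q" using q by simp
    ultimately have "3 + c * r N \<le> q" by (rule order_trans[OF add_left_mono])
    then have "L N / \<nu> * (3 + c * r N) \<le> L N / \<nu> * q" using L0[OF N] \<nu> by (intro mult_left_mono) auto
    then show ?thesis by (simp add: sep_def h_def G_def q_def power2_eq_square add_divide_distrib algebra_simps)
  qed
  have rpos: "r N > 0" if N: "N \<ge> N0" for N
    using N0[OF N] unfolding r_def by (simp add: mult.assoc)
  have pos: "0 \<le> sep N" "0 \<le> h N" if N: "N \<ge> N0" for N
    using L0[OF N] c \<nu> by (simp_all add: sep_def h_def)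
  have bad_meas: "bad N \<in> events" if N: "N \<ge> N0" for N
    unfolding bad_def by (rule bad_groups_prob(1)[OF P pp pos(1)[OF N] pos(2)[OF N] rpos[OF N] \<nu>])
  have bad_prob: "prob (bad N) \<le> 2 * (1 / real N ^ 2)" if N: "N \<ge> N0" for N
  proof -
    have Npos: "real N > 0" using N0[OF N] by simp
    have "prob (bad N) \<le> m N * (exp (- (\<nu> * sep N)) + exp (- (r N * exp (- (\<nu> * h N)))))"
      unfolding bad_def by (rule bad_groups_prob(2)[OF P pp pos(1)[OF N] pos(2)[OF N] rpos[OF N] \<nu>])
    also have "\<dots> \<le> real N * (1 / real N ^ 3 + 1 / real N ^ 3)"
    proof (intro mult_mono add_mono)
      have e3: "exp (- (3 * L N)) = 1 / real N ^ 3"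
        using Npos by (simp add: L_def exp_minus exp_of_nat_mult[of 3, simplified] inverse_eq_divide)
      show "exp (- (\<nu> * sep N)) \<le> 1 / real N ^ 3" using \<nu> e3 by (simp add: sep_def)
      have "exp (- (\<nu> * h N)) = real N powr (- c)" using \<nu> Npos by (simp add: h_def L_def powr_def)
      moreover have "3 * L N \<le> r N * real N powr (- c)"
      proof -
        have "3 * real N powr c * L N \<le> r N" unfolding r_def by linarith
        then have "3 * real N powr c * L N * real N powr (- c) \<le> r N * real N powr (- c)" by (rule mult_right_mono) simp
        moreover have "real N powr c * real N powr (- c) = 1" using Npos by (simp flip: powr_add)
        then have "3 * real N powr c * L N * real N powr (- c) = 3 * L N" by (simp add: algebra_simps)
        ultimately show ?thesis by simp
      qed
      ultimately have "exp (- (r N * exp (- (\<nu> * h N)))) \<le> exp (- (3 * L N))" by simp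
      then show "exp (- (r N * exp (- (\<nu> * h N)))) \<le> 1 / real N ^ 3" unfolding e3 .
      have "T N / G N \<le> real N"
      proof -
        have "s N \<le> 1" using s[of N] N0[OF N] by simp
        have "T N * \<nu> = s N * real N * \<nu> / \<rho>" by (simp add: T_def)
        also have "\<dots> \<le> 1 * real N * (\<rho> * (real N powr c * (L N)\<^sup>2)) / \<rho>"
          using N0[OF N] \<open>s N \<le> 1\<close> \<nu> \<rho> s[of N] by (intro divide_right_mono mult_mono) auto
        also have "\<dots> = real N * G N * \<nu>" using \<rho> \<nu> by (simp add: G_def)
        finally have "T N \<le> real N * G N" using \<nu> by simp
        then show ?thesis using G0[OF N] by (simp add: pos_divide_le_eq)
      qed
      moreover have "0 \<le> T N / G N" using G0[OF N] s[of N] N0[OF N] \<rho> by (simp add: T_def less_imp_le)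
      ultimately show "real (m N) \<le> real N" unfolding m_def by linarith
    qed auto
    also have "\<dots> = 2 * (1 / real N ^ 2)" using Npos by (simp add: field_simps power2_eq_square power3_eq_cube)
    finally show ?thesis .
  qed
  \<comment> \<open>The estimates start at \<open>N0\<close>, whereas Borel-Cantelli asks for
    measurability of every event of the sequence.\<close>
  define bad' where "bad' N = (if N \<ge> N0 then bad N else {})" for N
  have "AE \<omega> in P. \<forall>\<^sub>F N in sequentially. \<omega> \<in> space P - bad' N"
  proof (rule borel_cantelli_AE1)
    show "bad' N \<in> events" for N using bad_meas by (simp add: bad'_def)
    show "emeasure P (bad' N) < \<infinity>" for N using emeasure_finite[of "bad' N"] by (simp add: less_top[symmetric] top.not_eq_extremum)
    show "summable (\<lambda>N. prob (bad' N))"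
    proof (rule summable_comparison_test'[where N = 0])
      show "summable (\<lambda>N. 2 * (1 / real N ^ 2))" by (intro summable_mult inverse_power_summable[of 2, unfolded inverse_eq_divide power_one_over]) simp
      show "norm (prob (bad' N)) \<le> 2 * (1 / real N ^ 2)" for N using bad_prob[of N] by (auto simp: bad'_def)
    qed
  qed
  moreover have "AE \<omega> in P. \<forall>B. bounded B \<longrightarrow> finite (range (x \<omega>) \<inter> B)"
    using pp by (simp add: poisson_process_def)
  ultimately show ?thesis using mono
  proof eventually_elim
    case (elim \<omega>)
    from elim(1) eventually_ge_at_top[of N0] show ?case
    proof eventually_elim
      case N: (elim N)
      then have "\<not> bad_groups (\<lambda>k. - T N / 2 + k * G N) (sep N) (h N) (r N) (m N) (range (x \<omega>))"
        by (auto simp: bad'_def bad_def)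
      from good_groups_cells[OF elim(3) elim(2)[rule_format] this sepr[OF N(2)] pos[OF N(2)]]
      obtain J where J: "finite J" "card J = m N" "\<And>j. j \<in> J \<Longrightarrow>
          \<exists>a. - T N / 2 \<le> a \<and> a + h N \<le> - T N / 2 + m N * G N \<and> x \<omega> j \<le> a \<and> a + h N \<le> x \<omega> (j + 1)"
        by blast
      have sN: "0 < s N" using s[of N] N0[OF N(2)] by simp
      have Npos: "real N > 0" using N0[OF N(2)] by simp
      have "0 \<le> T N / G N" using G0[OF N(2)] sN \<rho> by (simp add: T_def less_imp_le)
      then have "m N \<le> T N / G N" unfolding m_def by linarith
      then have mG: "m N * G N \<le> T N" using G0[OF N(2)] by (simp add: pos_le_divide_eq)
      have "c * ln (real N) / (\<nu> * s N) \<le> cell_length \<rho> (s N) (x \<omega>) N j" if j: "j \<in> J" for j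
      proof -
        obtain a where a: "- T N / 2 \<le> a" "a + h N \<le> - T N / 2 + m N * G N" "x \<omega> j \<le> a" "a + h N \<le> x \<omega> (j + 1)"
          using J(3)[OF j] by blast
        have "h N / s N \<le> cell_length \<rho> (s N) (x \<omega>) N j"
          using a mG by (intro cell_length_ge[OF sN pos(2)[OF N(2)] a(3,4)]) (auto simp: T_def)
        then show ?thesis by (simp add: h_def L_def)
      qed
      moreover have "T N / G N = \<nu> * s N * real N powr (1 - c) / (\<rho> * (ln (real N))\<^sup>2)"
        using Npos by (simp add: T_def G_def L_def powr_diff mult_ac)
      ultimately show ?case using J(1,2) unfolding m_def by (intro exI[of _ J]) simp
    qed
  qed
qed


section \<open>Occupation numbers of the ground state\<close>

text \<open>Division with remainder: every cell receives \<open>N div card J\<close>, and the first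
  \<open>N mod card J\<close> in an enumeration receive one more; this rounding is the
  \<open>+ 1\<close> in the bound.\<close>

lemma distribute_evenly:
  assumes "finite J" "J \<noteq> {}"
  shows "\<exists>M::'a \<Rightarrow> nat. (\<forall>j. j \<notin> J \<longrightarrow> M j = 0) \<and> (\<Sum>j\<in>J. M j) = N \<and> (\<forall>j. real (M j) \<le> N / card J + 1)"
proof -
  obtain e where e: "bij_betw e J {0..<card J}" using ex_bij_betw_finite_nat[OF assms(1)] by blast
  have c: "card J > 0" using assms by (simp add: card_gt_0_iff)
  define q r where "q = N div card J" and "r = N mod card J"
  define M where "M j = (if j \<in> J then q + (if e j < r then 1 else 0) else 0)" for j
  have "(\<Sum>j\<in>J. M j) = (\<Sum>j\<in>J. q + (if e j < r then 1 else 0))" by (rule sum.cong) (auto simp: M_def)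
  also have "\<dots> = (\<Sum>i=0..<card J. q + (if i < r then 1 else 0))"
    by (rule sum.reindex_bij_betw[OF e, of "\<lambda>i. q + (if i < r then 1 else 0)"])
  also have "\<dots> = card J * q + card {i \<in> {0..<card J}. i < r}"
    by (simp add: sum.distrib sum.If_cases Int_def)
  also have "{i \<in> {0..<card J}. i < r} = {0..<r}" using c by (auto simp: r_def intro: less_trans[OF _ mod_less_divisor])
  finally have total: "(\<Sum>j\<in>J. M j) = N" by (simp add: q_def r_def)
  have bound: "real (M j) \<le> N / card J + 1" for j
  proof -
    have "real q \<le> N / card J" unfolding q_def by (rule of_nat_div_le_of_nat)
    moreover have "M j \<le> q + 1" by (simp add: M_def)
    then have "real (M j) \<le> real q + 1" by linarith
    ultimately show ?thesis by linarith
  qed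
  have zero: "M j = 0" if "j \<notin> J" for j using that by (simp add: M_def)
  have "(\<forall>j. j \<notin> J \<longrightarrow> M j = 0) \<and> (\<Sum>j\<in>J. M j) = N \<and> (\<forall>j. real (M j) \<le> N / card J + 1)"
    using zero total bound by simp
  then show ?thesis by (rule exI[of _ M])
qed

lemma admissible_len_pos:
  assumes "admissible len N M" "M j \<noteq> 0" "0 \<le> len j"
  shows "0 < len j"
proof -
  have "len j = 0 \<longrightarrow> M j = 0" using assms(1)[unfolded admissible_def, THEN conjunct1] by (rule spec)
  then show ?thesis using assms(2,3) by simp
qed

lemma total_energy_nonneg:
  assumes "\<And>j. 0 \<le> len j" "0 \<le> g" "admissible len N M"
  shows "0 \<le> total_energy len g M"
  unfolding total_energy_def
proof (rule sum_nonneg)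
  fix j assume "j \<in> {j. M j \<noteq> 0}"
  then have "len j > 0" by (intro admissible_len_pos[OF assms(3) _ assms(1)]) simp
  then show "0 \<le> E0_QM (M j) (len j) g" by (rule E0_QM_nonneg[OF _ assms(2)])
qed

text \<open>An even occupation of \<open>J\<close> serves as competitor. The single-cell bound
  decreases with the length, so every length may be lowered to \<open>l\<close>. One factor of
  \<open>(M j)\<^sup>2\<close> is at most \<open>N / card J + 1\<close>, and the other adds up to
  \<open>N\<close>.\<close>

lemma E_LS_QM_upper:
  assumes len: "\<And>j. 0 \<le> len j" and g: "0 \<le> g" and l: "l > 0"
    and J: "finite J" "J \<noteq> {}" "\<And>j. j \<in> J \<Longrightarrow> l \<le> len j"
  shows "E_LS_QM len N g \<le> N * (4608 / l\<^sup>2 + 18 * g * (N / card J + 1) / l)"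
proof -
  define M where "M = (SOME M. (\<forall>j. j \<notin> J \<longrightarrow> M j = 0) \<and> (\<Sum>j\<in>J. M j) = N \<and> (\<forall>j. real (M j) \<le> N / card J + 1))"
  have M0: "(\<forall>j. j \<notin> J \<longrightarrow> M j = 0) \<and> (\<Sum>j\<in>J. M j) = N \<and> (\<forall>j. real (M j) \<le> N / card J + 1)"
    unfolding M_def by (rule someI_ex[OF distribute_evenly[OF J(1,2)]])
  have M1: "M j = 0" if "j \<notin> J" for j
    using spec[OF conjunct1[OF M0], of j] that by (rule mp)
  have M2: "(\<Sum>j\<in>J. M j) = N" by (rule conjunct1[OF conjunct2[OF M0]])
  have M3: "real (M j) \<le> N / card J + 1" for j by (rule spec[OF conjunct2[OF conjunct2[OF M0]]])
  have sub: "{j. M j \<noteq> 0} \<subseteq> J"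
  proof
    fix j assume "j \<in> {j. M j \<noteq> 0}"
    then show "j \<in> J" using M1[of j] by (cases "j \<in> J") simp_all
  qed
  then have fin: "finite {j. M j \<noteq> 0}" using J(1) by (rule finite_subset)
  have sumN: "(\<Sum>j | M j \<noteq> 0. M j) = N"
    unfolding M2[symmetric] by (rule sum.mono_neutral_left[OF J(1) sub]) simp
  have adm: "admissible len N M"
    unfolding admissible_def
  proof (intro conjI allI impI fin sumN)
    fix j assume "len j = 0"
    then have "j \<notin> J" using J(3)[of j] l by auto
    then show "M j = 0" by (rule M1)
  qed
  let ?C = "4608 / l\<^sup>2 + 18 * g * (N / card J + 1) / l"
  have "E_LS_QM len N g \<le> total_energy len g M"
    unfolding E_LS_QM_def using adm total_energy_nonneg[OF len g]
    by (intro cInf_lower bdd_belowI[of _ 0]) auto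
  also have "\<dots> \<le> (\<Sum>j | M j \<noteq> 0. M j * ?C)"
    unfolding total_energy_def
  proof (rule sum_mono)
    fix j assume "j \<in> {j. M j \<noteq> 0}"
    then have lj: "l \<le> len j" by (rule J(3)[OF subsetD[OF sub]])
    have "E0_QM (M j) (len j) g \<le> 4608 * real (M j) / (len j)\<^sup>2 + 18 * g * (real (M j))\<^sup>2 / len j"
      using lj l by (intro E0_QM_upper[OF _ g]) simp
    also have "\<dots> \<le> 4608 * real (M j) / l\<^sup>2 + 18 * g * (real (M j))\<^sup>2 / l"
      using lj l g by (intro add_mono divide_left_mono power_mono) auto
    also have "(real (M j))\<^sup>2 \<le> M j * (N / card J + 1)"
      unfolding power2_eq_square by (rule mult_left_mono[OF M3]) simp
    then have "4608 * real (M j) / l\<^sup>2 + 18 * g * (real (M j))\<^sup>2 / l \<le> 4608 * real (M j) / l\<^sup>2 + 18 * g * (M j * (N / card J + 1)) / l"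
      using g l by (intro add_left_mono divide_right_mono mult_left_mono) auto
    also have "\<dots> = M j * ?C" by (simp add: algebra_simps)
    finally show "E0_QM (M j) (len j) g \<le> M j * ?C" .
  qed
  also have "\<dots> = N * ?C" unfolding sum_distrib_right[symmetric] using sumN by (metis of_nat_sum)
  finally show ?thesis .
qed

text \<open>All single-cell energies are nonnegative, so the most occupied cell alone costs at most
  \<open>U\<close>. The alternatives are: fewer than 8 particles, outside the range of the energy
  bound; a cell so long that the coupling is reduced to \<open>1 / (8 * d)\<close>; and a shorter
  cell, where the full coupling is kept.\<close>

lemma max_occupation_bound:
  assumes len: "\<And>j. 0 \<le> len j" and fin: "finite (range len)" and g: "0 < g" and l: "l > 0"
    and J: "finite J" "J \<noteq> {}" "\<And>j. j \<in> J \<Longrightarrow> l \<le> len j"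
    and gs: "ground_state_occupation len N g M"
    and U: "N * (4608 / l\<^sup>2 + 18 * g * (N / card J + 1) / l) \<le> U"
  defines "R \<equiv> real (Max (range M)) / Max (range len)"
  shows "0 \<le> R \<and> (R \<le> 8 / l \<or> R\<^sup>2 \<le> 128 / 3 * U \<or> R\<^sup>2 \<le> 16 * U / (3 * g * l))"
proof -
  have adm: "admissible len N M" and E: "E_LS_QM len N g = total_energy len g M"
    using gs unfolding ground_state_occupation_def by auto
  have finM: "finite {j. M j \<noteq> 0}" using adm by (simp add: admissible_def)
  have "range M \<subseteq> insert 0 (M ` {j. M j \<noteq> 0})" by auto
  then have "finite (range M)" using finM by (meson finite_imageI finite_insert finite_subset)
  then have "Max (range M) \<in> range M" by (rule Max_in) simp
  then obtain j where j: "M j = Max (range M)" by (metis rangeE)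
  define n where "n = Max (range M)"
  define \<Lambda> where "\<Lambda> = Max (range len)"
  have le\<Lambda>: "len i \<le> \<Lambda>" for i unfolding \<Lambda>_def using fin by (intro Max_ge) auto
  obtain i where "i \<in> J" using J(2) by blast
  then have l\<Lambda>: "l \<le> \<Lambda>" using J(3) le\<Lambda> order_trans by blast
  have \<Lambda>0: "\<Lambda> > 0" using l l\<Lambda> by linarith
  have R: "R = n / \<Lambda>" by (simp add: R_def n_def \<Lambda>_def)
  have R0: "0 \<le> R" using \<Lambda>0 by (simp add: R)
  show ?thesis
  proof (cases "n < 8")
    case True
    have "R \<le> 8 / \<Lambda>" unfolding R using True \<Lambda>0 by (intro divide_right_mono) auto
    also have "\<dots> \<le> 8 / l" using l l\<Lambda> by (intro divide_left_mono) auto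
    finally show ?thesis using R0 by simp
  next
    case False
    define d where "d = len j"
    have "M j \<noteq> 0" using False j by (simp add: n_def)
    then have d: "d > 0" unfolding d_def by (rule admissible_len_pos[OF adm _ len])
    have "E0_QM (M j) (len j) g \<le> total_energy len g M"
      unfolding total_energy_def
    proof (rule member_le_sum)
      fix i assume "i \<in> {j. M j \<noteq> 0} - {j}"
      then have "len i > 0" by (intro admissible_len_pos[OF adm _ len]) simp
      then show "0 \<le> E0_QM (M i) (len i) g" using g by (intro E0_QM_nonneg) auto
    qed (use finM \<open>M j \<noteq> 0\<close> in auto)
    also have "\<dots> \<le> U"
      using E_LS_QM_upper[where len = len and N = N, OF len less_imp_le[OF g] l J] U unfolding E by linarith
    finally have E0: "E0_QM n d g \<le> U" by (simp add: j n_def d_def)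
    \<comment> \<open>Lowering the coupling makes the energy bound applicable without an upper bound on the length \<open>d\<close>.\<close>
    define g' where "g' = min g (1 / (8 * d))"
    have g': "0 < g'" "g' \<le> g" "g' * d \<le> 1 / 8"
      using g d by (auto simp: g'_def min_def field_simps)
    have low: "3 / 16 * g' * (real n)\<^sup>2 / d \<le> U"
      using E0_QM_lower[OF _ d g', of n] False E0 by linarith
    have d\<Lambda>: "d \<le> \<Lambda>" unfolding d_def by (rule le\<Lambda>)
    show ?thesis
    proof (cases "g' = g")
      case True
      have "R\<^sup>2 = (real n)\<^sup>2 / (\<Lambda> * \<Lambda>)" by (simp add: R power_divide power2_eq_square)
      \<comment> \<open>One factor \<Lambda> is lowered to \<open>d\<close>, to match the energy
        bound, the other to \<open>l\<close>.\<close>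
      also have "\<dots> \<le> (real n)\<^sup>2 / (d * l)"
        using d d\<Lambda> l l\<Lambda> \<Lambda>0 by (intro divide_left_mono mult_mono) auto
      also have "\<dots> \<le> 16 * U / (3 * g * l)" using low d l g by (simp add: True field_simps)
      finally show ?thesis using R0 by simp
    next
      case False
      then have g'd: "g' = 1 / (8 * d)" by (simp add: g'_def min_def split: if_splits)
      have "R\<^sup>2 = (real n)\<^sup>2 / (\<Lambda> * \<Lambda>)" by (simp add: R power_divide power2_eq_square)
      also have "\<dots> \<le> (real n)\<^sup>2 / (d * d)"
        using d d\<Lambda> \<Lambda>0 by (intro divide_left_mono mult_mono) auto
      also have "\<dots> \<le> 128 / 3 * U" using low d by (simp add: g'd field_simps)
      finally show ?thesis using R0 by simp
    qed
  qed
qed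

section \<open>Comparison of constants and rates\<close>

lemma much_less_eventually_le:
  assumes "a \<lless> b" "\<forall>\<^sub>F N in sequentially. 0 \<le> b N"
  shows "\<forall>\<^sub>F N in sequentially. 0 < b N \<and> a N \<le> b N"
proof -
  have "\<forall>\<^sub>F N in sequentially. a N / b N < 1"
    using assms(1) unfolding much_less_def by (intro order_tendstoD(2)) auto
  moreover have "\<forall>\<^sub>F N in sequentially. b N \<noteq> 0" using assms(1) unfolding much_less_def by blast
  ultimately show ?thesis using assms(2)
  proof eventually_elim
    case (elim N)
    then have "b N > 0" by simp
    then show ?case using elim(1) by (simp add: pos_divide_less_eq)
  qed
qed

text \<open>From \<open>pi \<ge> 3\<close> one gets
  \<open>K_const \<eta> \<ge> 2250 / \<eta>\<^sup>2\<close>, hence a Gross-Pitaevskii energy of at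
  least \<open>1125 / \<eta>\<^sup>2\<close> and
  \<open>8 * c1_const \<eta> \<ge> 810000 / \<eta> ^ 4\<close>. Powers of
  \<open>3 * \<eta> \<le> 1\<close> lower the exponent to those produced by the energy
  estimates.\<close>

lemma c1_const_lower:
  assumes "0 < \<eta>" "\<eta> \<le> 1 / 3"
  shows "2430000 / \<eta> ^ 3 \<le> 8 * c1_const \<eta>" "7290000 / \<eta>\<^sup>2 \<le> 8 * c1_const \<eta>"
proof -
  have pi9: "9 \<le> pi\<^sup>2" using power_mono[of 3 pi 2] pi_gt3 by simp
  have K: "2250 / \<eta>\<^sup>2 \<le> K_const \<eta>"
  proof -
    have "2250 \<le> 10 * 5\<^sup>2 * pi\<^sup>2" using pi9 by simp
    then have "2250 / \<eta>\<^sup>2 \<le> 10 * 5\<^sup>2 * pi\<^sup>2 / \<eta>\<^sup>2" by (rule divide_right_mono) simp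
    then show ?thesis by (simp add: K_const_def)
  qed
  have "0 \<le> 2250 / \<eta>\<^sup>2" by simp
  then have "K_const \<eta> / 2 \<le> E_GP 1 1 (K_const \<eta>)" using K by (intro E_GP_lower) linarith
  then have "1125 / \<eta>\<^sup>2 \<le> E_GP 1 1 (K_const \<eta>)" using K by simp
  then have "8 * (90 * (1125 / \<eta>\<^sup>2) / \<eta>\<^sup>2) \<le> 8 * c1_const \<eta>"
    unfolding c1_const_def by (intro mult_left_mono divide_right_mono) auto
  then have main: "810000 / \<eta> ^ 4 \<le> 8 * c1_const \<eta>" by (simp add: power4_eq_xxxx power2_eq_square)
  have "3 * \<eta> \<le> 1" "9 * \<eta>\<^sup>2 \<le> 1" using assms power_mono[of \<eta> "1/3" 2] by (auto simp: power_divide)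
  have "2430000 / \<eta> ^ 3 = 810000 * (3 * \<eta>) / \<eta> ^ 4" using assms by (simp add: field_simps power_eq_if)
  also have "\<dots> \<le> 810000 * 1 / \<eta> ^ 4" using \<open>3 * \<eta> \<le> 1\<close> by (intro divide_right_mono mult_left_mono) auto
  finally show "2430000 / \<eta> ^ 3 \<le> 8 * c1_const \<eta>" using main by simp
  have "7290000 / \<eta>\<^sup>2 = 810000 * (9 * \<eta>\<^sup>2) / \<eta> ^ 4" using assms by (simp add: field_simps power_eq_if)
  also have "\<dots> \<le> 810000 * 1 / \<eta> ^ 4" using \<open>9 * \<eta>\<^sup>2 \<le> 1\<close> by (intro divide_right_mono mult_left_mono) auto
  finally show "7290000 / \<eta>\<^sup>2 \<le> 8 * c1_const \<eta>" using main by simp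
qed

text \<open>Inserting \<open>l\<close>, the first two alternatives are of order
  \<open>v\<^sup>2 * N / (\<eta>\<^sup>2 * L\<^sup>2)\<close> and the third of order
  \<open>v ^ 3 * N / (\<eta> ^ 3 * L ^ 3 * g)\<close>. In the first two
  \<open>M \<le> 2 * L \<le> L\<^sup>2\<close> replaces the logarithms by \<open>M\<close>; in the
  third \<open>1 / L \<le> 2 / M\<close> exchanges one of them. The numerical factors, at most 4 *
  393216 and 2 * 393216, fit into \<open>C\<close>.\<close>

lemma squared_ratio_bound:
  fixes R g v \<eta> L M N U l c1 :: real
  assumes R: "0 \<le> R" "R \<le> 8 / l \<or> R\<^sup>2 \<le> 128 / 3 * U \<or> R\<^sup>2 \<le> 16 * U / (3 * g * l)"
    and U: "U = 9216 * N / l\<^sup>2" and l: "l = \<eta> * L / (2 * v)"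
    and pos: "0 < g" "0 < v" "0 < \<eta>" "2 \<le> L" "0 < M" "M \<le> 2 * L" "1 \<le> N"
    and c1: "2430000 / \<eta> ^ 3 \<le> C" "7290000 / \<eta>\<^sup>2 \<le> C"
  shows "R\<^sup>2 \<le> C * (v\<^sup>2 * N / M) \<or> R\<^sup>2 \<le> C * (v ^ 3 * N / (L\<^sup>2 * g * M))"
proof -
  have l0: "l > 0" using pos by (simp add: l)
  have "M \<le> L\<^sup>2" using pos by (simp add: power2_eq_square) (metis mult_right_mono order_trans less_imp_le zero_less_numeral order_less_le_trans)
  then have inv: "1 / L\<^sup>2 \<le> 1 / M" using pos by (intro divide_left_mono) auto
  have l2: "1 / l\<^sup>2 = 4 * v\<^sup>2 / (\<eta>\<^sup>2 * L\<^sup>2)" by (simp add: l power_divide power_mult_distrib)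
  have C0: "0 \<le> C" by (rule order_trans[OF _ c1(2)]) simp
  have key: "a * N / l\<^sup>2 \<le> C * (v\<^sup>2 * N / M)" if a: "0 \<le> a" "4 * a \<le> 7290000" for a
  proof -
    have "a * N / l\<^sup>2 = a * N * (1 / l\<^sup>2)" by simp
    also have "\<dots> = (4 * a / \<eta>\<^sup>2) * (v\<^sup>2 * N) * (1 / L\<^sup>2)"
      unfolding l2 by (simp add: field_simps)
    also have "\<dots> \<le> C * (v\<^sup>2 * N) * (1 / M)"
    proof (intro mult_mono inv)
      have "4 * a / \<eta>\<^sup>2 \<le> 7290000 / \<eta>\<^sup>2" using a by (intro divide_right_mono) auto
      then show "4 * a / \<eta>\<^sup>2 \<le> C" using c1(2) by linarith
      show "0 \<le> C * (v\<^sup>2 * N)" using C0 pos by simp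
    qed (use pos C0 in auto)
    finally show ?thesis by simp
  qed
  from R(2) consider "R \<le> 8 / l" | "R\<^sup>2 \<le> 128 / 3 * U" | "R\<^sup>2 \<le> 16 * U / (3 * g * l)" by blast
  then show ?thesis
  proof cases
    case 1
    then have "R\<^sup>2 \<le> (8 / l)\<^sup>2" using R(1) by (intro power_mono) auto
    also have "\<dots> = 64 * 1 / l\<^sup>2" by (simp add: power_divide)
    also have "\<dots> \<le> 64 * N / l\<^sup>2" using pos by (intro divide_right_mono mult_left_mono) auto
    also have "\<dots> \<le> C * (v\<^sup>2 * N / M)" by (rule key) auto
    finally show ?thesis by simp
  next
    case 2
    have "128 / 3 * U = 393216 * N / l\<^sup>2" by (simp add: U)
    also have "\<dots> \<le> C * (v\<^sup>2 * N / M)" by (rule key) auto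
    finally have "R\<^sup>2 \<le> C * (v\<^sup>2 * N / M)" using 2 by (rule order_trans[rotated])
    then show ?thesis by (rule disjI1)
  next
    case 3
    have "16 * U / (3 * g * l) = (393216 / \<eta> ^ 3) * (v ^ 3 * N / (L\<^sup>2 * g)) * (1 / L)"
      using pos by (simp add: U l field_simps power2_eq_square power3_eq_cube)
    also have "\<dots> \<le> (393216 / \<eta> ^ 3) * (v ^ 3 * N / (L\<^sup>2 * g)) * (2 / M)"
      using pos by (intro mult_left_mono) (auto simp: field_simps)
    also have "\<dots> = (786432 / \<eta> ^ 3) * (v ^ 3 * N / (L\<^sup>2 * g * M))" by (simp add: field_simps)
    also have "\<dots> \<le> C * (v ^ 3 * N / (L\<^sup>2 * g * M))"
    proof (rule mult_right_mono)
      have "786432 / \<eta> ^ 3 \<le> 2430000 / \<eta> ^ 3" using pos by (intro divide_right_mono) auto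
      then show "786432 / \<eta> ^ 3 \<le> C" using c1(1) by linarith
    qed (use pos in auto)
    finally have "R\<^sup>2 \<le> C * (v ^ 3 * N / (L\<^sup>2 * g * M))" using 3 by (rule order_trans[rotated])
    then show ?thesis by (rule disjI2)
  qed
qed

text \<open>Both alternatives are at most the square
  \<open>C * (v ^ 3 * N / (L\<^sup>2 * \<mu> * M))\<close> of the claimed bound: the second because
  \<open>\<mu> \<le> g\<close>, the first because \<open>N powr (1 / 3) \<ge> 1\<close> forces
  \<open>\<mu> * L\<^sup>2 \<le> v\<close>.\<close>

lemma ratio_le_first_rate:
  fixes R g v \<mu> L M N C :: real
  assumes R: "R\<^sup>2 \<le> C * (v\<^sup>2 * N / M) \<or> R\<^sup>2 \<le> C * (v ^ 3 * N / (L\<^sup>2 * g * M))"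
    and \<mu>: "\<mu> = min g (v / (N powr (1 / 3) * L\<^sup>2))" and pos: "0 < g" "0 < v" "0 < L" "0 < M" "1 \<le> N" "0 \<le> C"
  shows "R \<le> sqrt C * (v powr (3 / 2) / L) * (1 / sqrt M) * \<mu> powr (- 1 / 2) * sqrt N"
proof (rule power2_le_imp_le)
  have N1: "1 \<le> N powr (1 / 3)" using pos by (intro ge_one_powr_ge_zero) auto
  then have "0 < v / (N powr (1 / 3) * L\<^sup>2)" using pos by (intro divide_pos_pos mult_pos_pos) auto
  then have \<mu>0: "\<mu> > 0" using pos by (simp add: \<mu>)
  have "\<mu> * L\<^sup>2 \<le> v / (N powr (1 / 3) * L\<^sup>2) * L\<^sup>2" by (intro mult_right_mono) (auto simp: \<mu>)
  also have "\<dots> = v / N powr (1 / 3)" using pos by simp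
  also have "\<dots> \<le> v" using N1 pos by (simp add: divide_le_eq)
  finally have \<mu>v: "\<mu> * L\<^sup>2 \<le> v" .
  have v3: "(v powr (3 / 2))\<^sup>2 = v ^ 3" using pos by (simp add: powr_power powr_realpow[of v 3, simplified])
  have "(\<mu> powr (- 1 / 2))\<^sup>2 = \<mu> powr (- 1 / 2 + - 1 / 2)" unfolding power2_eq_square powr_add ..
  then have m1: "(\<mu> powr (- 1 / 2))\<^sup>2 = 1 / \<mu>" using \<mu>0 by (simp add: powr_minus_divide)
  have sq: "(sqrt C * (v powr (3 / 2) / L) * (1 / sqrt M) * \<mu> powr (- 1 / 2) * sqrt N)\<^sup>2 = C * (v ^ 3 * N / (L\<^sup>2 * \<mu> * M))"
    unfolding power_mult_distrib power_divide v3 m1 using pos by (simp add: mult_ac)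
  have A: "v\<^sup>2 * N / M \<le> v ^ 3 * N / (L\<^sup>2 * \<mu> * M)"
  proof -
    have "v\<^sup>2 * N / M = v\<^sup>2 * N * (\<mu> * L\<^sup>2) / (L\<^sup>2 * \<mu> * M)" using \<mu>0 pos by simp
    also have "\<dots> \<le> v\<^sup>2 * N * v / (L\<^sup>2 * \<mu> * M)"
      using \<mu>v \<mu>0 pos by (intro divide_right_mono mult_left_mono) auto
    finally show ?thesis by (simp add: power2_eq_square power3_eq_cube algebra_simps)
  qed
  have B: "v ^ 3 * N / (L\<^sup>2 * g * M) \<le> v ^ 3 * N / (L\<^sup>2 * \<mu> * M)"
    using \<mu>0 pos by (intro divide_left_mono mult_right_mono mult_left_mono) (auto simp: \<mu>)
  show "R\<^sup>2 \<le> (sqrt C * (v powr (3 / 2) / L) * (1 / sqrt M) * \<mu> powr (- 1 / 2) * sqrt N)\<^sup>2"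
    unfolding sq using R mult_left_mono[OF A pos(6)] mult_left_mono[OF B pos(6)] by linarith
qed (use pos in auto)

text \<open>The lower bound on \<open>g\<close> turns the second alternative into
  \<open>v\<^sup>2 * N powr (7 / 6) / M\<close>, and 7/6 is below 6/5, twice the exponent 3/5; the
  first alternative has the exponent 1 only.\<close>

lemma ratio_le_second_rate:
  fixes R g v L M N C \<delta> :: real
  assumes R: "R\<^sup>2 \<le> C * (v\<^sup>2 * N / M) \<or> R\<^sup>2 \<le> C * (v ^ 3 * N / (L\<^sup>2 * g * M))"
    and g: "v * N powr (- 1 / 6) / L\<^sup>2 \<le> g" and pos: "0 < g" "0 < v" "0 < L" "0 < M" "1 \<le> N" "0 \<le> C" "0 < \<delta>"
  shows "R \<le> sqrt C * (v / sqrt M) * N powr (3 / 5 + \<delta>)"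
proof (rule power2_le_imp_le)
  have sq: "(sqrt C * (v / sqrt M) * N powr (3 / 5 + \<delta>))\<^sup>2 = C * (v\<^sup>2 * N powr (6 / 5 + 2 * \<delta>) / M)"
    using pos by (simp add: power_mult_distrib power_divide powr_power algebra_simps)
  have "N powr 1 \<le> N powr (6 / 5 + 2 * \<delta>)" using pos by (intro powr_mono) auto
  then have A: "v\<^sup>2 * N / M \<le> v\<^sup>2 * N powr (6 / 5 + 2 * \<delta>) / M"
    using pos by (intro divide_right_mono mult_left_mono) auto
  have B: "v ^ 3 * N / (L\<^sup>2 * g * M) \<le> v\<^sup>2 * N powr (6 / 5 + 2 * \<delta>) / M"
  proof -
    have le: "v * N powr (- 1 / 6) \<le> g * L\<^sup>2" using g pos by (simp add: pos_divide_le_eq)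
    have "N powr (- 1 / 6) * N powr (7 / 6) = N powr (- 1 / 6 + 7 / 6)" unfolding powr_add ..
    then have one: "N powr (- 1 / 6) * N powr (7 / 6) = N" using pos by simp
    have "v * N = v * N powr (- 1 / 6) * N powr (7 / 6)" unfolding mult.assoc one ..
    also have "\<dots> \<le> g * L\<^sup>2 * N powr (7 / 6)" using le by (rule mult_right_mono) simp
    also have "\<dots> \<le> g * L\<^sup>2 * N powr (6 / 5 + 2 * \<delta>)"
      using pos by (intro mult_left_mono powr_mono) auto
    finally have vN: "v * N \<le> N powr (6 / 5 + 2 * \<delta>) * (L\<^sup>2 * g)" by (simp add: mult_ac)
    have "v ^ 3 * N / (L\<^sup>2 * g * M) = v\<^sup>2 * (v * N) / (L\<^sup>2 * g * M)" by (simp add: power2_eq_square power3_eq_cube mult.assoc)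
    also have "\<dots> \<le> v\<^sup>2 * (N powr (6 / 5 + 2 * \<delta>) * (L\<^sup>2 * g)) / (L\<^sup>2 * g * M)"
      using vN pos by (intro divide_right_mono mult_left_mono) auto
    also have "\<dots> = v\<^sup>2 * N powr (6 / 5 + 2 * \<delta>) / M" using pos by simp
    finally show ?thesis .
  qed
  show "R\<^sup>2 \<le> (sqrt C * (v / sqrt M) * N powr (3 / 5 + \<delta>))\<^sup>2"
    unfolding sq using R mult_left_mono[OF A pos(6)] mult_left_mono[OF B pos(6)] by linarith
qed (use pos in auto)

text \<open>Randomness enters the estimates through the long cells; given these, the energy
  comparison is deterministic and holds for all large \<open>N\<close>. The lower bound on \<nu>N
  makes the number of long cells and the logarithm of \<open>\<nu>N N * N\<close> positive, and the
  upper bound on \<open>g\<close> makes the interaction negligible in the trial energy. Reading the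
  first bound as infinite for vanishing coupling is the premise
  \<open>g N \<noteq> 0\<close>.\<close>

theorem theorem3p4:
  fixes P :: "'w measure"
    and x :: "'w \<Rightarrow> int \<Rightarrow> real"
    and \<nu> \<rho> \<eta> :: real
    and s \<nu>N g :: "nat \<Rightarrow> real"
    and occ :: "nat \<Rightarrow> 'w \<Rightarrow> int \<Rightarrow> nat"
  assumes "\<nu> > 0" and "\<rho> > 0"
    and "prob_space P"
    and "poisson_process P \<nu> (\<lambda>\<omega>. range (x \<omega>))"
    and "AE \<omega> in P. strict_mono (x \<omega>) \<and> 0 \<in> {x \<omega> 0 <..< x \<omega> 1}"
    and "\<And>N. N \<ge> 1 \<Longrightarrow> 0 < s N \<and> s N \<le> 1"
    and "\<And>N. \<nu>N N = \<nu> * s N"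
    and "\<And>N. N \<ge> 1 \<Longrightarrow> 0 \<le> g N"
    and "0 < \<eta>" and "\<eta> \<le> 1 / 3"
    and "(\<lambda>N. (ln (real N)) ^ 4 / real N powr (1 - 2 * \<eta>)) \<lless> \<nu>N"
    and "\<nu>N \<lesssim> (\<lambda>_. 1)"
    and "g \<lless> (\<lambda>N. (\<nu>N N)\<^sup>2 * real N powr (- \<eta>) / (ln (real N))\<^sup>2)"
    and "AE \<omega> in P. \<forall>N\<ge>1.
      ground_state_occupation (cell_length \<rho> (s N) (x \<omega>) N) N (g N) (occ N \<omega>)"
  shows "(AE \<omega> in P. \<forall>\<^sub>F N in sequentially. g N \<noteq> 0 \<longrightarrow>
      real (Max (range (occ N \<omega>))) / Max (range (cell_length \<rho> (s N) (x \<omega>) N)) \<le>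
        sqrt (8 * c1_const \<eta>) * (\<nu>N N powr (3 / 2) / ln (real N)) *
        (1 / sqrt (ln (\<nu>N N * real N))) *
        (min (g N) (\<nu>N N / (real N powr (1 / 3) * (ln (real N))\<^sup>2))) powr (- 1 / 2) *
        sqrt (real N))
    \<and> (\<eta> < 1 / 6 \<longrightarrow> (\<lambda>N. \<nu>N N * real N powr (- 1 / 6) / (ln (real N))\<^sup>2) \<lless> g \<longrightarrow>
      (\<forall>\<delta>>0. AE \<omega> in P. \<forall>\<^sub>F N in sequentially.
        real (Max (range (occ N \<omega>))) / Max (range (cell_length \<rho> (s N) (x \<omega>) N)) \<le>
          sqrt (8 * c1_const \<eta>) * (\<nu>N N / sqrt (ln (\<nu>N N * real N))) *
          real N powr (3 / 5 + \<delta>)))"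
proof -
  define L where "L N = ln (real N)" for N :: nat
  define M where "M N = ln (\<nu>N N * real N)" for N
  define l where "l N = \<eta> * L N / (2 * \<nu>N N)" for N
  define m where "m N = nat \<lfloor>\<nu> * s N * real N powr (1 - \<eta> / 2) / (\<rho> * (ln (real N))\<^sup>2)\<rfloor>" for N
  define R where "R N \<omega> = real (Max (range (occ N \<omega>))) / Max (range (cell_length \<rho> (s N) (x \<omega>) N))" for N \<omega>
  \<comment> \<open>Twice the kinetic part \<open>4608 * N / (l N)\<^sup>2\<close> of the trial
    energy: for large \<open>N\<close> the interaction is at most as large.\<close>
  define U where "U N = 9216 * real N / (l N)\<^sup>2" for N
  define C where "C = 8 * c1_const \<eta>"
  have C: "2430000 / \<eta> ^ 3 \<le> C" "7290000 / \<eta>\<^sup>2 \<le> C"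
    unfolding C_def by (rule c1_const_lower[OF assms(9,10)])+
  have C0: "0 \<le> C" using C(2) by (rule order_trans[rotated]) simp
  have pos: "\<forall>\<^sub>F N in sequentially. 0 < \<nu>N N \<and> \<nu>N N \<le> \<nu> \<and> 0 \<le> g N"
    using eventually_ge_at_top[of 1]
  proof eventually_elim
    case (elim N)
    then show ?case using assms(6)[of N] assms(8)[of N] \<open>\<nu> > 0\<close> by (simp add: assms(7) mult_left_le)
  qed
  have nn: "\<forall>\<^sub>F N in sequentially. 0 \<le> \<nu>N N" using pos by (rule eventually_mono) simp
  have lower: "\<forall>\<^sub>F N in sequentially. L N ^ 4 / real N powr (1 - 2 * \<eta>) \<le> \<nu>N N"
    using much_less_eventually_le[OF assms(11) nn] by (rule eventually_mono) (simp add: L_def)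
  have gup: "\<forall>\<^sub>F N in sequentially. g N \<le> (\<nu>N N)\<^sup>2 * real N powr (- \<eta>) / (L N)\<^sup>2"
    using much_less_eventually_le[OF assms(13)] unfolding L_def by (rule eventually_mono) auto
  \<comment> \<open>In this order the thresholds provide \<open>2 \<le> L N\<close>,
    \<open>M N \<le> 2 * L N\<close>, \<open>0 < M N\<close>, at least two long cells, absorption of
    the rounding \<open>+ 1\<close> in the occupation, and an interaction below the kinetic
    energy.\<close>
  have asym: "\<forall>\<^sub>F N in sequentially. 2 \<le> ln (real N)"
      "\<forall>\<^sub>F N in sequentially. \<nu> \<le> real N"
      "\<forall>\<^sub>F N in sequentially. 1 < ln (real N) ^ 4 * real N powr (2 * \<eta>)"
      "\<forall>\<^sub>F N in sequentially. 2 * \<rho> \<le> ln (real N) ^ 2 * real N powr (3 / 2 * \<eta>)"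
      "\<forall>\<^sub>F N in sequentially. \<nu> \<le> 2 * \<rho> * (real N powr (\<eta> / 2) * (ln (real N))\<^sup>2)"
      "\<forall>\<^sub>F N in sequentially. 36 * \<rho> * \<eta> * (real N powr (- \<eta> / 2) * ln (real N)) \<le> 4608"
    using assms(1,2,9) by real_asymp+
  have facts: "\<forall>\<^sub>F N in sequentially. 1 \<le> N \<and> 0 < \<nu>N N \<and> 0 \<le> g N \<and> 2 \<le> L N \<and> 0 < M N \<and> M N \<le> 2 * L N \<and> 0 < m N \<and>
      (0 < g N \<longrightarrow> real N * (4608 / (l N)\<^sup>2 + 18 * g N * (real N / m N + 1) / l N) \<le> U N)"
    using eventually_ge_at_top[of 1] pos lower gup asym
  proof eventually_elim
    case (elim N)
    have N: "real N > 0" "real N \<ge> 1" using elim(1) by auto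
    have v: "0 < \<nu>N N" "\<nu>N N \<le> \<nu>" "0 \<le> g N" using elim(2) by auto
    have L2: "2 \<le> L N" using elim(5) by (simp add: L_def)
    have vN: "L N ^ 4 * real N powr (2 * \<eta>) \<le> \<nu>N N * real N"
    proof -
      have "L N ^ 4 * real N powr (2 * \<eta>) = L N ^ 4 / real N powr (1 - 2 * \<eta>) * real N"
        using N by (simp add: powr_diff)
      also have "\<dots> \<le> \<nu>N N * real N" using elim(3) N by (intro mult_right_mono) auto
      finally show ?thesis .
    qed
    then have "1 < \<nu>N N * real N" using elim(7) by (simp add: L_def)
    then have M0: "0 < M N" by (simp add: M_def)
    have "\<nu>N N * real N \<le> real N * real N" using v elim(6) by (intro mult_right_mono) auto
    then have "M N \<le> ln (real N * real N)" unfolding M_def using v N by (intro ln_mono) auto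
    then have M2: "M N \<le> 2 * L N" using N by (simp add: L_def ln_mult)
    have l0: "0 < l N" using L2 v assms(9) by (simp add: l_def)
    \<comment> \<open>The number of long cells before rounding down. By \<open>vN\<close> it is at
      least \<open>(L N)\<^sup>2 * N powr (3 / 2 * \<eta>) / \<rho>\<close>, hence at least 2, and
      rounding loses at most half of it.\<close>
    define w where "w = \<nu>N N * real N powr (1 - \<eta> / 2) / (\<rho> * (L N)\<^sup>2)"
    have "2 \<le> w"
    proof -
      have "2 * \<rho> * (L N)\<^sup>2 \<le> L N ^ 2 * real N powr (3 / 2 * \<eta>) * (L N)\<^sup>2"
        using elim(8) by (intro mult_right_mono) (auto simp: L_def)
      also have "\<dots> = L N ^ 4 * real N powr (2 * \<eta>) * real N powr (- \<eta> / 2)"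
        by (simp add: power4_eq_xxxx power2_eq_square mult.assoc flip: powr_add)
      also have "\<dots> \<le> \<nu>N N * real N * real N powr (- \<eta> / 2)" using vN by (intro mult_right_mono) auto
      also have "\<dots> = \<nu>N N * real N powr (1 - \<eta> / 2)"
        using N powr_add[of "real N" 1 "- \<eta> / 2"] by simp
      finally show ?thesis using assms(2) L2 by (simp add: w_def pos_le_divide_eq)
    qed
    have m: "m N = nat \<lfloor>w\<rfloor>" by (simp add: m_def w_def L_def assms(7))
    have mw: "w / 2 \<le> m N" using \<open>2 \<le> w\<close> unfolding m by linarith
    have m0: "0 < m N" using \<open>2 \<le> w\<close> unfolding m by simp
    have "real N * (4608 / (l N)\<^sup>2 + 18 * g N * (real N / m N + 1) / l N) \<le> U N"
    proof -
      have p: "real N powr (1 - \<eta> / 2) * real N powr (\<eta> / 2) = real N" using N by (simp flip: powr_add)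
      have "real N / m N \<le> real N / (w / 2)" using mw \<open>2 \<le> w\<close> N m0 by (intro divide_left_mono) auto
      also have "\<dots> = 2 * \<rho> * (real N powr (\<eta> / 2) * (L N)\<^sup>2) / \<nu>N N"
      proof -
        have "real N / (w / 2) = 2 * (real N powr (1 - \<eta> / 2) * real N powr (\<eta> / 2)) / w" by (simp add: p)
        also have "\<dots> = 2 * \<rho> * (real N powr (\<eta> / 2) * (L N)\<^sup>2) / \<nu>N N"
          using N v L2 assms(2) by (simp add: w_def)
        finally show ?thesis .
      qed
      finally have 1: "real N / m N \<le> 2 * \<rho> * (real N powr (\<eta> / 2) * (L N)\<^sup>2) / \<nu>N N" .
      have "\<nu>N N \<le> 2 * \<rho> * (real N powr (\<eta> / 2) * (L N)\<^sup>2)" using elim(9) v by (simp add: L_def)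
      then have "1 \<le> 2 * \<rho> * (real N powr (\<eta> / 2) * (L N)\<^sup>2) / \<nu>N N" using v by (simp add: pos_le_divide_eq)
      with 1 have 2: "real N / m N + 1 \<le> 4 * \<rho> * (real N powr (\<eta> / 2) * (L N)\<^sup>2) / \<nu>N N" by simp
      \<comment> \<open>Multiplied by \<open>(l N)\<^sup>2\<close>, the interaction is compared with
        the constant 4608. The powers of \<nu>N cancel completely, and of the logarithms a single
        one survives, which \<open>N powr (- \<eta> / 2)\<close> absorbs.\<close>
      have "18 * g N * (real N / m N + 1) * l N \<le>
          18 * ((\<nu>N N)\<^sup>2 * real N powr (- \<eta>) / (L N)\<^sup>2) * (4 * \<rho> * (real N powr (\<eta> / 2) * (L N)\<^sup>2) / \<nu>N N) * l N"
        using elim(4) 2 v l0 by (intro mult_right_mono mult_mono) (auto intro: add_nonneg_nonneg)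
      also have "\<dots> = 36 * \<rho> * \<eta> * (real N powr (- \<eta>) * real N powr (\<eta> / 2) * L N)"
        using v L2 by (simp add: l_def power2_eq_square field_simps)
      also have "real N powr (- \<eta>) * real N powr (\<eta> / 2) = real N powr (- \<eta> / 2)" by (simp flip: powr_add)
      also have "36 * \<rho> * \<eta> * (real N powr (- \<eta> / 2) * L N) \<le> 4608" using elim(10) by (simp add: L_def)
      finally have "18 * g N * (real N / m N + 1) * l N / (l N)\<^sup>2 \<le> 4608 / (l N)\<^sup>2" by (rule divide_right_mono) simp
      then have "18 * g N * (real N / m N + 1) / l N \<le> 4608 / (l N)\<^sup>2" using l0 by (simp add: power2_eq_square)
      then have "4608 / (l N)\<^sup>2 + 18 * g N * (real N / m N + 1) / l N \<le> 9216 / (l N)\<^sup>2" by simp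
      then have "real N * (4608 / (l N)\<^sup>2 + 18 * g N * (real N / m N + 1) / l N) \<le> real N * (9216 / (l N)\<^sup>2)"
        using N by (intro mult_left_mono) auto
      then show ?thesis by (simp add: U_def)
    qed
    then show ?case using elim(1) v L2 M0 M2 m0 by blast
  qed
  have mono: "AE \<omega> in P. strict_mono (x \<omega>)" using assms(5) by (auto elim: eventually_mono)
  \<comment> \<open>The cell lemma is applied with \<open>c = \<eta> / 2\<close>, and
    \<open>\<eta> \<le> 1 / 3\<close> is what makes \<open>c \<le> 1 / 6\<close>; this choice is
    behind the form of \<open>l N\<close> and \<open>m N\<close>.\<close>
  have cells: "AE \<omega> in P. \<forall>\<^sub>F N in sequentially. \<exists>J. finite J \<and> card J = m N \<and>
      (\<forall>j\<in>J. \<eta> / 2 * ln (real N) / (\<nu> * s N) \<le> cell_length \<rho> (s N) (x \<omega>) N j)"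
    unfolding m_def using assms(9,10)
    by (intro eventually_many_long_cells[OF assms(3,4) mono assms(1,2,6)]) auto
  have lf: "AE \<omega> in P. \<forall>B. bounded B \<longrightarrow> finite (range (x \<omega>) \<inter> B)"
    using assms(4) by (simp add: poisson_process_def)
  \<comment> \<open>The squared bound common to both claims, which differ in how the coupling is
    estimated afterwards.\<close>
  have main: "AE \<omega> in P. \<forall>\<^sub>F N in sequentially. g N \<noteq> 0 \<longrightarrow>
      R N \<omega> ^ 2 \<le> C * ((\<nu>N N)\<^sup>2 * real N / M N) \<or> R N \<omega> ^ 2 \<le> C * (\<nu>N N ^ 3 * real N / ((L N)\<^sup>2 * g N * M N))"
    using cells lf mono assms(14)
  proof eventually_elim
    case (elim \<omega>)
    from elim(1) facts show ?case
    proof eventually_elim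
      case N: (elim N)
      show ?case
      proof
        assume "g N \<noteq> 0"
        then have g: "0 < g N" using N(2) by auto
        have s: "0 < s N" using N(2) assms(6) by blast
        have f: "0 < \<nu>N N" "2 \<le> L N" "0 < M N" "M N \<le> 2 * L N" "0 < m N" "1 \<le> real N" using N(2) by auto
        obtain J where J: "finite J" "card J = m N"
          "\<And>j. j \<in> J \<Longrightarrow> \<eta> / 2 * ln (real N) / (\<nu> * s N) \<le> cell_length \<rho> (s N) (x \<omega>) N j" using N(1) by blast
        have Jne: "J \<noteq> {}" using J(2) f(5) by auto
        have l0: "0 < l N" using f assms(9) by (simp add: l_def)
        have lJ: "l N \<le> cell_length \<rho> (s N) (x \<omega>) N j" if "j \<in> J" for j
          using J(3)[OF that] by (simp add: l_def L_def assms(7))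
        have fin: "finite (range (cell_length \<rho> (s N) (x \<omega>) N))"
          by (rule finite_range_cell_length[OF elim(3) elim(2)[rule_format] s assms(2)])
        have gs: "ground_state_occupation (cell_length \<rho> (s N) (x \<omega>) N) N (g N) (occ N \<omega>)"
          using elim(4) N(2) by blast
        have U: "real N * (4608 / (l N)\<^sup>2 + 18 * g N * (real N / card J + 1) / l N) \<le> U N"
          using N(2) g unfolding J(2) by blast
        have B: "0 \<le> R N \<omega> \<and> (R N \<omega> \<le> 8 / l N \<or> (R N \<omega>)\<^sup>2 \<le> 128 / 3 * U N \<or> (R N \<omega>)\<^sup>2 \<le> 16 * U N / (3 * g N * l N))"
          unfolding R_def by (rule max_occupation_bound[OF cell_length_nonneg fin g l0 J(1) Jne lJ gs U])
        show "R N \<omega> ^ 2 \<le> C * ((\<nu>N N)\<^sup>2 * real N / M N) \<or> R N \<omega> ^ 2 \<le> C * (\<nu>N N ^ 3 * real N / ((L N)\<^sup>2 * g N * M N))"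
          by (rule squared_ratio_bound[OF B[THEN conjunct1] B[THEN conjunct2] U_def l_def g f(1) assms(9) f(2,3,4,6) C])
      qed
    qed
  qed
  show ?thesis
  proof (intro conjI impI allI)
    show "AE \<omega> in P. \<forall>\<^sub>F N in sequentially. g N \<noteq> 0 \<longrightarrow>
      real (Max (range (occ N \<omega>))) / Max (range (cell_length \<rho> (s N) (x \<omega>) N)) \<le>
        sqrt (8 * c1_const \<eta>) * (\<nu>N N powr (3 / 2) / ln (real N)) *
        (1 / sqrt (ln (\<nu>N N * real N))) *
        (min (g N) (\<nu>N N / (real N powr (1 / 3) * (ln (real N))\<^sup>2))) powr (- 1 / 2) *
        sqrt (real N)"
      using main
    proof eventually_elim
      case (elim \<omega>)
      from elim facts show ?case
      proof eventually_elim
        case N: (elim N)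
        show ?case
        proof
          assume gn: "g N \<noteq> 0"
          have f: "0 < g N" "0 < \<nu>N N" "0 < L N" "0 < M N" "1 \<le> real N" using N(2) gn by auto
          show "real (Max (range (occ N \<omega>))) / Max (range (cell_length \<rho> (s N) (x \<omega>) N)) \<le>
            sqrt (8 * c1_const \<eta>) * (\<nu>N N powr (3 / 2) / ln (real N)) *
            (1 / sqrt (ln (\<nu>N N * real N))) *
            (min (g N) (\<nu>N N / (real N powr (1 / 3) * (ln (real N))\<^sup>2))) powr (- 1 / 2) *
            sqrt (real N)"
            using ratio_le_first_rate[OF N(1)[rule_format, OF gn] refl f C0] unfolding R_def C_def L_def M_def .
        qed
      qed
    qed
  next
    fix \<delta> :: real
    assume gl: "(\<lambda>N. \<nu>N N * real N powr (- 1 / 6) / (ln (real N))\<^sup>2) \<lless> g" and \<delta>: "0 < \<delta>"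
    have "\<forall>\<^sub>F N in sequentially. 0 \<le> g N" using pos by (rule eventually_mono) simp
    from much_less_eventually_le[OF gl this]
    have gl': "\<forall>\<^sub>F N in sequentially. 0 < g N \<and> \<nu>N N * real N powr (- 1 / 6) / (L N)\<^sup>2 \<le> g N" unfolding L_def .
    show "AE \<omega> in P. \<forall>\<^sub>F N in sequentially.
        real (Max (range (occ N \<omega>))) / Max (range (cell_length \<rho> (s N) (x \<omega>) N)) \<le>
          sqrt (8 * c1_const \<eta>) * (\<nu>N N / sqrt (ln (\<nu>N N * real N))) *
          real N powr (3 / 5 + \<delta>)"
      using main
    proof eventually_elim
      case (elim \<omega>)
      from elim facts gl' show ?case
      proof eventually_elim
        case N: (elim N)
        have gn: "g N \<noteq> 0" using N(3) by simp
        have f: "0 < g N" "0 < \<nu>N N" "0 < L N" "0 < M N" "1 \<le> real N" using N(2,3) by auto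
        show ?case
          using ratio_le_second_rate[OF N(1)[rule_format, OF gn] N(3)[THEN conjunct2] f C0 \<delta>] unfolding R_def C_def M_def .
      qed
    qed
  qed
qed

end
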